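(* Let $A\ne B$ be complex numbers with $|A|>1$, $|B|>1$ and such that $0$ does not lie on the segment $[1/A,1/B]$. Let $f(z)=\left[\left(A-\frac1{\varphi(z)}\right)\left(B-\frac1{\varphi(z)}\right)\right]^{-1/2}$ be a holomorphic branch in $\overline{\mathbb C}\setminus[-1,1]$ and let $f_\infty$ be its germ at $z=\infty$. For $n\in\mathbb N$ let $Q_{3n},P_{3n,1},P_{3n,2},P_{3n,3}$ be polynomials of degree at most $3n$, $Q_{3n}\not\equiv0$, with $$(Q_{3n}f_\infty^j-P_{3n,j})(z)=O\left(\frac1{z^{n+1}}\right),\quad z\to\infty,\qquad j=1,2,3.$$ Let $\Delta_n(\mathbf z)=\det\left[\Psi_{n,k}(z^{(j)})\right]_{j=1,2,3;\,k=1,2,3}$ be the determinant defined in the context. Assume that there exists an infinite sequence $\Lambda\subset\mathbb N$ such that, for some finite set of points $\mathbf M=\{\mathbf z_1,\dots,\mathbf z_M\}\subset\mathfrak R_4(f)$ independent of $n\in\Lambda$ and for an arbitrary compact set $\mathbf K\subset\mathfrak R_4(f)\setminus\mathbf M$, $$0<C_1(\mathbf K)\le|\Delta_n(\mathbf z)|\le C_2(\mathbf K)<\infty,\quad \mathbf z\in\mathbf K,\quad n\in\Lambda,$$ with constants $C_1(\mathbf K),C_2(\mathbf K)$ independent of $n$. Then: 1) as $n\to\infty$, $n\in\Lambda$, the compact set $E$ (the projection to $\overline{\mathbb C}$ of the boundary between the first and second sheets of the Nuttall partition of $\mathfrak R_4(f)$) attracts all zeros of the polynomials $Q_{3n}$,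 except possibly a finite number (independent of $n$) of zeros; 2) as $n\to\infty$, $n\in\Lambda$, $$\frac{P_{3n,1}}{Q_{3n}}(z)\overset{\mathrm{cap}}\longrightarrow f(z^{(1)}),\quad z\in\overline{\mathbb C}\setminus E,$$ where $z^{(1)}$ is the point over $z$ on the first sheet of the Nuttall partition.
   Context: $\varphi(z)=z+(z^2-1)^{1/2}$ for $z\in\overline{\mathbb C}\setminus[-1,1]$, with the branch such that $(z^2-1)^{1/2}/z\to1$ as $z\to\infty$ (so $|\varphi|>1$). Riemann surface: let $\tilde F=[1/A,1/B]$ be the closed segment in the $\zeta$-plane, and let $\tilde f$ be the holomorphic branch of $[(A-1/\zeta)(B-1/\zeta)]^{-1/2}$ in $\overline{\mathbb C}_\zeta\setminus\tilde F$ with $\tilde f(\varphi(z))=f(z)$. The surface $\mathfrak R_4(f)$ is obtained from two copies of $\overline{\mathbb C}_\zeta$ cut along $\tilde F$, glued crosswise along the cut. The projection $\pi_4:\mathfrak R_4(f)\to\overline{\mathbb C}$ is $z=\frac12(\zeta+1/\zeta)$ on both copies (a four-sheeted covering, of genus $0$). $f$ is the single-valued meromorphic function on $\mathfrak R_4(f)$ equal to $\tilde f$ on the first copy and $-\tilde f$ on the second; its only poles are simple poles at the branch points $\mathbf a,\mathbf b$ over $\zeta=1/A$, $\zeta=1/B$. Nuttall partition: let $g_{\tilde F}(\zeta,\infty)$ be the Green function of $\overline{\mathbb C}\setminus\tilde F$ with singularity at $\infty$. Let $u$ be the function on $\mathfrak R_4(f)$ equal to $-2g_{\tilde F}(\zeta,\infty)-\log|\zeta|$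 on the first copy and $2g_{\tilde F}(\zeta,\infty)-\log|\zeta|$ on the second. It is harmonic except at the four points over $z=\infty$: $\infty^{(1)}$ ($\zeta=\infty$, first copy), where $u=-3\log|z|+O(1)$, and $\infty^{(2)}$ ($\zeta=0$, first copy), $\infty^{(3)}$ ($\zeta=0$, second copy), $\infty^{(4)}$ ($\zeta=\infty$, second copy), where $u=\log|z|+O(1)$. The sheets are defined by ordering the four points over $z$ so that $u(z^{(1)})<u(z^{(2)})<u(z^{(3)})<u(z^{(4)})$. $E=\{z:u(z^{(1)})=u(z^{(2)})\}$ (values ordered increasingly) is the projection of the boundary between sheets 1 and 2. Type I polynomials and remainders: for $\mathbf n_1=(n,n-1,n-1)$, $\mathbf n_2=(n-1,n,n-1)$, $\mathbf n_3=(n-1,n-1,n)$ let $Q_{\mathbf n_k,0}$ be a polynomial of degree at most $n$ and $Q_{\mathbf n_k,i}$, $i=1,2,3$, polynomials of degree at most the $i$-th component of $\mathbf n_k$, not identically zero, such that $R_{\mathbf n_k}:=Q_{\mathbf n_k,0}+Q_{\mathbf n_k,1}f_\infty+Q_{\mathbf n_k,2}f_\infty^2+Q_{\mathbf n_k,3}f_\infty^3=O(z^{-3n-1})$ as $z\to\infty$. $R_{\mathbf n_k}$ extends to a meromorphic function on $\mathfrak R_4(f)$ (replace $f_\infty$ by $f$), and the points $\mathbf p_{k,j}(n)$ are defined through its divisor: $$(R_{\mathbf n_k})=(3n+1)\infty^{(1)}-n\infty^{(2)}-n\infty^{(3)}-n\infty^{(4)}-3(\mathbf a+\mathbf b)+\sum_{j=1}^5\mathbf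 p_{k,j}(n),\quad k=1,2,3,$$ cancellations being allowed. The functions $\Psi_{n,k}$ and $\Delta_n$: for distinct $\mathbf z_1,\mathbf z_2\in\mathfrak R_4(f)$, $G(\mathbf z_1,\mathbf z_2;\mathbf z)$ is an Abelian integral of the third kind on $\mathfrak R_4(f)$ with purely imaginary periods and only logarithmic singularities at $\mathbf z_1,\mathbf z_2$: in a local coordinate $\zeta$, $G=-\log\zeta+O(1)$ as $\mathbf z\to\mathbf z_1$ and $G=\log\zeta+O(1)$ as $\mathbf z\to\mathbf z_2$ (so $\exp G$ has a simple pole at $\mathbf z_1$ and a simple zero at $\mathbf z_2$); $G$ is determined up to an additive constant, which is fixed for each pair (and $\exp G$ is a nonzero constant if $\mathbf z_1=\mathbf z_2$). Let $\mathbf a_1,\dots,\mathbf a_6$ be the poles of $f^3$ on $\mathfrak R_4(f)$ listed with multiplicity (three times $\mathbf a$ and three times $\mathbf b$). Put $$\Psi_{n,k}(\mathbf z)=\exp\left\{\sum_{j=1}^5G(\mathbf a_j,\mathbf p_{k,j}(n);\mathbf z)\right\},\quad k=1,2,3,$$ and $\Delta_n(\mathbf z)=\det[\Psi_{n,k}(z^{(j)})]_{j=1,2,3;\,k=1,2,3}$ with $z=\pi_4(\mathbf z)$ (boundary values are used where $z$ lies on the projection of a boundary between sheets). "Attracts all zeros except possibly a finite number independent of $n$" means: there is $N$ such that for every neighbourhood $U$ of the compact set, for all large $n\in\Lambda$ at most $N$ zeros (with multiplicity) lie outside $U$. $h_n\overset{\mathrm{cap}}\longrightarrow h$ in a domain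 $D$ means convergence in logarithmic capacity on compact subsets: for every compact $K\subset D$ and $\varepsilon>0$, $\mathrm{cap}\{z\in K:|h_n(z)-h(z)|\ge\varepsilon\}\to0$ (near $\infty$, in a local coordinate). *)

theory Defs
  imports
    "HOL-Complex_Analysis.Complex_Analysis"
    "HOL-Probability.Probability_Measure"
    "HOL-Library.Landau_Symbols"
begin

section \<open>The Riemann sphere\<close>

text \<open>
  The extended plane is \<^typ>\<open>complex option\<close>, with \<^term>\<open>None\<close> as the point at infinity.
\<close>

abbreviation sphere_top :: "complex option topology" where
  "sphere_top \<equiv> Alexandroff_compactification euclidean"

definition sphere_chart :: "complex option \<Rightarrow> complex \<Rightarrow> complex option" where
  "sphere_chart p t = (case p of Some s \<Rightarrow> Some (s + t)
                               | None \<Rightarrow> if t = 0 then None else Some (1 / t))"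

text \<open>
  Meromorphic functions on the sphere are represented by complex-valued functions which are
  continuous off the poles and take the dummy value 0 at the poles, as in
  \<^const>\<open>nicely_meromorphic_on\<close>.
\<close>

definition sphere_meromorphic :: "(complex option \<Rightarrow> complex) \<Rightarrow> bool" where
  "sphere_meromorphic h \<longleftrightarrow> (\<forall>p. (\<lambda>t. h (sphere_chart p t)) nicely_meromorphic_on {0})"

definition sphere_order :: "(complex option \<Rightarrow> complex) \<Rightarrow> complex option \<Rightarrow> int" where
  "sphere_order h p = zorder (\<lambda>t. h (sphere_chart p t)) 0"


section \<open>Green functions and logarithmic capacity\<close>

text \<open>Twice continuously differentiable with vanishing Laplacian.\<close>

definition harmonic_on :: "(complex \<Rightarrow> real) \<Rightarrow> complex set \<Rightarrow> bool" where
  "harmonic_on v S \<longleftrightarrow> open S \<and>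
     (\<exists>vx vy vxx vxy vyy.
        (\<forall>z\<in>S. (v has_derivative (\<lambda>h. vx z * Re h + vy z * Im h)) (at z) \<and>
               (vx has_derivative (\<lambda>h. vxx z * Re h + vxy z * Im h)) (at z) \<and>
               (vy has_derivative (\<lambda>h. vxy z * Re h + vyy z * Im h)) (at z) \<and>
               vxx z + vyy z = 0) \<and>
        continuous_on S vxx \<and> continuous_on S vxy \<and> continuous_on S vyy)"

text \<open>
  Green function of the complement of \<^term>\<open>S\<close> in the sphere with singularity at infinity, for a
  compact set \<^term>\<open>S\<close> (such as a segment) all of whose points are regular for the Dirichlet
  problem. Its values on \<^term>\<open>S\<close> itself are not constrained.
\<close>

definition green_function_at_infinity :: "complex set \<Rightarrow> (complex \<Rightarrow> real) \<Rightarrow> bool" where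
  "green_function_at_infinity S g \<longleftrightarrow>
     harmonic_on g (- S) \<and>
     (\<forall>\<zeta>\<in>S. (g \<longlongrightarrow> 0) (at \<zeta> within - S)) \<and>
     (\<exists>c. ((\<lambda>\<zeta>. g \<zeta> - ln (norm \<zeta>)) \<longlongrightarrow> c) at_infinity)"

text \<open>
  The energy is the double integral of the kernel \<open>log (1 / dist z w)\<close>, split into its positive
  and its negative part; the kernel is infinite on the diagonal, and the integral of its negative
  part is finite for a finite measure with compact support.
\<close>

definition log_energy :: "complex measure \<Rightarrow> ereal" where
  "log_energy \<mu> =
     enn2ereal (\<integral>\<^sup>+ z. \<integral>\<^sup>+ w. (if z = w then \<infinity> else ennreal (- ln (dist z w))) \<partial>\<mu> \<partial>\<mu>)
     - enn2ereal (\<integral>\<^sup>+ z. \<integral>\<^sup>+ w. ennreal (ln (dist z w)) \<partial>\<mu> \<partial>\<mu>)"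

definition log_capacity :: "complex set \<Rightarrow> ennreal" where
  "log_capacity S =
     (SUP \<mu> \<in> {\<mu>. prob_space \<mu> \<and> sets \<mu> = sets borel \<and>
                   (\<exists>K. compact K \<and> K \<subseteq> S \<and> emeasure \<mu> K = 1) \<and> log_energy \<mu> < \<infinity>}.
        ennreal (exp (- real_of_ereal (log_energy \<mu>))))"

text \<open>
  Convergence in capacity on compact subsets of a subset \<^term>\<open>D\<close> of the sphere. The compact sets
  are taken in the local coordinates, including the coordinate \<open>1/z\<close> at infinity.
\<close>

definition converges_in_capacity ::
  "('i \<Rightarrow> complex option \<Rightarrow> complex) \<Rightarrow> (complex option \<Rightarrow> complex) \<Rightarrow> complex option set \<Rightarrow>
   'i filter \<Rightarrow> bool" where
  "converges_in_capacity h l D \<F> \<longleftrightarrow>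
     (\<forall>p K \<epsilon>. compact K \<longrightarrow> sphere_chart p ` K \<subseteq> D \<longrightarrow> 0 < \<epsilon> \<longrightarrow>
        ((\<lambda>n. log_capacity {t\<in>K. \<epsilon> \<le> dist (h n (sphere_chart p t)) (l (sphere_chart p t))})
           \<longlongrightarrow> 0) \<F>)"

text \<open>
  The quotient of two polynomials as a function on the sphere. Its values at the zeros of the
  denominator and at infinity play no role for convergence in capacity, since finite sets have
  capacity 0.
\<close>

definition poly_quotient :: "complex poly \<Rightarrow> complex poly \<Rightarrow> complex option \<Rightarrow> complex" where
  "poly_quotient p q x = (case x of Some z \<Rightarrow> poly p z / poly q z
                                  | None \<Rightarrow> Lim at_infinity (\<lambda>z. poly p z / poly q z))"


section \<open>The function and its Riemann surface\<close>

text \<open>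
  The branch of the square root of \<open>z\<^sup>2 - 1\<close> outside \<open>[-1,1]\<close> that is asymptotic to \<open>z\<close> is
  \<open>z * csqrt (1 - 1 / z\<^sup>2)\<close>: for \<open>z \<noteq> 0\<close>, the number \<open>1 - 1 / z\<^sup>2\<close> is real and at most 0 only if \<open>z\<close>
  is in \<open>[-1,1]\<close>.
\<close>

definition joukowski_phi :: "complex \<Rightarrow> complex" where
  "joukowski_phi z = z + z * csqrt (1 - 1 / z\<^sup>2)"

definition joukowski :: "complex option \<Rightarrow> complex option" where
  "joukowski x = (case x of None \<Rightarrow> None
                          | Some \<zeta> \<Rightarrow> if \<zeta> = 0 then None else Some ((\<zeta> + 1 / \<zeta>) / 2))"

abbreviation zeta_cut :: "complex \<Rightarrow> complex \<Rightarrow> complex set" where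
  "zeta_cut A B \<equiv> closed_segment (1 / A) (1 / B)"

text \<open>
  Two copies of the \<open>\<zeta>\<close>-sphere, cut along the segment from \<open>1/A\<close> to \<open>1/B\<close> and glued crosswise,
  form the Riemann surface of the square root \<open>s\<close> of \<open>(\<zeta> - 1/B) / (\<zeta> - 1/A)\<close>. This quotient is in
  \<open>[-\<infinity>,0]\<close> exactly for \<open>\<zeta>\<close> on the cut. So the first copy is the half-plane \<open>Re s > 0\<close>, the second
  copy is \<open>Re s < 0\<close>, and their common boundary is the imaginary axis together with \<open>s = \<infinity>\<close>.
  The function \<open>s\<close> is a bijection onto the sphere (the genus is 0), so a point of the surface is
  represented by its value of \<open>s\<close>, and the charts \<^const>\<open>sphere_chart\<close> in \<open>s\<close> are local
  coordinates. \<open>surf_zeta\<close> is the projection to the \<open>\<zeta>\<close>-sphere, \<open>surf_side\<close> is 1 on the first copy,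
  -1 on the second and 0 over the cut, \<open>surf_swap\<close> exchanges the copies and \<open>surf_lift\<close> maps a \<open>\<zeta>\<close>
  off the cut to the point over it on the first copy. The lemmas below confirm this.
\<close>

type_synonym surf = "complex option"

definition surf_zeta :: "complex \<Rightarrow> complex \<Rightarrow> surf \<Rightarrow> complex option" where
  "surf_zeta A B x = (case x of None \<Rightarrow> Some (1 / A)
     | Some s \<Rightarrow> if s\<^sup>2 = 1 then None else Some ((s\<^sup>2 / A - 1 / B) / (s\<^sup>2 - 1)))"

definition surf_side :: "surf \<Rightarrow> real" where
  "surf_side x = (case x of None \<Rightarrow> 0 | Some s \<Rightarrow> sgn (Re s))"

definition surf_swap :: "surf \<Rightarrow> surf" where
  "surf_swap = map_option uminus"

definition surf_lift :: "complex \<Rightarrow> complex \<Rightarrow> complex option \<Rightarrow> surf" where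
  "surf_lift A B y = (case y of None \<Rightarrow> Some 1
     | Some \<zeta> \<Rightarrow> if \<zeta> = 1 / A then None else Some (csqrt ((\<zeta> - 1 / B) / (\<zeta> - 1 / A))))"

definition surf_proj :: "complex \<Rightarrow> complex \<Rightarrow> surf \<Rightarrow> complex option" where
  "surf_proj A B x = joukowski (surf_zeta A B x)"

text \<open>The four points over a point of the \<open>z\<close>-sphere, with multiplicity.\<close>

definition joukowski_fiber :: "complex option \<Rightarrow> complex option multiset" where
  "joukowski_fiber y = (case y of None \<Rightarrow> {#None, Some 0#}
     | Some z \<Rightarrow> {#Some (z + csqrt (z\<^sup>2 - 1)), Some (z - csqrt (z\<^sup>2 - 1))#})"

definition surf_fiber :: "complex \<Rightarrow> complex \<Rightarrow> complex option \<Rightarrow> surf multiset" where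
  "surf_fiber A B y = image_mset (surf_lift A B) (joukowski_fiber y)
                    + image_mset (\<lambda>\<zeta>. surf_swap (surf_lift A B \<zeta>)) (joukowski_fiber y)"

lemma surf_zeta_lift:
  assumes "A \<noteq> B" "A \<noteq> 0" "B \<noteq> 0"
  shows "surf_zeta A B (surf_lift A B y) = y" "surf_zeta A B (surf_swap (surf_lift A B y)) = y"
proof -
  have "surf_zeta A B (surf_lift A B y) = y \<and> surf_zeta A B (surf_swap (surf_lift A B y)) = y"
  proof (cases y)
    case (Some \<zeta>)
    show ?thesis
    proof (cases "\<zeta> = 1 / A")
      case False
      define r where "r = (\<zeta> - 1 / B) / (\<zeta> - 1 / A)"
      have nz: "\<zeta> - 1 / A \<noteq> 0" "1 / A - 1 / B \<noteq> 0"
        using False assms by auto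
      have r1: "r - 1 = (1 / A - 1 / B) / (\<zeta> - 1 / A)"
      proof -
        have "(\<zeta> - 1 / A) - (\<zeta> - 1 / B) = 1 / B - 1 / A" by simp
        then have "r - 1 = ((\<zeta> - 1 / B) - (\<zeta> - 1 / A)) / (\<zeta> - 1 / A)"
          using nz(1) unfolding r_def by (subst diff_divide_distrib) simp
        then show ?thesis by simp
      qed
      have "r / A - 1 / B = \<zeta> * (r - 1)"
      proof -
        have "r * (\<zeta> - 1 / A) = \<zeta> - 1 / B" using nz by (simp add: r_def)
        then show ?thesis by (simp add: algebra_simps)
      qed
      moreover have "r - 1 \<noteq> 0" using r1 nz by simp
      ultimately have "r \<noteq> 1" "(r / A - 1 / B) / (r - 1) = \<zeta>" by auto
      then show ?thesis using Some False
        by (simp add: surf_lift_def surf_zeta_def surf_swap_def flip: r_def)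
    qed (simp add: Some surf_lift_def surf_zeta_def surf_swap_def)
  qed (simp add: surf_lift_def surf_zeta_def surf_swap_def)
  then show "surf_zeta A B (surf_lift A B y) = y" "surf_zeta A B (surf_swap (surf_lift A B y)) = y"
    by auto
qed

lemma surf_zeta_Some:
  assumes "A \<noteq> B" "A \<noteq> 0" "B \<noteq> 0" "surf_zeta A B (Some s) = Some \<zeta>"
  shows "\<zeta> \<noteq> 1 / A" "s\<^sup>2 = (\<zeta> - 1 / B) / (\<zeta> - 1 / A)"
proof -
  have s: "s\<^sup>2 - 1 \<noteq> 0" and z: "\<zeta> = (s\<^sup>2 / A - 1 / B) / (s\<^sup>2 - 1)"
    using assms(4) by (auto simp: surf_zeta_def split: if_splits)
  have d: "1 / A - 1 / B \<noteq> 0" using assms by auto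
  have e: "\<zeta> * (s\<^sup>2 - 1) = s\<^sup>2 / A - 1 / B" using s z by simp
  have "(\<zeta> - 1 / A) * (s\<^sup>2 - 1) = 1 / A - 1 / B"
    using e by (simp add: algebra_simps)
  then show ne: "\<zeta> \<noteq> 1 / A" using d by auto
  have "s\<^sup>2 * (\<zeta> - 1 / A) = \<zeta> - 1 / B"
    using e by (simp add: algebra_simps)
  then show "s\<^sup>2 = (\<zeta> - 1 / B) / (\<zeta> - 1 / A)"
    using ne by (metis eq_divide_eq right_minus_eq)
qed

lemma surf_zeta_eq_iff:
  assumes "A \<noteq> B" "A \<noteq> 0" "B \<noteq> 0"
  shows "surf_zeta A B x = y \<longleftrightarrow> x = surf_lift A B y \<or> x = surf_swap (surf_lift A B y)"
proof
  assume e: "surf_zeta A B x = y"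
  show "x = surf_lift A B y \<or> x = surf_swap (surf_lift A B y)"
  proof (cases x)
    case None
    then show ?thesis using e by (auto simp: surf_zeta_def surf_lift_def)
  next
    case (Some s)
    show ?thesis
    proof (cases y)
      case None
      then have "s\<^sup>2 = 1" using e Some by (auto simp: surf_zeta_def split: if_splits)
      then have "s = 1 \<or> s = -1" by (simp add: power2_eq_1_iff)
      then show ?thesis using None Some by (auto simp: surf_lift_def surf_swap_def)
    next
      case y: (Some \<zeta>)
      have "\<zeta> \<noteq> 1 / A" "s\<^sup>2 = (csqrt ((\<zeta> - 1 / B) / (\<zeta> - 1 / A)))\<^sup>2"
        using surf_zeta_Some[OF assms] e Some y by auto
      then show ?thesis
        unfolding power2_eq_iff using Some y by (simp add: surf_lift_def surf_swap_def)
    qed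
  qed
qed (use surf_zeta_lift[OF assms] in auto)

lemma surf_side_swap [simp]: "surf_side (surf_swap x) = - surf_side x"
  by (cases x) (auto simp: surf_side_def surf_swap_def sgn_if)

lemma quotient_nonpos_iff:
  fixes a b z :: complex
  assumes "z \<noteq> a" "a \<noteq> b"
  shows "(z - b) / (z - a) \<in> \<real>\<^sub>\<le>\<^sub>0 \<longleftrightarrow> z \<in> closed_segment a b"
proof
  assume "(z - b) / (z - a) \<in> \<real>\<^sub>\<le>\<^sub>0"
  then obtain r where r: "(z - b) / (z - a) = of_real r" "r \<le> 0"
    by (auto elim: nonpos_Reals_cases)
  define t where "t = 1 / (1 - r)"
  have t: "0 \<le> t" "t \<le> 1" "1 - t = - r * t"
    using r by (auto simp: t_def divide_simps)
  have "z - b = of_real r * (z - a)" using r(1) assms by (simp add: divide_simps)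
  then have zz: "z * (1 - of_real r) = b - of_real r * a" by (simp add: algebra_simps)
  have "of_real (t * (1 - r)) = (1 :: complex)"
    using r(2) by (simp add: t_def)
  then have "of_real t * (1 - of_real r) = (1 :: complex)"
    by (simp only: of_real_mult of_real_diff of_real_1)
  then have "z = of_real t * (z * (1 - of_real r))"
    by (metis mult.left_commute mult.right_neutral)
  then have "z = of_real t * (b - of_real r * a)"
    unfolding zz .
  also have "\<dots> = of_real (1 - t) * a + of_real t * b"
    unfolding t(3) by (simp add: algebra_simps)
  finally have "z = (1 - t) *\<^sub>R a + t *\<^sub>R b" by (simp add: scaleR_conv_of_real)
  then show "z \<in> closed_segment a b" using t(1,2) unfolding closed_segment_def by blast
next
  assume "z \<in> closed_segment a b"
  then obtain t where t: "0 \<le> t" "t \<le> 1" "z = (1 - t) *\<^sub>R a + t *\<^sub>R b"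
    by (auto simp: closed_segment_def)
  have "z - b = of_real (t - 1) * (b - a)" "z - a = of_real t * (b - a)"
    unfolding t(3) by (simp_all add: scaleR_conv_of_real algebra_simps)
  then have "(z - b) / (z - a) = of_real ((t - 1) / t)"
    using assms by simp
  moreover have "(t - 1) / t \<le> 0" using t by (simp add: divide_nonpos_nonneg)
  ultimately show "(z - b) / (z - a) \<in> \<real>\<^sub>\<le>\<^sub>0" by (metis nonpos_Reals_of_real_iff)
qed

lemma surf_side_lift:
  assumes "A \<noteq> B" "A \<noteq> 0" "B \<noteq> 0"
  shows "surf_side (surf_lift A B y) = (if y \<in> Some ` zeta_cut A B then 0 else 1)"
proof (cases y)
  case (Some \<zeta>)
  show ?thesis
  proof (cases "\<zeta> = 1 / A")
    case False
    have ne: "1 / A \<noteq> 1 / B" using assms by auto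
    let ?r = "(\<zeta> - 1 / B) / (\<zeta> - 1 / A)"
    have "Re (csqrt ?r) = 0 \<longleftrightarrow> ?r \<in> \<real>\<^sub>\<le>\<^sub>0"
    proof
      assume "Re (csqrt ?r) = 0"
      then have c: "csqrt ?r = \<i> * of_real (Im (csqrt ?r))" by (simp add: complex_eq_iff)
      have "?r = (csqrt ?r)\<^sup>2" by simp
      also have "\<dots> = of_real (- (Im (csqrt ?r))\<^sup>2)"
        by (subst c) (simp add: power_mult_distrib)
      finally show "?r \<in> \<real>\<^sub>\<le>\<^sub>0" by (metis neg_le_0_iff_le nonpos_Reals_of_real_iff zero_le_power2)
    next
      assume "?r \<in> \<real>\<^sub>\<le>\<^sub>0"
      then show "Re (csqrt ?r) = 0" by (auto elim!: nonpos_Reals_cases)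
    qed
    moreover have "Re (csqrt ?r) \<ge> 0" using csqrt_principal[of ?r] by linarith
    ultimately show ?thesis
      using Some False quotient_nonpos_iff[OF False ne]
      by (auto simp: surf_lift_def surf_side_def sgn_if)
  qed (simp add: Some surf_lift_def surf_side_def)
qed (auto simp: surf_lift_def surf_side_def)

lemma surf_side_eq_0_iff:
  assumes "A \<noteq> B" "A \<noteq> 0" "B \<noteq> 0"
  shows "surf_side x = 0 \<longleftrightarrow> surf_zeta A B x \<in> Some ` zeta_cut A B"
proof -
  have "x = surf_lift A B (surf_zeta A B x) \<or> x = surf_swap (surf_lift A B (surf_zeta A B x))"
    using surf_zeta_eq_iff[OF assms, of x] by blast
  then have "\<bar>surf_side x\<bar> = \<bar>surf_side (surf_lift A B (surf_zeta A B x))\<bar>"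
    by (metis abs_minus_cancel surf_side_swap)
  then show ?thesis unfolding surf_side_lift[OF assms] by (auto split: if_splits)
qed

text \<open>Each copy is mapped bijectively onto the sphere cut along the segment.\<close>

lemma surf_copies:
  assumes "A \<noteq> B" "A \<noteq> 0" "B \<noteq> 0"
  shows "bij_betw (surf_zeta A B) {x. surf_side x = 1} (- Some ` zeta_cut A B)"
    and "bij_betw (surf_zeta A B) {x. surf_side x = - 1} (- Some ` zeta_cut A B)"
proof -
  note l = surf_zeta_lift[OF assms] and s = surf_side_lift[OF assms]
    and s0 = surf_side_eq_0_iff[OF assms]
  have z: "x = surf_lift A B (surf_zeta A B x) \<or> x = surf_swap (surf_lift A B (surf_zeta A B x))"
    for x using surf_zeta_eq_iff[OF assms, of x] by blast
  have nonneg: "surf_side (surf_lift A B y) \<ge> 0" for y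
    unfolding s by simp
  have 1: "surf_lift A B (surf_zeta A B x) = x" if "surf_side x = 1" for x
    using z[of x]
  proof
    assume "x = surf_swap (surf_lift A B (surf_zeta A B x))"
    then have "surf_side x = - surf_side (surf_lift A B (surf_zeta A B x))"
      by (metis surf_side_swap)
    then show ?thesis using nonneg[of "surf_zeta A B x"] that by linarith
  qed simp
  have 2: "surf_swap (surf_lift A B (surf_zeta A B x)) = x" if "surf_side x = - 1" for x
    using z[of x]
  proof
    assume "x = surf_lift A B (surf_zeta A B x)"
    then have "surf_side x = surf_side (surf_lift A B (surf_zeta A B x))"
      by simp
    then show ?thesis using nonneg[of "surf_zeta A B x"] that by linarith
  qed simp
  have 3: "surf_zeta A B x \<in> - Some ` zeta_cut A B" if "surf_side x \<noteq> 0" for x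
    using s0[of x] that by blast
  have 4: "surf_side (surf_lift A B y) = 1" if "y \<notin> Some ` zeta_cut A B" for y
    using s[of y] that by simp
  show "bij_betw (surf_zeta A B) {x. surf_side x = 1} (- Some ` zeta_cut A B)"
  proof (rule bij_betw_byWitness[of _ "surf_lift A B"])
    show "surf_zeta A B ` {x. surf_side x = 1} \<subseteq> - Some ` zeta_cut A B"
      using 3 by (metis (mono_tags, lifting) image_subsetI mem_Collect_eq zero_neq_one)
  qed (use 1 4 l in blast)+
  show "bij_betw (surf_zeta A B) {x. surf_side x = - 1} (- Some ` zeta_cut A B)"
  proof (rule bij_betw_byWitness[of _ "\<lambda>y. surf_swap (surf_lift A B y)"])
    show "surf_zeta A B ` {x. surf_side x = - 1} \<subseteq> - Some ` zeta_cut A B"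
      using 3 by (metis (mono_tags, lifting) image_subsetI mem_Collect_eq neg_equal_0_iff_equal zero_neq_one)
    show "(\<lambda>y. surf_swap (surf_lift A B y)) ` (- Some ` zeta_cut A B) \<subseteq> {x. surf_side x = - 1}"
      using 4 by auto
  qed (use 2 l in blast)+
qed

lemma surf_lift_holomorphic:
  assumes "A \<noteq> B" "A \<noteq> 0" "B \<noteq> 0"
  shows "(\<lambda>\<zeta>. the (surf_lift A B (Some \<zeta>))) holomorphic_on - zeta_cut A B"
proof (rule holomorphic_transform)
  have ne: "1 / A \<noteq> 1 / B" using assms by auto
  have "\<zeta> \<noteq> 1 / A \<and> (\<zeta> - 1 / B) / (\<zeta> - 1 / A) \<notin> \<real>\<^sub>\<le>\<^sub>0" if "\<zeta> \<notin> zeta_cut A B" for \<zeta>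
    using that quotient_nonpos_iff[of \<zeta> "1 / A" "1 / B", OF _ ne] by auto
  then show "(\<lambda>\<zeta>. csqrt ((\<zeta> - 1 / B) / (\<zeta> - 1 / A))) holomorphic_on - zeta_cut A B"
    by (intro holomorphic_intros) (metis Compl_iff right_minus_eq)+
qed (auto simp: surf_lift_def)

lemma in_joukowski_fiber: "x \<in># joukowski_fiber y \<longleftrightarrow> joukowski x = y"
proof (cases "\<exists>\<zeta> z. x = Some \<zeta> \<and> y = Some z")
  case True
  then obtain \<zeta> z where xy: "x = Some \<zeta>" "y = Some z" by auto
  have "\<zeta> = z + csqrt (z\<^sup>2 - 1) \<or> \<zeta> = z - csqrt (z\<^sup>2 - 1) \<longleftrightarrow> (\<zeta> - z)\<^sup>2 = (csqrt (z\<^sup>2 - 1))\<^sup>2"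
    unfolding power2_eq_iff by (auto simp: algebra_simps)
  also have "\<dots> \<longleftrightarrow> \<zeta> * \<zeta> + 1 = 2 * z * \<zeta>"
  proof -
    have "(\<zeta> - z)\<^sup>2 - (csqrt (z\<^sup>2 - 1))\<^sup>2 = \<zeta> * \<zeta> + 1 - 2 * z * \<zeta>"
      unfolding power2_csqrt by (simp add: power2_eq_square algebra_simps)
    then show ?thesis by (metis eq_iff_diff_eq_0)
  qed
  also have "\<dots> \<longleftrightarrow> \<zeta> \<noteq> 0 \<and> (\<zeta> + 1 / \<zeta>) / 2 = z"
    by (cases "\<zeta> = 0") (auto simp: divide_simps algebra_simps)
  finally show ?thesis using xy by (auto simp: joukowski_fiber_def joukowski_def)
next
  case False
  then show ?thesis
    by (cases x; cases y) (auto simp: joukowski_fiber_def joukowski_def)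
qed

lemma in_surf_fiber:
  assumes "A \<noteq> B" "A \<noteq> 0" "B \<noteq> 0"
  shows "x \<in># surf_fiber A B y \<longleftrightarrow> surf_proj A B x = y"
proof -
  have "x \<in># surf_fiber A B y \<longleftrightarrow> (\<exists>\<zeta>. joukowski \<zeta> = y \<and> surf_zeta A B x = \<zeta>)"
    unfolding surf_zeta_eq_iff[OF assms] by (auto simp: surf_fiber_def in_joukowski_fiber)
  then show ?thesis by (simp add: surf_proj_def)
qed

lemma size_surf_fiber: "size (surf_fiber A B y) = 4"
  by (cases y) (simp_all add: surf_fiber_def joukowski_fiber_def)


section \<open>The Nuttall partition\<close>

text \<open>
  Off the points over infinity, \<open>u\<close> is \<open>-2 g - log |\<zeta>|\<close> on the first copy, \<open>2 g - log |\<zeta>|\<close> on the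
  second and \<open>- log |\<zeta>|\<close> over the cut, where the Green function vanishes.
\<close>

definition nuttall_u :: "complex \<Rightarrow> complex \<Rightarrow> (complex \<Rightarrow> real) \<Rightarrow> surf \<Rightarrow> ereal" where
  "nuttall_u A B g x = (case surf_zeta A B x of
       None \<Rightarrow> (if surf_side x = 1 then - \<infinity> else \<infinity>)
     | Some \<zeta> \<Rightarrow> if \<zeta> = 0 then \<infinity> else ereal (- 2 * surf_side x * g \<zeta> - ln (norm \<zeta>)))"

definition nuttall_values ::
  "complex \<Rightarrow> complex \<Rightarrow> (complex \<Rightarrow> real) \<Rightarrow> complex option \<Rightarrow> ereal list" where
  "nuttall_values A B g y =
     sorted_list_of_multiset (image_mset (nuttall_u A B g) (surf_fiber A B y))"

text \<open>
  The point over \<^term>\<open>y\<close> on the \<^term>\<open>j\<close>-th sheet, \<open>1 \<le> j \<le> 4\<close>; it is meaningful if the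
  \<^term>\<open>j\<close>-th value differs from the other three.
\<close>

definition sheet_point ::
  "complex \<Rightarrow> complex \<Rightarrow> (complex \<Rightarrow> real) \<Rightarrow> complex option \<Rightarrow> nat \<Rightarrow> surf" where
  "sheet_point A B g y j =
     (THE x. x \<in># surf_fiber A B y \<and> nuttall_u A B g x = nuttall_values A B g y ! (j - 1))"

definition first_boundary :: "complex \<Rightarrow> complex \<Rightarrow> (complex \<Rightarrow> real) \<Rightarrow> complex option set" where
  "first_boundary A B g = {y. nuttall_values A B g y ! 0 = nuttall_values A B g y ! 1}"


section \<open>Type I remainders and the determinant\<close>

definition typeI_remainder ::
  "complex \<Rightarrow> complex \<Rightarrow> (surf \<Rightarrow> complex) \<Rightarrow> (nat \<Rightarrow> complex poly) \<Rightarrow> surf \<Rightarrow> complex" where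
  "typeI_remainder A B F q x = (case surf_proj A B x of None \<Rightarrow> 0
                                  | Some z \<Rightarrow> \<Sum>i\<le>3. poly (q i) z * F x ^ i)"

text \<open>
  An Abelian integral of the third kind with logarithmic singularities at \<^term>\<open>z1\<close> and
  \<^term>\<open>z2\<close> is multivalued; \<^term>\<open>G\<close> selects one of its values at each point. The surface has
  genus 0, so every period is a multiple of the period \<open>2\<pi>i\<close> around a singularity, and the value
  selected at a point near \<^term>\<open>p\<close> differs from the value of a local branch by such a multiple.
\<close>

definition third_kind_integral :: "surf \<Rightarrow> surf \<Rightarrow> (surf \<Rightarrow> complex) \<Rightarrow> bool" where
  "third_kind_integral z1 z2 G \<longleftrightarrow>
     (\<forall>p. \<exists>\<Gamma>. \<Gamma> analytic_on {0} \<and>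
        (\<forall>\<^sub>F t in at 0. \<exists>m::int. G (sphere_chart p t) =
            (of_bool (p = z2) - of_bool (p = z1)) * Ln t + \<Gamma> t + 2 * of_real pi * \<i> * of_int m) \<and>
        (p \<noteq> z1 \<and> p \<noteq> z2 \<longrightarrow> (\<exists>m::int. G p = \<Gamma> 0 + 2 * of_real pi * \<i> * of_int m)))"

text \<open>
  In the following definitions, \<^term>\<open>a j\<close> is the \<^term>\<open>j\<close>-th pole of the cube of the function on
  the surface, and \<^term>\<open>p k j\<close> the \<^term>\<open>j\<close>-th free zero of the \<^term>\<open>k\<close>-th remainder.
\<close>

definition Psi ::
  "(surf \<Rightarrow> surf \<Rightarrow> surf \<Rightarrow> complex) \<Rightarrow> (nat \<Rightarrow> surf) \<Rightarrow> (nat \<Rightarrow> nat \<Rightarrow> surf) \<Rightarrow>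
   nat \<Rightarrow> surf \<Rightarrow> complex" where
  "Psi G a p k x = exp (\<Sum>j=1..5. G (a j) (p k j) x)"

definition Delta ::
  "complex \<Rightarrow> complex \<Rightarrow> (complex \<Rightarrow> real) \<Rightarrow> (surf \<Rightarrow> surf \<Rightarrow> surf \<Rightarrow> complex) \<Rightarrow>
   (nat \<Rightarrow> surf) \<Rightarrow> (nat \<Rightarrow> nat \<Rightarrow> surf) \<Rightarrow> complex \<Rightarrow> complex" where
  "Delta A B g G a p z =
     (let row = (\<lambda>j. vector [Psi G a p 1 (sheet_point A B g (Some z) j),
                             Psi G a p 2 (sheet_point A B g (Some z) j),
                             Psi G a p 3 (sheet_point A B g (Some z) j)])
      in det (vector [row 1, row 2, row 3] :: complex^3^3))"

text \<open>
  The points \<^term>\<open>z\<close> that are not on the projection of a boundary between sheets and over which no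
  singularity of the integrals lies; there \<^const>\<open>Delta\<close> is defined pointwise. At the remaining
  points, which form a nowhere dense set, the value is that of the continuous extension or, on the
  projections of the boundaries, each of the boundary values. So
  \<open>Delta_modulus A B g G a p y l\<close> says that \<^term>\<open>l\<close> is a value of the modulus of the determinant
  over the point \<^term>\<open>y\<close> of the sphere (infinite at a pole).
\<close>

definition Delta_generic ::
  "complex \<Rightarrow> complex \<Rightarrow> (complex \<Rightarrow> real) \<Rightarrow> (nat \<Rightarrow> surf) \<Rightarrow> (nat \<Rightarrow> nat \<Rightarrow> surf) \<Rightarrow>
   complex \<Rightarrow> bool" where
  "Delta_generic A B g a p z \<longleftrightarrow> distinct (nuttall_values A B g (Some z)) \<and>
     (\<forall>x \<in># surf_fiber A B (Some z). \<forall>k\<in>{1,2,3}. \<forall>j\<in>{1..5}. x \<noteq> a j \<and> x \<noteq> p k j)"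

definition Delta_modulus ::
  "complex \<Rightarrow> complex \<Rightarrow> (complex \<Rightarrow> real) \<Rightarrow> (surf \<Rightarrow> surf \<Rightarrow> surf \<Rightarrow> complex) \<Rightarrow>
   (nat \<Rightarrow> surf) \<Rightarrow> (nat \<Rightarrow> nat \<Rightarrow> surf) \<Rightarrow> complex option \<Rightarrow> ereal \<Rightarrow> bool" where
  "Delta_modulus A B g G a p y l \<longleftrightarrow>
     (\<exists>w :: nat \<Rightarrow> complex. (\<forall>i. Delta_generic A B g a p (w i)) \<and>
        limitin sphere_top (\<lambda>i. Some (w i)) y sequentially \<and>
        (\<lambda>i. ereal (norm (Delta A B g G a p (w i)))) \<longlonglongrightarrow> l)"

end

theory Submission
  imports Defs "HOL-Computational_Algebra.Fundamental_Theorem_Algebra"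
begin

text \<open>
  The surface has genus 0 and \<open>s\<close> is a global coordinate on it, so the functions of the theorem are
  rational functions of \<open>s\<close>. Over a generic \<open>z\<close> lie four points \<open>s, -s, s', -s'\<close>, at which \<open>F\<close>
  takes four different values. Lagrange interpolation at these values turns \<open>Q, P\<^sub>1, P\<^sub>2, P\<^sub>3\<close> into one
  rational function \<open>Y\<close> of \<open>s\<close> such that \<open>Q\<close> is the sum of \<open>Y\<close> and \<open>P\<^sub>1\<close> the sum of \<open>F Y\<close> over the four
  points (lemma \<open>recovery\<close>). The approximation conditions at infinity make \<open>Y\<close> vanish to order
  \<open>n\<close> at the three points over infinity other than the point \<open>s = 1\<close>, while the bound on the degrees
  allows a pole of order \<open>3n\<close> at \<open>s = 1\<close>.

  Let \<open>w\<close> be the rational function with a triple zero at \<open>s = 1\<close> and simple poles at the other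
  three points over infinity; it is normalised such that \<open>u = log |w|\<close>. Then \<open>w\<^sup>n Y\<close>, multiplied by the
  fixed polynomial \<open>disc\<close> in \<open>s\<close>, is a polynomial \<open>T\<^sub>n\<close> of degree at most 6 (lemma
  \<open>dual_polynomial\<close>), and, up to a constant factor,
  \<open>Q w\<^sup>n disc = T\<^sub>n(s) + \<Sum> (w(s)/w(t))\<^sup>n (disc(s)/disc(t)) T\<^sub>n(t)\<close>, the sum over the other three points \<open>t\<close>;
  the same holds for \<open>P\<^sub>1\<close> if each \<open>T\<^sub>n\<close> is multiplied by \<open>F\<close> at the same point. The first sheet
  is the set where \<open>|w(s)| < |w(t)|\<close> for these \<open>t\<close>, so only the first term survives there. The
  coefficients of \<open>T\<^sub>n\<close> can be normalised; hence every sequence of indices has a subsequence along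
  which the normalised functions tend, locally uniformly on the first sheet, to a nonzero polynomial \<open>L\<close>
  of degree at most 6 and to \<open>F L\<close> (lemmas \<open>normalized_limit\<close> and \<open>normalized_subsequence\<close>).

  Both assertions follow by contradiction along such a subsequence. Seven zeros of \<open>Q\<close> away from
  \<open>E\<close> would lift to the first sheet and accumulate at seven zeros of \<open>L\<close>, counted with multiplicity
  (lemma \<open>zeros_bounded_by_degree_of_limit\<close>). And \<open>P\<^sub>1/Q\<close> tends to \<open>F\<close> outside arbitrarily small discs
  around the finitely many zeros of \<open>L\<close>, which have arbitrarily small capacity (lemma
  \<open>log_capacity_vanishes_near_finite\<close>).

  That the first sheet has this description rests on the uniqueness of the Green function, which gives
  \<open>g = log |(s + 1)/(s - 1)|\<close> on the first copy.
\<close>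

section \<open>Locally uniform limits and the number of zeros\<close>

definition locally_uniform_limit ::
  "complex set \<Rightarrow> (nat \<Rightarrow> complex \<Rightarrow> complex) \<Rightarrow> (complex \<Rightarrow> complex) \<Rightarrow> bool" where
  "locally_uniform_limit S q l \<longleftrightarrow>
     (\<forall>c\<in>S. \<exists>r>0. cball c r \<subseteq> S \<and> uniform_limit (cball c r) q l sequentially)"

text \<open>
  By the maximum principle. This is what removes exceptional points: it is enough to control the
  functions on circles that avoid them.
\<close>

lemma uniform_limit_sphere_imp_cball:
  fixes q :: "nat \<Rightarrow> complex \<Rightarrow> complex"
  assumes q: "\<And>n. q n holomorphic_on S" and l: "l holomorphic_on S" and S: "cball c r \<subseteq> S"
    and r: "0 < r" and lim: "uniform_limit (sphere c r) q l sequentially"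
  shows "uniform_limit (cball c r) q l sequentially"
proof (rule uniform_limitI)
  fix e :: real assume e: "0 < e"
  have "\<forall>\<^sub>F n in sequentially. \<forall>x\<in>sphere c r. dist (q n x) (l x) < e / 2"
    using uniform_limitD[OF lim, of "e / 2"] e by simp
  then show "\<forall>\<^sub>F n in sequentially. \<forall>x\<in>cball c r. dist (q n x) (l x) < e"
  proof eventually_elim
    case (elim n)
    have h: "(\<lambda>x. q n x - l x) holomorphic_on cball c r"
      using q[of n] l S by (intro holomorphic_intros) (blast intro: holomorphic_on_subset)+
    have "norm (q n x - l x) \<le> e / 2" if "x \<in> cball c r" for x
    proof (rule maximum_modulus_frontier[where S = "cball c r" and f = "\<lambda>x. q n x - l x"])
      show "(\<lambda>x. q n x - l x) holomorphic_on interior (cball c r)"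
        using h by (rule holomorphic_on_subset) (simp add: ball_subset_cball)
      show "continuous_on (closure (cball c r)) (\<lambda>x. q n x - l x)"
        using h by (simp add: holomorphic_on_imp_continuous_on)
      show "norm (q n z - l z) \<le> e / 2" if "z \<in> frontier (cball c r)" for z
        using elim that r by (auto simp: dist_norm less_imp_le)
    qed (use that in auto)
    then show ?case using e by (fastforce simp: dist_norm)
  qed
qed

lemma small_radius_avoiding_finite:
  fixes X :: "complex set"
  assumes "finite X" "0 < e"
  obtains r where "0 < r" "r < e" "sphere c r \<inter> X = {}"
proof -
  have "infinite ({0<..<e} - dist c ` X)" using assms by simp
  then obtain r where "r \<in> {0<..<e} - dist c ` X" using infinite_imp_nonempty by blast
  then show ?thesis by (intro that[of r]) auto
qed

lemma locally_uniform_limit_moving_point: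
  assumes lim: "locally_uniform_limit S q l" and l: "isCont l \<tau>"
    and \<sigma>: "\<sigma> \<longlonglongrightarrow> \<tau>" "\<tau> \<in> S"
  shows "(\<lambda>n. q n (\<sigma> n)) \<longlonglongrightarrow> l \<tau>"
proof (rule tendstoI)
  fix e :: real assume e: "0 < e"
  obtain r where r: "0 < r" "uniform_limit (cball \<tau> r) q l sequentially"
    using lim \<sigma> unfolding locally_uniform_limit_def by blast
  have "(\<lambda>n. l (\<sigma> n)) \<longlonglongrightarrow> l \<tau>"
    using l \<sigma>(1) by (rule isCont_tendsto_compose)
  then have "\<forall>\<^sub>F n in sequentially. dist (l (\<sigma> n)) (l \<tau>) < e / 2"
    using e by (intro tendstoD) auto
  moreover have "\<forall>\<^sub>F n in sequentially. \<forall>x\<in>cball \<tau> r. dist (q n x) (l x) < e / 2"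
    using uniform_limitD[OF r(2), of "e / 2"] e by simp
  moreover have "\<forall>\<^sub>F n in sequentially. dist (\<sigma> n) \<tau> < r" using \<sigma>(1) r(1) by (rule tendstoD)
  ultimately show "\<forall>\<^sub>F n in sequentially. dist (q n (\<sigma> n)) (l \<tau>) < e"
  proof eventually_elim
    case (elim n)
    then have "dist (q n (\<sigma> n)) (l (\<sigma> n)) < e / 2" by (simp add: dist_commute less_imp_le)
    then show ?case using elim(1) dist_triangle[of "q n (\<sigma> n)" "l \<tau>" "l (\<sigma> n)"] by linarith
  qed
qed

text \<open>
  The limit vanishes at the limit \<open>\<tau>\<close> of the zeros, and on a circle that does not pass through \<open>\<tau>\<close>
  the factors \<open>s - \<sigma> n\<close> are bounded below, so the quotients converge there and hence inside.
\<close>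

lemma divide_out_moving_zero:
  fixes q h :: "nat \<Rightarrow> complex \<Rightarrow> complex" and T :: "complex poly"
  assumes S: "open S" and h: "\<And>n. h n holomorphic_on S"
    and q: "\<And>n s. s \<in> S \<Longrightarrow> q n s = (s - \<sigma> n) * h n s"
    and lim: "locally_uniform_limit S q (poly T)"
    and \<sigma>: "\<sigma> \<longlonglongrightarrow> \<tau>" "\<tau> \<in> S" "\<And>n. \<sigma> n \<in> S"
  obtains T' where "T = [:- \<tau>, 1:] * T'" "locally_uniform_limit S h (poly T')"
proof -
  have "(\<lambda>n. q n (\<sigma> n)) \<longlonglongrightarrow> poly T \<tau>"
    using locally_uniform_limit_moving_point[OF lim poly_isCont \<sigma>(1,2)] .
  moreover have "q n (\<sigma> n) = 0" for n using q[OF \<sigma>(3)[of n], of n] by simp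
  ultimately have "poly T \<tau> = 0" using LIMSEQ_unique tendsto_const by (metis (no_types, lifting) ext)
  then obtain T' where T': "T = [:- \<tau>, 1:] * T'" by (meson dvdE poly_eq_0_iff_dvd)
  have "locally_uniform_limit S h (poly T')"
    unfolding locally_uniform_limit_def
  proof
    fix c assume "c \<in> S"
    then obtain r0 where r0: "0 < r0" "cball c r0 \<subseteq> S" "uniform_limit (cball c r0) q (poly T) sequentially"
      using lim unfolding locally_uniform_limit_def by blast
    obtain r where r: "0 < r" "r < r0" "sphere c r \<inter> {\<tau>} = {}"
      using small_radius_avoiding_finite[of "{\<tau>}" r0 c] r0 by auto
    have sub: "cball c r \<subseteq> S" using r r0 by force
    define d where "d = \<bar>dist c \<tau> - r\<bar>"
    have d: "0 < d" using r unfolding d_def by auto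
    have far: "d \<le> norm (x - \<tau>)" if "x \<in> sphere c r" for x
      using that unfolding d_def by (simp add: dist_norm[symmetric]) (smt (verit) dist_commute dist_triangle)
    have "uniform_limit (sphere c r) (\<lambda>n s. s - \<sigma> n) (\<lambda>s. s - \<tau>) sequentially"
    proof (rule uniform_limitI)
      fix e :: real assume "0 < e"
      from tendstoD[OF \<sigma>(1) this] show "\<forall>\<^sub>F n in sequentially. \<forall>x\<in>sphere c r. dist (x - \<sigma> n) (x - \<tau>) < e"
        by eventually_elim (auto simp: dist_norm norm_minus_commute)
    qed
    moreover have "uniform_limit (sphere c r) q (poly T) sequentially"
      using r0(3) by (rule uniform_limit_on_subset) (use r in auto)
    moreover have "bounded (poly T ` sphere c r)"
      by (intro compact_imp_bounded compact_continuous_image continuous_intros) auto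
    ultimately have "uniform_limit (sphere c r) (\<lambda>n s. q n s / (s - \<sigma> n)) (\<lambda>s. poly T s / (s - \<tau>)) sequentially"
      using far d by (intro uniform_lim_divide) auto
    moreover have "\<forall>\<^sub>F n in sequentially. \<forall>s\<in>sphere c r. q n s / (s - \<sigma> n) = h n s"
      using tendstoD[OF \<sigma>(1) d]
    proof eventually_elim
      case (elim n)
      have "s \<noteq> \<sigma> n" if "s \<in> sphere c r" for s
        using far[OF that] elim by (auto simp: dist_norm)
      then show ?case using q sub r by (auto simp: subset_iff)
    qed
    moreover have "poly T s / (s - \<tau>) = poly T' s" if "s \<in> sphere c r" for s
    proof -
      have "poly T s = (s - \<tau>) * poly T' s" unfolding T' by (simp add: algebra_simps)
      moreover have "s - \<tau> \<noteq> 0" using far[OF that] d by auto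
      ultimately show ?thesis by simp
    qed
    ultimately have "uniform_limit (sphere c r) h (poly T') sequentially"
      by (subst (asm) uniform_limit_cong) auto
    then have "uniform_limit (cball c r) h (poly T') sequentially"
      by (intro uniform_limit_sphere_imp_cball[OF h _ sub r(1)] holomorphic_intros)
    then show "\<exists>r>0. cball c r \<subseteq> S \<and> uniform_limit (cball c r) h (poly T') sequentially"
      using r sub by blast
  qed
  then show ?thesis using that T' by blast
qed

text \<open>
  A quantitative form of Hurwitz' theorem for a polynomial limit: each of the \<open>m\<close> zeros can be divided
  out in turn, and each time the degree of the limit drops by one. Multiplicities are expressed by the
  factorisation of \<open>q n\<close>.
\<close>

lemma zeros_bounded_by_degree_of_limit:
  fixes q h :: "nat \<Rightarrow> complex \<Rightarrow> complex" and T :: "complex poly"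
  assumes "open S" "\<And>n. h n holomorphic_on S"
    and "\<And>n s. s \<in> S \<Longrightarrow> q n s = (\<Prod>i<m. s - \<sigma> i n) * h n s"
    and "locally_uniform_limit S q (poly T)" "T \<noteq> 0"
    and "\<And>i. i < m \<Longrightarrow> \<sigma> i \<longlonglongrightarrow> \<tau> i \<and> \<tau> i \<in> S \<and> (\<forall>n. \<sigma> i n \<in> S)"
  shows "m \<le> degree T"
  using assms
proof (induction m arbitrary: q T)
  case (Suc m)
  define h' where "h' = (\<lambda>n s. (\<Prod>i<m. s - \<sigma> i n) * h n s)"
  have m: "\<sigma> m \<longlonglongrightarrow> \<tau> m" "\<tau> m \<in> S" "\<And>n. \<sigma> m n \<in> S" using Suc.prems(6)[of m] by auto
  obtain T' where T': "T = [:- \<tau> m, 1:] * T'" "locally_uniform_limit S h' (poly T')"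
  proof (rule divide_out_moving_zero[OF Suc.prems(1) _ _ Suc.prems(4) m])
    show "h' n holomorphic_on S" for n
      unfolding h'_def by (intro holomorphic_intros Suc.prems)
    show "q n s = (s - \<sigma> m n) * h' n s" if "s \<in> S" for n s
      using Suc.prems(3)[OF that] by (simp add: h'_def algebra_simps)
  qed blast
  have "T' \<noteq> 0" using T' Suc.prems(5) by auto
  then have "m \<le> degree T'"
    using Suc.IH[of h' T'] Suc.prems(1,2,6) T' by (simp add: h'_def)
  then show ?case unfolding T'(1) using \<open>T' \<noteq> 0\<close> by (subst degree_mult_eq) auto
qed simp

lemma common_convergent_subsequence:
  fixes x :: "nat \<Rightarrow> nat \<Rightarrow> complex"
  assumes "\<And>i. i < m \<Longrightarrow> bounded (range (x i))"
  obtains r l where "strict_mono r" "\<And>i. i < m \<Longrightarrow> (\<lambda>k. x i (r k)) \<longlonglongrightarrow> l i"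
proof -
  have "\<exists>r l. strict_mono (r :: nat \<Rightarrow> nat) \<and> (\<forall>i<m. (\<lambda>k. x i (r k)) \<longlonglongrightarrow> l i)"
    using assms
  proof (induction m)
    case 0
    show ?case by (rule exI[of _ id]) (simp add: strict_mono_def)
  next
    case (Suc m)
    then obtain r l where r: "strict_mono r" "\<forall>i<m. (\<lambda>k. x i (r k)) \<longlonglongrightarrow> l i"
      by (meson less_Suc_eq)
    have "bounded (range (\<lambda>k. x m (r k)))"
      using Suc.prems[of m] by (rule bounded_subset) auto
    then obtain l' r' where r': "strict_mono r'" "((\<lambda>k. x m (r k)) \<circ> r') \<longlonglongrightarrow> l'"
      using bounded_imp_convergent_subsequence by blast
    show ?case
    proof (intro exI conjI allI impI)
      show "strict_mono (r \<circ> r')" using r r' by (simp add: strict_mono_o)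
      fix i assume i: "i < Suc m"
      show "(\<lambda>k. x i ((r \<circ> r') k)) \<longlonglongrightarrow> (l(m := l')) i"
      proof (cases "i = m")
        case True
        then show ?thesis using r'(2) by (simp add: o_def)
      next
        case False
        then show ?thesis using LIMSEQ_subseq_LIMSEQ[OF _ r'(1), of "\<lambda>k. x i (r k)" "l i"] r i
          by (simp add: o_def)
      qed
    qed
  qed
  then show ?thesis using that by blast
qed

section \<open>Capacity of small discs\<close>

text \<open>
  One of the discs has mass at least \<open>1 / card X\<close>, and on it the kernel is at least \<open>- ln (2 r)\<close>;
  the negative part of the kernel is at most \<open>ln (2 R)\<close> because the diameter of the disc of radius \<open>R\<close>
  is \<open>2 R\<close>.
\<close>

lemma log_energy_ge:
  assumes \<mu>: "prob_space \<mu>" "sets \<mu> = sets borel" "compact K" "emeasure \<mu> K = 1"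
    and X: "finite X" "K \<subseteq> (\<Union>x\<in>X. ball x r)" "0 < r" "2 * r < 1"
    and R: "K \<subseteq> cball 0 R" "1 \<le> 2 * R"
  shows "ereal (- ln (2 * r) / (real (card X))\<^sup>2 - ln (2 * R)) \<le> log_energy \<mu>"
proof -
  interpret prob_space \<mu> by fact
  have [measurable_cong]: "sets \<mu> = sets borel" by fact
  have K: "K \<in> sets \<mu>" using \<mu> by (simp add: borel_compact)
  have b: "ball x r \<in> sets \<mu>" for x using \<mu> by simp
  define m where "m = real (card X)"
  have K1: "measure \<mu> K = 1" using \<mu>(4) by (simp add: measure_def)
  have "X \<noteq> {}" using X K1 by (auto simp: subset_empty)
  then have m: "0 < m" using X by (simp add: m_def card_gt_0_iff)
  have "\<exists>x\<in>X. 1 / m \<le> measure \<mu> (ball x r)"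
  proof (rule ccontr)
    assume "\<not> (\<exists>x\<in>X. 1 / m \<le> measure \<mu> (ball x r))"
    then have *: "measure \<mu> (ball x r) < 1 / m" if "x \<in> X" for x
      using that not_le by blast
    have "measure \<mu> K \<le> measure \<mu> (\<Union>x\<in>X. ball x r)"
      using X b \<mu>(2) by (intro finite_measure_mono) auto
    also have "\<dots> \<le> (\<Sum>x\<in>X. measure \<mu> (ball x r))"
      using X b by (intro finite_measure_subadditive_finite) auto
    also have "\<dots> < (\<Sum>x\<in>X. 1 / m)"
      using * X \<open>X \<noteq> {}\<close> by (intro sum_strict_mono) auto
    also have "\<dots> = 1" using m by (simp add: m_def)
    finally show False using K1 by simp
  qed
  then obtain x where x: "x \<in> X" "1 / m \<le> measure \<mu> (ball x r)" by blast
  let ?b = "measure \<mu> (ball x r)"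
  define L where "L = - ln (2 * r)"
  have L: "0 < L" using X by (simp add: L_def)
  let ?P = "\<integral>\<^sup>+ z. \<integral>\<^sup>+ w. (if z = w then \<infinity> else ennreal (- ln (dist z w))) \<partial>\<mu> \<partial>\<mu>"
  let ?N = "\<integral>\<^sup>+ z. \<integral>\<^sup>+ w. ennreal (ln (dist z w)) \<partial>\<mu> \<partial>\<mu>"
  have in1: "(\<integral>\<^sup>+ w. ennreal L * indicator (ball x r) w \<partial>\<mu>) = ennreal (L * ?b)"
    using L b by (simp add: nn_integral_cmult_indicator emeasure_eq_measure ennreal_mult)
  have "ennreal (L * ?b * ?b) = (\<integral>\<^sup>+ z. ennreal (L * ?b) * indicator (ball x r) z \<partial>\<mu>)"
    using L b by (simp add: nn_integral_cmult_indicator emeasure_eq_measure ennreal_mult)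
  also have "\<dots> \<le> ?P"
  proof (rule nn_integral_mono)
    fix z
    show "ennreal (L * ?b) * indicator (ball x r) z \<le>
        (\<integral>\<^sup>+ w. (if z = w then \<infinity> else ennreal (- ln (dist z w))) \<partial>\<mu>)"
    proof (cases "z \<in> ball x r")
      case True
      have "(\<integral>\<^sup>+ w. ennreal L * indicator (ball x r) w \<partial>\<mu>) \<le>
          (\<integral>\<^sup>+ w. (if z = w then \<infinity> else ennreal (- ln (dist z w))) \<partial>\<mu>)"
      proof (rule nn_integral_mono)
        fix w
        have "L \<le> - ln (dist z w)" if "w \<in> ball x r" "z \<noteq> w"
        proof -
          have "dist z w \<le> dist x z + dist x w" by (metis dist_commute dist_triangle)
          then have "dist z w \<le> 2 * r" using True that(1) by simp
          then show ?thesis unfolding L_def using that X by simp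
        qed
        then show "ennreal L * indicator (ball x r) w \<le> (if z = w then \<infinity> else ennreal (- ln (dist z w)))"
          by (auto simp: indicator_def ennreal_leI)
      qed
      then show ?thesis using True by (simp add: in1)
    qed simp
  qed
  finally have P: "ennreal (L * ?b * ?b) \<le> ?P" .
  have "L / m\<^sup>2 = L * (1 / m) * (1 / m)" by (simp add: power2_eq_square)
  also have "\<dots> \<le> L * ?b * ?b" using L m x(2) by (intro mult_mono) auto
  finally have "ennreal (L / m\<^sup>2) \<le> ?P" using P by (meson ennreal_leI order_trans)
  then have P: "ereal (L / m\<^sup>2) \<le> enn2ereal ?P"
    using L by (simp add: less_eq_ennreal.rep_eq enn2ereal_ennreal)
  have ae: "AE z in \<mu>. z \<in> K" using K1 prob_eq_1[OF K] by simp
  have "?N \<le> (\<integral>\<^sup>+ z. ennreal (ln (2 * R)) \<partial>\<mu>)"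
  proof (rule nn_integral_mono_AE)
    show "AE z in \<mu>. (\<integral>\<^sup>+ w. ennreal (ln (dist z w)) \<partial>\<mu>) \<le> ennreal (ln (2 * R))"
      using ae
    proof eventually_elim
      case (elim z)
      have "(\<integral>\<^sup>+ w. ennreal (ln (dist z w)) \<partial>\<mu>) \<le> (\<integral>\<^sup>+ w. ennreal (ln (2 * R)) \<partial>\<mu>)"
      proof (rule nn_integral_mono_AE)
        show "AE w in \<mu>. ennreal (ln (dist z w)) \<le> ennreal (ln (2 * R))"
          using ae
        proof eventually_elim
          case w: (elim w)
          have "dist z w \<le> dist 0 z + dist 0 w" by (metis dist_commute dist_triangle)
          moreover have "dist 0 z \<le> R" "dist 0 w \<le> R" using w elim R by auto
          ultimately have d: "dist z w \<le> 2 * R" by linarith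
          show ?case
          proof (cases "z = w")
            case False
            then show ?thesis using d R by (intro ennreal_leI) simp
          qed (use R in simp)
        qed
      qed
      then show ?case by (simp add: emeasure_space_1)
    qed
  qed
  then have "?N \<le> ennreal (ln (2 * R))" by (simp add: emeasure_space_1)
  then have N: "enn2ereal ?N \<le> ereal (ln (2 * R))"
    using R by (simp add: less_eq_ennreal.rep_eq enn2ereal_ennreal)
  have "ereal (L / m\<^sup>2) - ereal (ln (2 * R)) \<le> log_energy \<mu>"
    unfolding log_energy_def using P N by (rule ereal_minus_mono)
  then show ?thesis by (simp add: L_def m_def)
qed

lemma log_capacity_small_balls:
  assumes X: "finite X" "S \<subseteq> (\<Union>x\<in>X. ball x r)" "0 < r" "2 * r < 1"
    and R: "S \<subseteq> cball 0 R" "1 \<le> 2 * R"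
  shows "log_capacity S \<le> ennreal (exp (ln (2 * R) + ln (2 * r) / (real (card X))\<^sup>2))"
  unfolding log_capacity_def
proof (rule SUP_least)
  fix \<mu> :: "complex measure"
  assume "\<mu> \<in> {\<mu>. prob_space \<mu> \<and> sets \<mu> = sets borel \<and>
                   (\<exists>K. compact K \<and> K \<subseteq> S \<and> emeasure \<mu> K = 1) \<and> log_energy \<mu> < \<infinity>}"
  then obtain K where K: "prob_space \<mu>" "sets \<mu> = sets borel" "compact K" "K \<subseteq> S"
    "emeasure \<mu> K = 1" "log_energy \<mu> < \<infinity>" by blast
  have "ereal (- ln (2 * r) / (real (card X))\<^sup>2 - ln (2 * R)) \<le> log_energy \<mu>"
    using K X R by (intro log_energy_ge[of \<mu> K]) auto
  then have "- ln (2 * r) / (real (card X))\<^sup>2 - ln (2 * R) \<le> real_of_ereal (log_energy \<mu>)"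
    using K(6) by (cases "log_energy \<mu>") auto
  then show "ennreal (exp (- real_of_ereal (log_energy \<mu>))) \<le>
      ennreal (exp (ln (2 * R) + ln (2 * r) / (real (card X))\<^sup>2))"
    by (intro ennreal_leI) simp
qed

text \<open>
  The bound of the previous lemma tends to 0 with the radius when the set of centres is fixed.
\<close>

lemma log_capacity_vanishes_near_finite:
  fixes X :: "complex set" and \<epsilon> :: ennreal
  assumes X: "finite X" and K: "bounded K" and \<epsilon>: "0 < \<epsilon>"
  obtains r where "0 < r"
    "\<And>S. S \<subseteq> K \<Longrightarrow> S \<subseteq> (\<Union>x\<in>X. ball x r) \<Longrightarrow> log_capacity S < \<epsilon>"
proof -
  obtain e where e: "0 < e" "ennreal e < \<epsilon>"
  proof -
    obtain e' where e': "0 < e'" "e' < \<epsilon>" using \<epsilon> dense by blast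
    then have "e' < top" using order.strict_trans2[of e' \<epsilon> top] by simp
    then have "e' = ennreal (enn2real e')" by simp
    then show ?thesis using that[of "enn2real e'"] e' by (metis enn2real_positive_iff \<open>e' < top\<close>)
  qed
  obtain R0 where "K \<subseteq> cball 0 R0" using K unfolding bounded_iff by (auto simp: subset_iff)
  then obtain R where R: "K \<subseteq> cball 0 R" "1 \<le> 2 * R"
    by (intro that[of "max 1 R0"]) auto
  define m where "m = real (card (insert 0 X))"
  have m: "0 < m" using X by (simp add: m_def card_gt_0_iff)
  \<comment> \<open>chosen such that the radius \<open>exp (- M) / 2\<close> turns the bound into at most \<open>e\<close>\<close>
  define M where "M = max 1 (m\<^sup>2 * (ln (2 * R) - ln e))"
  define r where "r = exp (- M) / 2"
  have M: "1 \<le> M" "m\<^sup>2 * (ln (2 * R) - ln e) \<le> M" by (auto simp: M_def)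
  show ?thesis
  proof (rule that[of r])
    show "0 < r" by (simp add: r_def)
    fix S assume S: "S \<subseteq> K" "S \<subseteq> (\<Union>x\<in>X. ball x r)"
    have "log_capacity S \<le> ennreal (exp (ln (2 * R) + ln (2 * r) / m\<^sup>2))"
      unfolding m_def
    proof (rule log_capacity_small_balls)
      show "2 * r < 1" using M by (simp add: r_def)
    qed (use X S R M in \<open>auto simp: r_def\<close>)
    also have "\<dots> \<le> ennreal (exp (ln e))"
    proof (intro ennreal_leI, subst exp_le_cancel_iff)
      have "ln (2 * R) - ln e \<le> M / m\<^sup>2" using M m by (simp add: field_simps)
      then show "ln (2 * R) + ln (2 * r) / m\<^sup>2 \<le> ln e" by (simp add: r_def)
    qed
    also have "\<dots> < \<epsilon>" using e by simp
    finally show "log_capacity S < \<epsilon>" .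
  qed
qed

section \<open>Uniqueness of the Green function\<close>

lemma harmonic_on_lincomb:
  assumes "harmonic_on u S" "harmonic_on v S"
  shows "harmonic_on (\<lambda>z. a * u z + b * v z) S"
proof -
  obtain ux uy uxx uxy uyy where u: "open S"
    "\<And>z. z \<in> S \<Longrightarrow> (u has_derivative (\<lambda>h. ux z * Re h + uy z * Im h)) (at z)"
    "\<And>z. z \<in> S \<Longrightarrow> (ux has_derivative (\<lambda>h. uxx z * Re h + uxy z * Im h)) (at z)"
    "\<And>z. z \<in> S \<Longrightarrow> (uy has_derivative (\<lambda>h. uxy z * Re h + uyy z * Im h)) (at z)"
    "\<And>z. z \<in> S \<Longrightarrow> uxx z + uyy z = 0"
    "continuous_on S uxx" "continuous_on S uxy" "continuous_on S uyy"
    using assms(1) unfolding harmonic_on_def by blast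
  obtain vx vy vxx vxy vyy where v:
    "\<And>z. z \<in> S \<Longrightarrow> (v has_derivative (\<lambda>h. vx z * Re h + vy z * Im h)) (at z)"
    "\<And>z. z \<in> S \<Longrightarrow> (vx has_derivative (\<lambda>h. vxx z * Re h + vxy z * Im h)) (at z)"
    "\<And>z. z \<in> S \<Longrightarrow> (vy has_derivative (\<lambda>h. vxy z * Re h + vyy z * Im h)) (at z)"
    "\<And>z. z \<in> S \<Longrightarrow> vxx z + vyy z = 0"
    "continuous_on S vxx" "continuous_on S vxy" "continuous_on S vyy"
    using assms(2) unfolding harmonic_on_def by blast
  show ?thesis unfolding harmonic_on_def
  proof (intro conjI exI ballI)
    fix z assume z: "z \<in> S"
    show "((\<lambda>z. a * u z + b * v z) has_derivative
        (\<lambda>h. (a * ux z + b * vx z) * Re h + (a * uy z + b * vy z) * Im h)) (at z)"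
      by (rule has_derivative_eq_rhs, (rule derivative_intros u(2)[OF z] v(1)[OF z])+) (auto simp: algebra_simps)
    show "((\<lambda>z. a * ux z + b * vx z) has_derivative
        (\<lambda>h. (a * uxx z + b * vxx z) * Re h + (a * uxy z + b * vxy z) * Im h)) (at z)"
      by (rule has_derivative_eq_rhs, (rule derivative_intros u(3)[OF z] v(2)[OF z])+) (auto simp: algebra_simps)
    show "((\<lambda>z. a * uy z + b * vy z) has_derivative
        (\<lambda>h. (a * uxy z + b * vxy z) * Re h + (a * uyy z + b * vyy z) * Im h)) (at z)"
      by (rule has_derivative_eq_rhs, (rule derivative_intros u(4)[OF z] v(3)[OF z])+) (auto simp: algebra_simps)
    show "a * uxx z + b * vxx z + (a * uyy z + b * vyy z) = 0"
      using u(5)[OF z] v(4)[OF z] by (metis (no_types, lifting) add.assoc add.commute add.left_commute distrib_left mult_zero_right add_0)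
  qed (use u v in \<open>auto intro!: continuous_intros\<close>)
qed

lemma harmonic_on_cong:
  assumes "harmonic_on u S" "\<And>z. z \<in> S \<Longrightarrow> v z = u z"
  shows "harmonic_on v S"
proof -
  obtain ux uy uxx uxy uyy where u: "open S"
    "\<forall>z\<in>S. (u has_derivative (\<lambda>h. ux z * Re h + uy z * Im h)) (at z) \<and>
               (ux has_derivative (\<lambda>h. uxx z * Re h + uxy z * Im h)) (at z) \<and>
               (uy has_derivative (\<lambda>h. uxy z * Re h + uyy z * Im h)) (at z) \<and>
               uxx z + uyy z = 0"
    "continuous_on S uxx" "continuous_on S uxy" "continuous_on S uyy"
    using assms(1) unfolding harmonic_on_def by blast
  have "(v has_derivative (\<lambda>h. ux z * Re h + uy z * Im h)) (at z)" if z: "z \<in> S" for z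
  proof (rule has_derivative_transform_within_open)
    show "(u has_derivative (\<lambda>h. ux z * Re h + uy z * Im h)) (at z)" using u(2) z by blast
  qed (use assms(2) u(1) z in auto)
  then have "\<forall>z\<in>S. (v has_derivative (\<lambda>h. ux z * Re h + uy z * Im h)) (at z) \<and>
               (ux has_derivative (\<lambda>h. uxx z * Re h + uxy z * Im h)) (at z) \<and>
               (uy has_derivative (\<lambda>h. uxy z * Re h + uyy z * Im h)) (at z) \<and>
               uxx z + uyy z = 0"
    using u(2) by blast
  then show ?thesis using u(1,3,4,5) unfolding harmonic_on_def by blast
qed

text \<open>
  If \<open>L = W'/W\<close>, then \<open>ln |W|\<close> has the partial derivatives \<open>Re L\<close> and \<open>- Im L\<close>, and those of \<open>L\<close>
  come from the holomorphic derivative of \<open>L\<close>.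
\<close>

lemma harmonic_on_ln_norm:
  assumes S: "open S" and W: "W holomorphic_on S" "\<And>z. z \<in> S \<Longrightarrow> W z \<noteq> 0"
  shows "harmonic_on (\<lambda>z. ln (norm (W z))) S"
proof -
  define L where "L = (\<lambda>z. deriv W z / W z)"
  have L: "L holomorphic_on S" unfolding L_def
    using S W by (intro holomorphic_intros holomorphic_deriv) auto
  have dL: "(L has_field_derivative deriv L z) (at z)" if "z \<in> S" for z
    using L S that by (rule holomorphic_derivI)
  have dW: "(W has_field_derivative deriv W z) (at z)" if "z \<in> S" for z
    using W(1) S that by (rule holomorphic_derivI)
  have c: "continuous_on S (deriv L)"
    using L S holomorphic_deriv holomorphic_on_imp_continuous_on by blast
  show ?thesis unfolding harmonic_on_def
  proof (intro conjI exI ballI)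
    fix z assume z: "z \<in> S"
    have dr: "((\<lambda>x. Re (L x)) has_derivative (\<lambda>h. Re (deriv L z * h))) (at z)"
      and di: "((\<lambda>x. Im (L x)) has_derivative (\<lambda>h. Im (deriv L z * h))) (at z)"
      using dL[OF z] unfolding has_field_derivative_def
      by (intro has_derivative_Re has_derivative_Im; simp)+
    have "((\<lambda>x. norm (W x)) has_derivative (\<lambda>h. (deriv W z * h) \<bullet> sgn (W z))) (at z)"
      using dW[OF z] GDERIV_norm[OF W(2)[OF z]] unfolding has_field_derivative_def gderiv_def
      by (rule has_derivative_compose)
    then have "((\<lambda>x. ln (norm (W x))) has_derivative
        (\<lambda>h. ((deriv W z * h) \<bullet> sgn (W z)) * inverse (norm (W z)))) (at z)"
      using W(2)[OF z] by (intro has_derivative_ln) auto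
    moreover have "((deriv W z * h) \<bullet> sgn (W z)) * inverse (norm (W z)) = Re (L z * h)" for h
    proof -
      have "(a \<bullet> sgn w) * inverse (norm w) = Re (a / w)" for a w :: complex
      proof -
        have "a \<bullet> sgn w = inverse (norm w) * (a \<bullet> w)" by (simp add: sgn_div_norm)
        moreover have "Re (a / w) = (a \<bullet> w) / (norm w)\<^sup>2"
          unfolding complex_div_cnj[of a w] of_real_power[symmetric] Re_divide_of_real
          by (simp add: inner_complex_def)
        ultimately show ?thesis by (simp add: power2_eq_square divide_inverse)
      qed
      then show ?thesis using W(2)[OF z] by (simp add: L_def)
    qed
    ultimately show "((\<lambda>x. ln (norm (W x))) has_derivative (\<lambda>h. Re (L z) * Re h + (- Im (L z)) * Im h)) (at z)"
      by simp
    show "((\<lambda>x. Re (L x)) has_derivative (\<lambda>h. Re (deriv L z) * Re h + (- Im (deriv L z)) * Im h)) (at z)"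
      using dr by simp
    show "((\<lambda>x. - Im (L x)) has_derivative (\<lambda>h. (- Im (deriv L z)) * Re h + (- Re (deriv L z)) * Im h)) (at z)"
      using has_derivative_minus[OF di] by (simp add: algebra_simps)
    show "Re (deriv L z) + - Re (deriv L z) = 0" by simp
  qed (use S c in \<open>auto intro!: continuous_intros\<close>)
qed

lemma second_derivative_test_max:
  fixes \<phi> \<phi>' :: "real \<Rightarrow> real"
  assumes r: "0 < r" and d: "\<And>x. \<bar>x\<bar> < r \<Longrightarrow> (\<phi> has_real_derivative \<phi>' x) (at x)"
    and d2: "(\<phi>' has_real_derivative c) (at 0)" and max: "\<And>x. \<bar>x\<bar> < r \<Longrightarrow> \<phi> x \<le> \<phi> 0"
  shows "c \<le> 0"
proof (rule ccontr)
  assume "\<not> c \<le> 0"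
  have 0: "\<phi>' 0 = 0"
    using DERIV_local_max[OF d[of 0] r] max r by auto
  obtain e where e: "0 < e" "\<And>h. 0 < h \<Longrightarrow> h < e \<Longrightarrow> \<phi>' 0 < \<phi>' (0 + h)"
    using DERIV_pos_inc_right[OF d2] \<open>\<not> c \<le> 0\<close> by auto
  define h where "h = min e r / 2"
  have h: "0 < h" "h < e" "h < r" using e r by (auto simp: h_def)
  obtain y where y: "0 < y" "y < h" "\<phi> h - \<phi> 0 = (h - 0) * \<phi>' y"
    using MVT2[of 0 h \<phi> \<phi>'] d h by force
  have "0 < \<phi>' y" using e(2)[of y] y h 0 by simp
  then have "\<phi> 0 < \<phi> h" using y(3) h by (smt (verit) mult_pos_pos)
  then show False using max[of h] h by simp
qed

text \<open>
  Weak maximum principle. The compactness of the superlevel sets replaces boundary conditions: it says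
  that the upper limit of \<open>v\<close> at the boundary, including infinity, is at most 0.
\<close>

lemma harmonic_nonpos:
  assumes v: "harmonic_on v S"
    and comp: "\<And>\<eta>. 0 < \<eta> \<Longrightarrow> compact {z\<in>S. \<eta> \<le> v z}"
    and z: "z \<in> S"
  shows "v z \<le> 0"
proof (rule ccontr)
  assume neg: "\<not> v z \<le> 0"
  obtain vx vy vxx vxy vyy where h: "open S"
    "\<And>z. z \<in> S \<Longrightarrow> (v has_derivative (\<lambda>h. vx z * Re h + vy z * Im h)) (at z)"
    "\<And>z. z \<in> S \<Longrightarrow> (vx has_derivative (\<lambda>h. vxx z * Re h + vxy z * Im h)) (at z)"
    "\<And>z. z \<in> S \<Longrightarrow> (vy has_derivative (\<lambda>h. vxy z * Re h + vyy z * Im h)) (at z)"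
    "\<And>z. z \<in> S \<Longrightarrow> vxx z + vyy z = 0"
    using v unfolding harmonic_on_def by blast
  define \<eta> where "\<eta> = v z / 2"
  define C where "C = {z\<in>S. \<eta> \<le> v z}"
  have \<eta>: "0 < \<eta>" "v z = 2 * \<eta>" using neg by (auto simp: \<eta>_def)
  have C: "compact C" "z \<in> C" using comp[OF \<eta>(1)] z \<eta> by (auto simp: C_def)
  obtain R where R: "0 < R" "\<And>x. x \<in> C \<Longrightarrow> norm x \<le> R"
    using compact_imp_bounded[OF C(1)] bounded_pos by blast
  \<comment> \<open>adding \<open>\<delta> |x|\<^sup>2\<close> makes the Laplacian positive without moving the maximum to the edge of \<open>C\<close>\<close>
  define \<delta> where "\<delta> = \<eta> / (2 * R\<^sup>2)"
  have \<delta>: "0 < \<delta>" "\<delta> * R\<^sup>2 < \<eta>" using R \<eta> by (auto simp: \<delta>_def)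
  have contv: "continuous_on S v"
    using h(1,2) by (metis continuous_on_eq_continuous_at has_derivative_continuous)
  have "continuous_on C (\<lambda>x. v x + \<delta> * (norm x)\<^sup>2)"
    by (intro continuous_intros continuous_on_subset[OF contv]) (auto simp: C_def)
  then obtain m where m: "m \<in> C" "\<And>x. x \<in> C \<Longrightarrow> v x + \<delta> * (norm x)\<^sup>2 \<le> v m + \<delta> * (norm m)\<^sup>2"
    using continuous_attains_sup[OF C(1)] C(2) by blast
  have "v z \<le> v m + \<delta> * (norm m)\<^sup>2"
    using m(2)[OF C(2)] \<delta>(1) by (smt (verit) mult_nonneg_nonneg zero_le_power2)
  also have "\<dots> \<le> v m + \<delta> * R\<^sup>2"
    using \<delta> R m by (intro add_left_mono mult_left_mono power_mono) auto
  finally have vm: "\<eta> < v m" using \<delta> \<eta> by linarith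
  have mS: "m \<in> S" using m by (simp add: C_def)
  have "\<forall>\<^sub>F x in nhds m. \<eta> < v x"
    using contv h(1) mS vm by (metis continuous_on_eq_continuous_at isCont_def order_tendstoD(1) tendsto_at_iff_tendsto_nhds)
  moreover have "\<forall>\<^sub>F x in nhds m. x \<in> S" using h(1) mS by (rule eventually_nhds_in_open)
  ultimately have "\<forall>\<^sub>F x in nhds m. x \<in> C"
    by eventually_elim (simp add: C_def)
  then obtain r where r: "0 < r" "\<And>x. dist x m < r \<Longrightarrow> x \<in> C"
    unfolding eventually_nhds_metric by blast
  have inS: "x \<in> S" if "dist x m < r" for x using r(2)[OF that] by (simp add: C_def)
  have second: "vxx m * (Re d)\<^sup>2 + 2 * vxy m * Re d * Im d + vyy m * (Im d)\<^sup>2 + 2 * \<delta> \<le> 0"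
    if d: "norm d = 1" for d :: complex
  proof -
    have line: "((\<lambda>x. w (m + d * of_real x)) has_real_derivative wx * Re d + wy * Im d) (at x)"
      if "(w has_derivative (\<lambda>h. wx * Re h + wy * Im h)) (at (m + d * of_real x))" for w wx wy x
    proof -
      have "((\<lambda>x. m + d * of_real x) has_derivative (\<lambda>h. d * of_real h)) (at x)"
        by (rule has_derivative_eq_rhs, (rule derivative_intros)+) auto
      from has_derivative_compose[OF this that]
      have "((\<lambda>x. w (m + d * of_real x)) has_derivative (\<lambda>h. wx * Re (d * of_real h) + wy * Im (d * of_real h))) (at x)" .
      then show ?thesis unfolding has_field_derivative_def
        by (rule has_derivative_eq_rhs) (auto simp: fun_eq_iff algebra_simps)
    qed
    have nd: "(norm (m + d * of_real x))\<^sup>2 = (norm m)\<^sup>2 + 2 * x * Re (cnj m * d) + x\<^sup>2" for x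
    proof -
      have "(norm (m + d * of_real x))\<^sup>2 = (norm m)\<^sup>2 + 2 * x * Re (cnj m * d) + x\<^sup>2 * (norm d)\<^sup>2"
        unfolding cmod_power2 by (simp add: power2_eq_square algebra_simps)
      then show ?thesis using d by simp
    qed
    show ?thesis
    proof (rule second_derivative_test_max[where r = r
        and \<phi> = "\<lambda>x. v (m + d * of_real x) + \<delta> * ((norm m)\<^sup>2 + 2 * x * Re (cnj m * d) + x\<^sup>2)"
        and \<phi>' = "\<lambda>x. vx (m + d * of_real x) * Re d + vy (m + d * of_real x) * Im d
                    + \<delta> * (2 * Re (cnj m * d) + 2 * x)"])
      fix x :: real assume x: "\<bar>x\<bar> < r"
      have dm: "dist (m + d * of_real x) m < r" using x d by (simp add: dist_norm norm_mult)
      show "((\<lambda>x. v (m + d * of_real x) + \<delta> * ((norm m)\<^sup>2 + 2 * x * Re (cnj m * d) + x\<^sup>2)) has_real_derivative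
          vx (m + d * of_real x) * Re d + vy (m + d * of_real x) * Im d + \<delta> * (2 * Re (cnj m * d) + 2 * x)) (at x)"
        by (rule derivative_eq_intros line[OF h(2)[OF inS[OF dm]]] refl)+ simp
      show "v (m + d * of_real x) + \<delta> * ((norm m)\<^sup>2 + 2 * x * Re (cnj m * d) + x\<^sup>2)
          \<le> v (m + d * of_real 0) + \<delta> * ((norm m)\<^sup>2 + 2 * 0 * Re (cnj m * d) + 0\<^sup>2)"
        using m(2)[OF r(2)[OF dm]] unfolding nd by simp
    next
      have m0: "m + d * of_real 0 \<in> S" using mS by simp
      note l3 = line[OF h(3)[OF m0]] and l4 = line[OF h(4)[OF m0]]
      show "((\<lambda>x. vx (m + d * of_real x) * Re d + vy (m + d * of_real x) * Im d + \<delta> * (2 * Re (cnj m * d) + 2 * x))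
          has_real_derivative vxx m * (Re d)\<^sup>2 + 2 * vxy m * Re d * Im d + vyy m * (Im d)\<^sup>2 + 2 * \<delta>) (at 0)"
        by (rule derivative_eq_intros l3 l4 refl)+ (simp add: power2_eq_square algebra_simps)
    qed (use r in auto)
  qed
  show False using second[of 1] second[of \<i>] h(5)[OF mS] \<delta>(1) by simp
qed

text \<open>
  The difference \<open>g - g'\<close> is bounded near infinity but need not tend to 0 there; \<open>g - (1 + \<epsilon>) g'\<close>
  tends to \<open>-\<infinity>\<close>, so the maximum principle applies to it, and then \<open>\<epsilon>\<close> tends to 0.
\<close>

lemma green_function_le:
  assumes S: "compact S" and g: "green_function_at_infinity S g" and g': "green_function_at_infinity S g'"
    and z: "z \<notin> S"
  shows "g z \<le> g' z"
proof -
  obtain c where c: "((\<lambda>\<zeta>. g \<zeta> - ln (norm \<zeta>)) \<longlongrightarrow> c) at_infinity"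
    using g unfolding green_function_at_infinity_def by blast
  obtain c' where c': "((\<lambda>\<zeta>. g' \<zeta> - ln (norm \<zeta>)) \<longlongrightarrow> c') at_infinity"
    using g' unfolding green_function_at_infinity_def by blast
  have lninf: "filterlim (\<lambda>\<zeta>::complex. ln (norm \<zeta>)) at_top at_infinity"
    by (intro filterlim_compose[OF ln_at_top] filterlim_norm_at_top)
  have le: "g z \<le> (1 + \<epsilon>) * g' z" if \<epsilon>: "0 < \<epsilon>" for \<epsilon>
  proof -
    define v where "v = (\<lambda>z. 1 * g z + (- (1 + \<epsilon>)) * g' z)"
    have hv: "harmonic_on v (- S)" unfolding v_def
      using g g' by (intro harmonic_on_lincomb) (auto simp: green_function_at_infinity_def)
    have contv: "isCont v x" if "x \<notin> S" for x
      using hv that unfolding harmonic_on_def by (meson ComplI has_derivative_continuous)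
    have "((\<lambda>\<zeta>. (g \<zeta> - ln (norm \<zeta>)) - (1 + \<epsilon>) * (g' \<zeta> - ln (norm \<zeta>))) \<longlongrightarrow> c - (1 + \<epsilon>) * c') at_infinity"
      by (intro tendsto_intros c c')
    moreover have "filterlim (\<lambda>\<zeta>::complex. \<epsilon> * ln (norm \<zeta>)) at_top at_infinity"
      using \<epsilon> lninf by (intro filterlim_tendsto_pos_mult_at_top[OF tendsto_const]) auto
    ultimately have "filterlim (\<lambda>\<zeta>. - ((g \<zeta> - ln (norm \<zeta>)) - (1 + \<epsilon>) * (g' \<zeta> - ln (norm \<zeta>))) + \<epsilon> * ln (norm \<zeta>)) at_top at_infinity"
      by (intro filterlim_tendsto_add_at_top[OF tendsto_minus])
    then have vinf: "filterlim v at_bot at_infinity"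
      unfolding filterlim_uminus_at_bot by (simp add: v_def algebra_simps)
    have vS: "(v \<longlongrightarrow> 0) (at \<zeta> within - S)" if "\<zeta> \<in> S" for \<zeta>
    proof -
      have "(v \<longlongrightarrow> 1 * 0 + (- (1 + \<epsilon>)) * 0) (at \<zeta> within - S)" unfolding v_def
        using g g' that by (intro tendsto_intros) (auto simp: green_function_at_infinity_def)
      then show ?thesis by simp
    qed
    have "v z \<le> 0"
    proof (rule harmonic_nonpos[OF hv])
      fix \<eta> :: real assume \<eta>: "0 < \<eta>"
      have "\<forall>\<^sub>F x in at_infinity. v x < \<eta>"
        using vinf by (simp add: filterlim_at_bot_dense)
      then obtain b where b: "\<And>x. b \<le> norm x \<Longrightarrow> v x < \<eta>"
        unfolding eventually_at_infinity by blast
      have bd: "bounded {z\<in>-S. \<eta> \<le> v z}"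
        unfolding bounded_iff by (rule exI[of _ b]) (use b in \<open>force simp: not_less[symmetric]\<close>)
      have "closed {z\<in>-S. \<eta> \<le> v z}"
        unfolding closed_sequential_limits
      proof (intro allI impI, elim conjE)
        fix x l assume x: "\<forall>n::nat. x n \<in> {z\<in>-S. \<eta> \<le> v z}" and l: "x \<longlonglongrightarrow> l"
        show "l \<in> {z\<in>-S. \<eta> \<le> v z}"
        proof (cases "l \<in> S")
          case True
          have "filterlim x (at l within - S) sequentially"
            unfolding filterlim_at using l x True by (auto intro!: always_eventually)
          from filterlim_compose[OF vS[OF True] this] have "(\<lambda>n. v (x n)) \<longlonglongrightarrow> 0" .
          then have "\<eta> \<le> 0" by (rule LIMSEQ_le_const) (use x in auto)
          then show ?thesis using \<eta> by simp
        next
          case False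
          have "(\<lambda>n. v (x n)) \<longlonglongrightarrow> v l"
            using contv[OF False] l by (rule isCont_tendsto_compose)
          then have "\<eta> \<le> v l" by (rule LIMSEQ_le_const) (use x in auto)
          then show ?thesis using False by simp
        qed
      qed
      then show "compact {z\<in>-S. \<eta> \<le> v z}" using bd by (simp add: compact_eq_bounded_closed)
    qed (use z in auto)
    then show ?thesis by (simp add: v_def algebra_simps)
  qed
  have "((\<lambda>\<epsilon>. (1 + \<epsilon>) * g' z) \<longlongrightarrow> (1 + 0) * g' z) (at_right 0)"
    by (intro tendsto_intros)
  moreover have "\<forall>\<^sub>F \<epsilon> in at_right 0. g z \<le> (1 + \<epsilon>) * g' z"
    using le by (auto simp: eventually_at_right_less intro: eventually_mono[OF eventually_at_right_less])
  ultimately show ?thesis using tendsto_lowerbound[of "\<lambda>\<epsilon>. (1 + \<epsilon>) * g' z"] by fastforce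
qed

lemma green_function_unique:
  assumes "compact S" "green_function_at_infinity S g" "green_function_at_infinity S g'" "z \<notin> S"
  shows "g z = g' z"
  using green_function_le[OF assms] green_function_le[OF assms(1,3,2,4)] by simp

section \<open>The Green function of a segment\<close>

text \<open>
  If \<open>c\<close> is the square root of \<open>p / q\<close> with nonnegative real part, this is \<open>|c - 1|\<^sup>2 / |c + 1|\<^sup>2\<close>, and
  \<open>r\<close> is \<open>|q| Re c\<close>. In this form it is continuous in \<open>p\<close> and \<open>q\<close> across the branch cut of the square
  root and at \<open>q = 0\<close>.
\<close>

definition copy_ratio :: "complex \<Rightarrow> complex \<Rightarrow> real" where
  "copy_ratio p q =
     (let r = sqrt ((norm p * norm q + Re (p * cnj q)) / 2)
      in (norm p + norm q - 2 * r) / (norm p + norm q + 2 * r))"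

lemma Re_mult_cnj_ge: "0 \<le> norm p * norm q + Re (p * cnj q)"
  using abs_Re_le_cmod[of "p * cnj q"] by (simp add: norm_mult)

lemma continuous_on_copy_ratio:
  assumes "continuous_on S f" "continuous_on S h" "\<And>x. x \<in> S \<Longrightarrow> f x \<noteq> 0 \<or> h x \<noteq> 0"
  shows "continuous_on S (\<lambda>x. copy_ratio (f x) (h x))"
proof -
  have "norm p + norm q + 2 * sqrt ((norm p * norm q + Re (p * cnj q)) / 2) \<noteq> 0"
    if "p \<noteq> 0 \<or> q \<noteq> 0" for p q :: complex
  proof -
    have "0 < norm p + norm q" using that by (auto simp: add_pos_nonneg add_nonneg_pos)
    moreover have "0 \<le> sqrt ((norm p * norm q + Re (p * cnj q)) / 2)"
      using Re_mult_cnj_ge[of p q] by simp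
    ultimately show ?thesis by linarith
  qed
  then show ?thesis unfolding copy_ratio_def Let_def
    using assms by (intro continuous_intros) auto
qed

lemma copy_ratio_scale:
  assumes "l \<noteq> 0"
  shows "copy_ratio (l * p) (l * q) = copy_ratio p q"
proof -
  define r where "r = sqrt ((norm p * norm q + Re (p * cnj q)) / 2)"
  have re: "Re (of_real x * y) = x * Re y" for x y by simp
  have "Re (l * p * cnj (l * q)) = (norm l)\<^sup>2 * Re (p * cnj q)"
  proof -
    have "l * p * cnj (l * q) = (l * cnj l) * (p * cnj q)" by (simp only: complex_cnj_mult mult_ac)
    also have "\<dots> = of_real ((norm l)\<^sup>2) * (p * cnj q)" by (simp only: complex_norm_square)
    finally show ?thesis by (simp only: re)
  qed
  then have "(norm (l * p) * norm (l * q) + Re (l * p * cnj (l * q))) / 2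
     = (norm l)\<^sup>2 * ((norm p * norm q + Re (p * cnj q)) / 2)"
    by (simp add: norm_mult power2_eq_square algebra_simps)
  note e = this
  have "sqrt ((norm (l * p) * norm (l * q) + Re (l * p * cnj (l * q))) / 2) = norm l * r"
    by (simp only: e real_sqrt_mult r_def real_sqrt_abs abs_norm_cancel)
  then have "copy_ratio (l * p) (l * q) = (norm l * (norm p + norm q - 2 * r)) / (norm l * (norm p + norm q + 2 * r))"
    by (simp add: copy_ratio_def Let_def norm_mult algebra_simps)
  then show ?thesis using assms by (simp add: copy_ratio_def Let_def r_def)
qed

lemma norm_add_one_sq: "(norm (c + 1))\<^sup>2 = (norm c)\<^sup>2 + 1 + 2 * Re c"
  "(norm (c - 1))\<^sup>2 = (norm c)\<^sup>2 + 1 - 2 * Re c"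
  unfolding cmod_power2 by (simp_all add: power2_eq_square algebra_simps)

lemma copy_ratio_root:
  assumes c: "p = c\<^sup>2 * q" "q \<noteq> 0"
  shows "copy_ratio p q = ((norm c)\<^sup>2 + 1 - 2 * \<bar>Re c\<bar>) / ((norm c)\<^sup>2 + 1 + 2 * \<bar>Re c\<bar>)"
proof -
  have "copy_ratio p q = copy_ratio (q * c\<^sup>2) (q * 1)" using c by (simp add: mult.commute)
  also have "\<dots> = copy_ratio (c\<^sup>2) 1" by (rule copy_ratio_scale[OF c(2)])
  also have "\<dots> = ((norm c)\<^sup>2 + 1 - 2 * \<bar>Re c\<bar>) / ((norm c)\<^sup>2 + 1 + 2 * \<bar>Re c\<bar>)"
  proof -
    have "((norm c)\<^sup>2 + Re (c\<^sup>2)) / 2 = (Re c)\<^sup>2"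
      unfolding cmod_power2 by (simp add: power2_eq_square)
    then show ?thesis by (simp add: copy_ratio_def Let_def norm_power)
  qed
  finally show ?thesis .
qed

lemma copy_ratio_eq:
  assumes "p = c\<^sup>2 * q" "q \<noteq> 0" "0 \<le> Re c"
  shows "copy_ratio p q = (norm (c - 1))\<^sup>2 / (norm (c + 1))\<^sup>2"
  unfolding norm_add_one_sq copy_ratio_root[OF assms(1,2)] using assms(3) by simp

text \<open>
  Of the two square roots \<open>c\<close>, the one in the right half-plane gives the smaller value.
\<close>

lemma copy_ratio_le:
  assumes "p = c\<^sup>2 * q" "q \<noteq> 0" "c \<noteq> - 1"
  shows "copy_ratio p q \<le> (norm (c - 1))\<^sup>2 / (norm (c + 1))\<^sup>2"
proof (cases "0 \<le> Re c")
  case True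
  then show ?thesis using copy_ratio_eq[OF assms(1,2)] by simp
next
  case False
  have "0 < (norm (c + 1))\<^sup>2" using assms(3) by (simp add: eq_neg_iff_add_eq_0)
  moreover have "copy_ratio p q \<le> 1"
    unfolding copy_ratio_root[OF assms(1,2)]
    by (subst divide_le_eq_1_pos) (simp_all add: add_nonneg_pos add_pos_nonneg)
  moreover have "(norm (c + 1))\<^sup>2 \<le> (norm (c - 1))\<^sup>2" using False unfolding norm_add_one_sq by simp
  ultimately show ?thesis by (smt (verit) le_divide_eq_1_pos)
qed

lemma copy_ratio_zero_right: "p \<noteq> 0 \<Longrightarrow> copy_ratio p 0 = 1"
  by (simp add: copy_ratio_def)

lemma copy_ratio_bounds:
  assumes "p \<noteq> 0 \<or> q \<noteq> 0"
  shows "0 \<le> copy_ratio p q" "copy_ratio p q \<le> 1" "p \<noteq> q \<Longrightarrow> 0 < copy_ratio p q"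
proof -
  have "0 \<le> copy_ratio p q \<and> copy_ratio p q \<le> 1 \<and> (p \<noteq> q \<longrightarrow> 0 < copy_ratio p q)"
  proof (cases "q = 0")
    case True
    then show ?thesis using assms by (simp add: copy_ratio_zero_right)
  next
    case False
    define c where "c = csqrt (p / q)"
    have c: "p = c\<^sup>2 * q" "0 \<le> Re c" using False csqrt_principal[of "p / q"] by (auto simp: c_def)
    have n1: "c + 1 \<noteq> 0"
    proof
      assume "c + 1 = 0"
      then have "Re (c + 1) = 0" by simp
      then show False using c(2) by simp
    qed
    have "(norm (c - 1))\<^sup>2 \<le> (norm (c + 1))\<^sup>2" using c unfolding norm_add_one_sq by simp
    moreover have "c \<noteq> 1" if "p \<noteq> q" using that c by auto
    ultimately show ?thesis unfolding copy_ratio_eq[OF c(1) False c(2)]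
      using n1 by (auto simp: divide_le_eq_1)
  qed
  then show "0 \<le> copy_ratio p q" "copy_ratio p q \<le> 1" "p \<noteq> q \<Longrightarrow> 0 < copy_ratio p q" by auto
qed

lemma csqrt_quotient_pos:
  assumes ab: "a \<noteq> b" and z: "z \<notin> closed_segment a b"
  shows "0 < Re (csqrt ((z - b) / (z - a)))" "z \<noteq> a" "(z - b) / (z - a) \<noteq> 1" "(z - b) / (z - a) \<notin> \<real>\<^sub>\<le>\<^sub>0"
proof -
  let ?c = "csqrt ((z - b) / (z - a))"
  show za: "z \<noteq> a" using z by auto
  show np: "(z - b) / (z - a) \<notin> \<real>\<^sub>\<le>\<^sub>0" using quotient_nonpos_iff[OF za ab] z by simp
  show "0 < Re ?c"
  proof (rule ccontr)
    assume "\<not> 0 < Re ?c"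
    then have "Re ?c = 0" using Re_csqrt[of "(z - b) / (z - a)"] by linarith
    then have "Im (?c\<^sup>2) = 0" "Re (?c\<^sup>2) \<le> 0"
      by (simp_all add: power2_eq_square del: csqrt.simps)
    then show False using np by (simp add: complex_nonpos_Reals_iff)
  qed
  show "(z - b) / (z - a) \<noteq> 1" using za ab by (auto simp: divide_eq_1_iff)
qed

lemma copy_ratio_one_on_segment:
  assumes ab: "a \<noteq> b" and z: "z \<in> closed_segment a b"
  shows "copy_ratio (z - b) (z - a) = 1"
proof (cases "z = a")
  case True
  then show ?thesis using ab by (simp add: copy_ratio_zero_right)
next
  case False
  define c where "c = csqrt ((z - b) / (z - a))"
  have "(z - b) / (z - a) \<in> \<real>\<^sub>\<le>\<^sub>0" using z quotient_nonpos_iff[OF False ab] by simp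
  then have "Re c = 0" unfolding c_def by (auto elim!: nonpos_Reals_cases)
  moreover have "z - b = c\<^sup>2 * (z - a)" using False by (simp add: c_def)
  ultimately show ?thesis
    using copy_ratio_root[of "z - b" c "z - a"] False by (simp add: add_nonneg_eq_0_iff)
qed

text \<open>
  The function \<open>W = (s + 1) / (s - 1)\<close> of the square root \<open>s\<close> of \<open>(\<zeta> - b) / (\<zeta> - a)\<close> maps the
  complement of the segment to the exterior of the unit circle, with a simple pole at infinity; so
  \<open>ln |W|\<close> is the Green function.
\<close>

lemma green_function_segment:
  assumes ab: "a \<noteq> b"
  shows "green_function_at_infinity (closed_segment a b) (\<lambda>\<zeta>. - ln (copy_ratio (\<zeta> - b) (\<zeta> - a)) / 2)"
    (is "green_function_at_infinity ?S ?g")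
proof -
  define s where "s = (\<lambda>\<zeta>. csqrt ((\<zeta> - b) / (\<zeta> - a)))"
  define W where "W = (\<lambda>\<zeta>. (s \<zeta> + 1) / (s \<zeta> - 1))"
  have s2: "\<zeta> - b = (s \<zeta>)\<^sup>2 * (\<zeta> - a)" if "\<zeta> \<noteq> a" for \<zeta> using that by (simp add: s_def)
  have Re_s: "0 < Re (s \<zeta>)" if "\<zeta> \<notin> ?S" for \<zeta>
    unfolding s_def using csqrt_quotient_pos[OF ab that] by blast
  have s1: "s \<zeta> + 1 \<noteq> 0" "s \<zeta> - 1 \<noteq> 0" if "\<zeta> \<notin> ?S" for \<zeta>
  proof -
    have "Re (s \<zeta> + 1) \<noteq> 0" using Re_s[OF that] by simp
    then show "s \<zeta> + 1 \<noteq> 0" by (metis zero_complex.sel(1))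
    show "s \<zeta> - 1 \<noteq> 0" using csqrt_quotient_pos(3)[OF ab that] by (simp add: s_def)
  qed
  have holW: "W holomorphic_on - ?S"
    unfolding W_def
  proof (intro holomorphic_intros)
    show "s holomorphic_on - ?S" "s holomorphic_on - ?S" unfolding s_def
      using csqrt_quotient_pos(2,4)[OF ab] by (intro holomorphic_intros; auto)+
  qed (use s1 in auto)
  have gW: "?g \<zeta> = ln (norm (W \<zeta>))" if "\<zeta> \<notin> ?S" for \<zeta>
  proof -
    have "copy_ratio (\<zeta> - b) (\<zeta> - a) = (norm (s \<zeta> - 1))\<^sup>2 / (norm (s \<zeta> + 1))\<^sup>2"
      using csqrt_quotient_pos(2)[OF ab that] Re_s[OF that] s2 by (intro copy_ratio_eq) auto
    also have "\<dots> = inverse ((norm (W \<zeta>))\<^sup>2)"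
      using s1[OF that] by (simp add: W_def norm_divide power_divide)
    finally show ?thesis
      using s1[OF that] by (simp add: W_def ln_inverse ln_realpow)
  qed
  have cont: "continuous_on UNIV (\<lambda>\<zeta>. copy_ratio (\<zeta> - b) (\<zeta> - a))"
    using ab by (intro continuous_on_copy_ratio continuous_intros) auto
  note one = copy_ratio_one_on_segment[OF ab]
  have "harmonic_on (\<lambda>\<zeta>. ln (norm (W \<zeta>))) (- ?S)"
    using s1 by (intro harmonic_on_ln_norm holW) (auto simp: W_def)
  then have h: "harmonic_on ?g (- ?S)"
    by (rule harmonic_on_cong) (use gW in auto)
  have "(?g \<longlongrightarrow> 0) (at \<zeta> within - ?S)" if "\<zeta> \<in> ?S" for \<zeta>
  proof -
    have "((\<lambda>\<zeta>. copy_ratio (\<zeta> - b) (\<zeta> - a)) \<longlongrightarrow> 1) (at \<zeta> within - ?S)"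
      using cont one[OF that] by (metis (mono_tags, lifting) UNIV_I continuous_on_def tendsto_within_subset top_greatest)
    then have "(?g \<longlongrightarrow> - ln 1 / 2) (at \<zeta> within - ?S)"
      by (intro tendsto_intros) auto
    then show ?thesis by simp
  qed
  moreover have "((\<lambda>\<zeta>. ?g \<zeta> - ln (norm \<zeta>)) \<longlongrightarrow> ln (norm (4 / (a - b)))) at_infinity"
  proof -
    have inv: "((\<lambda>\<zeta>::complex. 1 / \<zeta>) \<longlongrightarrow> 0) at_infinity"
      using tendsto_inverse_0 by (rule Lim_transform_eventually) (simp add: inverse_eq_divide)
    have ev: "\<forall>\<^sub>F \<zeta> in at_infinity. \<zeta> \<notin> ?S \<and> \<zeta> \<noteq> 0"
    proof -
      have "bounded (insert 0 ?S)" by (simp add: compact_imp_bounded[OF compact_segment])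
      then obtain B where "\<And>x. x \<in> insert 0 ?S \<Longrightarrow> norm x \<le> B" unfolding bounded_iff by blast
      then show ?thesis unfolding eventually_at_infinity
        by (intro exI[of _ "B + 1"]) force
    qed
    have "((\<lambda>\<zeta>. (1 - b * (1 / \<zeta>)) / (1 - a * (1 / \<zeta>))) \<longlongrightarrow> (1 - b * 0) / (1 - a * 0)) at_infinity"
      by (intro tendsto_intros inv) auto
    moreover have "\<forall>\<^sub>F \<zeta> in at_infinity. (1 - b * (1 / \<zeta>)) / (1 - a * (1 / \<zeta>)) = (\<zeta> - b) / (\<zeta> - a)"
      using ev
    proof eventually_elim
      case (elim \<zeta>)
      have "(1 - b * (1 / \<zeta>)) / (1 - a * (1 / \<zeta>)) = (\<zeta> * (1 - b * (1 / \<zeta>))) / (\<zeta> * (1 - a * (1 / \<zeta>)))"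
        using elim by simp
      then show ?case using elim by (simp add: algebra_simps)
    qed
    ultimately have "((\<lambda>\<zeta>. (\<zeta> - b) / (\<zeta> - a)) \<longlongrightarrow> 1) at_infinity"
      by (simp add: tendsto_cong)
    then have slim: "(s \<longlongrightarrow> 1) at_infinity"
      unfolding s_def using isCont_tendsto_compose[OF continuous_at_csqrt, of 1] by simp
    have "((\<lambda>\<zeta>. (s \<zeta> + 1)\<^sup>2 / (a * (s \<zeta>)\<^sup>2 - b)) \<longlongrightarrow> (1 + 1)\<^sup>2 / (a * 1\<^sup>2 - b)) at_infinity"
      using ab by (intro tendsto_intros slim) auto
    then have "((\<lambda>\<zeta>. ln (norm ((s \<zeta> + 1)\<^sup>2 / (a * (s \<zeta>)\<^sup>2 - b)))) \<longlongrightarrow> ln (norm (4 / (a - b)))) at_infinity"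
      using ab by (intro tendsto_ln tendsto_norm) auto
    moreover have "\<forall>\<^sub>F \<zeta> in at_infinity. ln (norm ((s \<zeta> + 1)\<^sup>2 / (a * (s \<zeta>)\<^sup>2 - b))) = ?g \<zeta> - ln (norm \<zeta>)"
      using ev
    proof eventually_elim
      case (elim \<zeta>)
      then have z: "\<zeta> \<notin> ?S" "\<zeta> \<noteq> 0" by auto
      have "\<zeta> - b = (s \<zeta>)\<^sup>2 * (\<zeta> - a)" using s2 csqrt_quotient_pos(2)[OF ab z(1)] by blast
      then have e: "a * (s \<zeta>)\<^sup>2 - b = \<zeta> * ((s \<zeta> - 1) * (s \<zeta> + 1))"
        by (simp add: algebra_simps power2_eq_square)
      have "(s \<zeta> + 1)\<^sup>2 / (a * (s \<zeta>)\<^sup>2 - b) = W \<zeta> / \<zeta>"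
        unfolding e W_def using s1[OF z(1)] z by (simp add: divide_simps power2_eq_square)
      moreover have "W \<zeta> \<noteq> 0" using s1[OF z(1)] by (simp add: W_def)
      ultimately show ?case using z gW[OF z(1)] by (simp add: norm_divide ln_div)
    qed
    ultimately show ?thesis by (simp add: tendsto_cong)
  qed
  ultimately show ?thesis using h unfolding green_function_at_infinity_def by blast
qed

section \<open>The first sheet in the uniformising coordinate\<close>

lemma sorted_list_of_multiset_least:
  assumes "\<And>y. y \<in># M \<Longrightarrow> x \<le> y"
  shows "sorted_list_of_multiset (add_mset x M) = x # sorted_list_of_multiset M"
  by (simp add: insort_is_Cons assms)

text \<open>
  The two preimages have the sum \<open>2 z\<close> and the product 1.
\<close>

lemma joukowski_fiber_Some:
  assumes "\<zeta> \<noteq> 0"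
  shows "joukowski_fiber (Some ((\<zeta> + 1 / \<zeta>) / 2)) = {#Some \<zeta>, Some (1 / \<zeta>)#}"
proof -
  define z c where "z = (\<zeta> + 1 / \<zeta>) / 2" and "c = csqrt (z\<^sup>2 - 1)"
  have c2: "c\<^sup>2 = z\<^sup>2 - 1" by (simp add: c_def)
  have "c\<^sup>2 = ((\<zeta> - 1 / \<zeta>) / 2)\<^sup>2"
    unfolding c2 z_def using assms by (simp add: power2_eq_square field_simps)
  then have "c = (\<zeta> - 1 / \<zeta>) / 2 \<or> c = - ((\<zeta> - 1 / \<zeta>) / 2)" by (simp only: power2_eq_iff)
  then consider "c = (\<zeta> - 1 / \<zeta>) / 2" | "c = - ((\<zeta> - 1 / \<zeta>) / 2)" by blast
  then have "z + c = \<zeta> \<and> z - c = 1 / \<zeta> \<or> z + c = 1 / \<zeta> \<and> z - c = \<zeta>"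
  proof cases
    have u: "(u + v) / 2 + (u - v) / 2 = u" "(u + v) / 2 - (u - v) / 2 = v" for u v :: complex
      by (simp_all add: field_simps)
    case 1
    show ?thesis unfolding z_def 1 u by simp
  next
    have u: "(u + v) / 2 + (u - v) / 2 = u" "(u + v) / 2 - (u - v) / 2 = v" for u v :: complex
      by (simp_all add: field_simps)
    case 2
    show ?thesis unfolding z_def 2 add_uminus_conv_diff diff_minus_eq_add u by simp
  qed
  then show ?thesis unfolding joukowski_fiber_def z_def[symmetric]
    by (auto simp: c_def[symmetric] add_mset_commute)
qed

lemma joukowski_surj:
  obtains \<zeta> :: complex where "\<zeta> \<noteq> 0" "z = (\<zeta> + 1 / \<zeta>) / 2"
proof -
  have "joukowski (Some (z + csqrt (z\<^sup>2 - 1))) = Some z"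
    by (simp add: in_joukowski_fiber[symmetric] joukowski_fiber_def)
  then show ?thesis by (intro that[of "z + csqrt (z\<^sup>2 - 1)"]) (auto simp: joukowski_def split: if_splits)
qed

locale cut_surface =
  fixes A B \<alpha> \<beta> :: complex
  assumes AB: "A \<noteq> B" "1 < norm A" "1 < norm B" and \<alpha>_eq: "\<alpha> = 1 / A" and \<beta>_eq: "\<beta> = 1 / B"
begin

lemma parameters: "A \<noteq> 0" "B \<noteq> 0" "\<alpha> \<noteq> 0" "\<beta> \<noteq> 0" "\<alpha> \<noteq> \<beta>" "norm \<alpha> < 1" "norm \<beta> < 1"
  using AB by (auto simp: \<alpha>_eq \<beta>_eq divide_inverse norm_inverse inverse_less_1_iff)

abbreviation zeta_ratio :: "complex \<Rightarrow> real" where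
  "zeta_ratio \<zeta> \<equiv> copy_ratio (\<zeta> - \<beta>) (\<zeta> - \<alpha>)"

lemma zeta_ratio_bounds: "0 < zeta_ratio \<zeta>" "zeta_ratio \<zeta> \<le> 1"
  using copy_ratio_bounds[of "\<zeta> - \<beta>" "\<zeta> - \<alpha>"] parameters by auto

text \<open>
  Off the cut this is the formula for the Green function; over the cut the ratio is 1, and both sides
  reduce to \<open>- log |\<zeta>|\<close>.
\<close>

lemma nuttall_u_lift:
  assumes g: "green_function_at_infinity (zeta_cut A B) g" and "\<zeta> \<noteq> 0"
  shows "nuttall_u A B g (surf_lift A B (Some \<zeta>)) = ereal (ln (zeta_ratio \<zeta>) - ln (norm \<zeta>))"
    and "nuttall_u A B g (surf_swap (surf_lift A B (Some \<zeta>))) = ereal (- ln (zeta_ratio \<zeta>) - ln (norm \<zeta>))"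
proof -
  have cut: "zeta_cut A B = closed_segment \<alpha> \<beta>" by (simp add: \<alpha>_eq \<beta>_eq)
  have side: "surf_side (surf_lift A B (Some \<zeta>)) = (if \<zeta> \<in> zeta_cut A B then 0 else 1)"
    using surf_side_lift[OF AB(1) parameters(1,2), of "Some \<zeta>"] by auto
  have "2 * surf_side (surf_lift A B (Some \<zeta>)) * g \<zeta> = - ln (zeta_ratio \<zeta>)"
  proof (cases "\<zeta> \<in> zeta_cut A B")
    case True
    then show ?thesis unfolding side using copy_ratio_one_on_segment[OF parameters(5)] by (simp add: cut)
  next
    case False
    then have "g \<zeta> = - ln (zeta_ratio \<zeta>) / 2"
      using green_function_unique[OF compact_segment g[unfolded cut] green_function_segment[OF parameters(5)]]
      by (simp add: cut)
    then show ?thesis unfolding side using False by simp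
  qed
  then show "nuttall_u A B g (surf_lift A B (Some \<zeta>)) = ereal (ln (zeta_ratio \<zeta>) - ln (norm \<zeta>))"
    "nuttall_u A B g (surf_swap (surf_lift A B (Some \<zeta>))) = ereal (- ln (zeta_ratio \<zeta>) - ln (norm \<zeta>))"
    using assms(2) by (simp_all add: nuttall_u_def surf_zeta_lift[OF AB(1) parameters(1,2)])
qed

text \<open>
  The hypothesis \<open>le\<close> says that \<open>u\<close> is smallest at the lift of \<open>\<zeta>\<close>. If it were attained at a second
  of the four points, counted with multiplicity, the two smallest values would agree and the point would
  lie on the boundary.
\<close>

lemma first_sheet_least:
  assumes g: "green_function_at_infinity (zeta_cut A B) g" and \<zeta>: "\<zeta> \<noteq> 0"
    and le: "zeta_ratio \<zeta> \<le> zeta_ratio (1 / \<zeta>) * (norm \<zeta>)\<^sup>2"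
    and E: "Some ((\<zeta> + 1 / \<zeta>) / 2) \<notin> first_boundary A B g"
  shows "zeta_ratio \<zeta> < zeta_ratio (1 / \<zeta>) * (norm \<zeta>)\<^sup>2" "zeta_ratio \<zeta> < 1"
    "sheet_point A B g (Some ((\<zeta> + 1 / \<zeta>) / 2)) 1 = surf_lift A B (Some \<zeta>)"
proof -
  let ?y = "Some ((\<zeta> + 1 / \<zeta>) / 2)" and ?u = "nuttall_u A B g"
  define x x' where "x = surf_lift A B (Some \<zeta>)" and "x' = surf_lift A B (Some (1 / \<zeta>))"
  have i0: "1 / \<zeta> \<noteq> 0" using \<zeta> by simp
  note ux = nuttall_u_lift[OF g \<zeta>, folded x_def] and ux' = nuttall_u_lift[OF g i0, folded x'_def]
  have fib: "surf_fiber A B ?y = {#x, x', surf_swap x, surf_swap x'#}"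
    unfolding surf_fiber_def joukowski_fiber_Some[OF \<zeta>] by (simp add: x_def x'_def)
  have k: "0 < zeta_ratio \<zeta>" "zeta_ratio \<zeta> \<le> 1" "0 < zeta_ratio (1 / \<zeta>)" "zeta_ratio (1 / \<zeta>) \<le> 1"
    using zeta_ratio_bounds by blast+
  have lniff: "ln (zeta_ratio \<zeta>) - ln (norm \<zeta>) \<le> ln (zeta_ratio (1 / \<zeta>)) - ln (norm (1 / \<zeta>)) \<and>
      (ln (zeta_ratio \<zeta>) - ln (norm \<zeta>) = ln (zeta_ratio (1 / \<zeta>)) - ln (norm (1 / \<zeta>)) \<longleftrightarrow>
        zeta_ratio \<zeta> = zeta_ratio (1 / \<zeta>) * (norm \<zeta>)\<^sup>2)"
  proof -
    have e: "ln (zeta_ratio (1 / \<zeta>)) - ln (norm (1 / \<zeta>)) = ln (zeta_ratio (1 / \<zeta>) * (norm \<zeta>)\<^sup>2) - ln (norm \<zeta>)"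
      using \<zeta> k by (simp add: ln_mult ln_div norm_divide ln_realpow)
    have p: "0 < zeta_ratio (1 / \<zeta>) * (norm \<zeta>)\<^sup>2" using \<zeta> k by simp
    show ?thesis unfolding e using le k p by simp
  qed
  have lnk: "ln (zeta_ratio \<zeta>) \<le> 0" "ln (zeta_ratio (1 / \<zeta>)) \<le> 0" using k by simp_all
  have u_le: "?u x \<le> ?u x'" "?u x \<le> ?u (surf_swap x)" "?u x' \<le> ?u (surf_swap x')"
    unfolding ux ux' using lniff lnk by simp_all
  then have min: "?u x \<le> y" if "y \<in># {#?u x', ?u (surf_swap x), ?u (surf_swap x')#}" for y
    using that by auto
  let ?M = "{#?u x', ?u (surf_swap x), ?u (surf_swap x')#}"
  have vals: "nuttall_values A B g ?y = ?u x # sorted_list_of_multiset ?M"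
    unfolding nuttall_values_def fib using sorted_list_of_multiset_least[of ?M "?u x", OF min] by simp
  have notin: "?u x \<notin># ?M"
  proof
    assume "?u x \<in># ?M"
    then obtain N where N: "?M = add_mset (?u x) N" by (metis mset_add)
    have "sorted_list_of_multiset ?M = ?u x # sorted_list_of_multiset N"
      unfolding N by (rule sorted_list_of_multiset_least) (metis N min union_single_eq_member insert_iff set_mset_add_mset_insert)
    then have "nuttall_values A B g ?y ! 0 = nuttall_values A B g ?y ! 1"
      unfolding vals by simp
    then show False using E by (simp add: first_boundary_def)
  qed
  have "zeta_ratio \<zeta> \<noteq> zeta_ratio (1 / \<zeta>) * (norm \<zeta>)\<^sup>2"
    using notin lniff unfolding ux ux' by auto
  then show "zeta_ratio \<zeta> < zeta_ratio (1 / \<zeta>) * (norm \<zeta>)\<^sup>2" using le by simp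
  have "?u x \<noteq> ?u (surf_swap x)" using notin by auto
  then have "zeta_ratio \<zeta> \<noteq> 1" unfolding ux by auto
  then show "zeta_ratio \<zeta> < 1" using k by simp
  show "sheet_point A B g ?y 1 = x"
    unfolding sheet_point_def vals fib
  proof (rule the_equality)
    fix w assume "w \<in># {#x, x', surf_swap x, surf_swap x'#} \<and>
      ?u w = (?u x # sorted_list_of_multiset ?M) ! (1 - 1)"
    then show "w = x" using notin by auto
  qed simp
qed

text \<open>
  One of the two preimages \<open>\<zeta>\<close> and \<open>1 / \<zeta>\<close> satisfies the hypothesis of the previous lemma.
\<close>

lemma first_sheet_exists:
  assumes g: "green_function_at_infinity (zeta_cut A B) g" and E: "Some z \<notin> first_boundary A B g"
  obtains \<zeta> where "\<zeta> \<noteq> 0" "z = (\<zeta> + 1 / \<zeta>) / 2" "zeta_ratio \<zeta> < zeta_ratio (1 / \<zeta>) * (norm \<zeta>)\<^sup>2"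
    "zeta_ratio \<zeta> < 1" "sheet_point A B g (Some z) 1 = surf_lift A B (Some \<zeta>)"
proof -
  obtain \<zeta> where \<zeta>: "\<zeta> \<noteq> 0" "z = (\<zeta> + 1 / \<zeta>) / 2" by (rule joukowski_surj)
  show ?thesis
  proof (cases "zeta_ratio \<zeta> \<le> zeta_ratio (1 / \<zeta>) * (norm \<zeta>)\<^sup>2")
    case True
    then show ?thesis using that[OF \<zeta>] first_sheet_least[OF g \<zeta>(1) True] E \<zeta>(2) by simp
  next
    case False
    have i: "1 / \<zeta> \<noteq> 0" "z = (1 / \<zeta> + 1 / (1 / \<zeta>)) / 2" using \<zeta> by (auto simp: add.commute)
    have "zeta_ratio (1 / \<zeta>) \<le> zeta_ratio (1 / (1 / \<zeta>)) * (norm (1 / \<zeta>))\<^sup>2"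
      using False \<zeta> by (simp add: norm_divide power_divide field_simps)
    then show ?thesis using that[OF i] first_sheet_least[OF g i(1)] E i(2) by simp
  qed
qed

abbreviation zeta_num :: "complex \<Rightarrow> complex" where
  "zeta_num s \<equiv> \<alpha> * s\<^sup>2 - \<beta>"

definition zeta_of :: "complex \<Rightarrow> complex" where
  "zeta_of s = zeta_num s / (s\<^sup>2 - 1)"

text \<open>
  The point over \<open>1 / \<zeta>\<close> has \<open>s'\<^sup>2 = pp s / qq s\<close>: inverting \<open>\<zeta>\<close> acts on \<open>s\<^sup>2\<close> as a Moebius
  transformation, which is an involution. Numerator and denominator are kept apart because \<open>s'\<close> may be
  infinite.
\<close>

definition pp :: "complex \<Rightarrow> complex" where
  "pp s = (1 - \<alpha> * \<beta>) * s\<^sup>2 - (1 - \<beta>\<^sup>2)"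

definition qq :: "complex \<Rightarrow> complex" where
  "qq s = (1 - \<alpha>\<^sup>2) * s\<^sup>2 - (1 - \<alpha> * \<beta>)"

definition znum :: "complex \<Rightarrow> complex" where
  "znum s = (zeta_num s)\<^sup>2 + (s\<^sup>2 - 1)\<^sup>2"

definition zden :: "complex \<Rightarrow> complex" where
  "zden s = 2 * zeta_num s * (s\<^sup>2 - 1)"

definition z_of :: "complex \<Rightarrow> complex" where
  "z_of s = znum s / zden s"

abbreviation sheet_bound :: "complex \<Rightarrow> real" where
  "sheet_bound s \<equiv> copy_ratio (pp s) (qq s) * (norm (zeta_num s))\<^sup>2"

text \<open>
  The first sheet without reference to the Green function: \<open>|w|\<close> is smaller at \<open>s\<close> than at the points
  over \<open>1 / \<zeta>\<close>, after clearing denominators, and \<open>Re s > 0\<close> makes it smaller than at \<open>- s\<close>. In this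
  form the set is visibly open and contains the point \<open>s = 1\<close> over infinity.
\<close>

definition sheet1 :: "complex set" where
  "sheet1 = {s. 0 < Re s \<and> norm (s - 1) ^ 4 < sheet_bound s}"

lemma pp_qq_identities:
  "\<alpha> * pp s - \<beta> * qq s = (\<alpha> - \<beta>) * (s\<^sup>2 - 1)"
  "pp s - qq s = (\<alpha> - \<beta>) * zeta_num s"
  "(1 - \<alpha> * \<beta>) * pp s - (1 - \<beta>\<^sup>2) * qq s = (\<alpha> - \<beta>)\<^sup>2 * s\<^sup>2"
  "(1 - \<alpha>\<^sup>2) * pp s - (1 - \<alpha> * \<beta>) * qq s = (\<alpha> - \<beta>)\<^sup>2"
  by (simp_all add: pp_def qq_def power2_eq_square algebra_simps)

lemma surf_zeta_Some_eq: "surf_zeta A B (Some s) = (if s\<^sup>2 = 1 then None else Some (zeta_of s))"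
  unfolding surf_zeta_def zeta_of_def unfolding \<alpha>_eq \<beta>_eq by simp

lemma pp_or_qq: "pp s \<noteq> 0 \<or> qq s \<noteq> 0"
  using pp_qq_identities(4)[of s] parameters by auto

lemma zeta_of_nonzero: "s\<^sup>2 \<noteq> 1 \<Longrightarrow> \<alpha> * s\<^sup>2 \<noteq> \<beta> \<Longrightarrow> zeta_of s \<noteq> 0"
  by (simp add: zeta_of_def)

lemma finite_poles: "finite {s. s\<^sup>2 = 1 \<or> \<alpha> * s\<^sup>2 = \<beta>}"
proof -
  have "[:- 1, 0, 1:] \<noteq> (0 :: complex poly)" "[:- \<beta>, 0, \<alpha>:] \<noteq> 0" using parameters by auto
  then have "finite ({s. poly [:- 1, 0, 1:] s = 0} \<union> {s. poly [:- \<beta>, 0, \<alpha>:] s = 0})"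
    using poly_roots_finite by blast
  then show ?thesis by (rule finite_subset[rotated]) (auto simp: power2_eq_square algebra_simps)
qed

lemma z_of_zeta:
  assumes "s\<^sup>2 \<noteq> 1" "\<alpha> * s\<^sup>2 \<noteq> \<beta>"
  shows "z_of s = (zeta_of s + 1 / zeta_of s) / 2"
proof -
  have "(x\<^sup>2 + y\<^sup>2) / (2 * x * y) = (x / y + 1 / (x / y)) / 2" if "x \<noteq> 0" "y \<noteq> 0" for x y :: complex
    using that by (simp add: power2_eq_square field_simps)
  note * = this
  show ?thesis unfolding z_of_def zeta_of_def znum_def zden_def by (rule *) (use assms in auto)
qed

lemma zeta_of_minus:
  assumes "s\<^sup>2 \<noteq> 1"
  shows "zeta_of s - \<alpha> = (\<alpha> - \<beta>) / (s\<^sup>2 - 1)" "zeta_of s - \<beta> = s\<^sup>2 * ((\<alpha> - \<beta>) / (s\<^sup>2 - 1))"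
proof -
  have "s\<^sup>2 - 1 \<noteq> 0" using assms by simp
  then show "zeta_of s - \<alpha> = (\<alpha> - \<beta>) / (s\<^sup>2 - 1)" "zeta_of s - \<beta> = s\<^sup>2 * ((\<alpha> - \<beta>) / (s\<^sup>2 - 1))"
    by (simp_all add: zeta_of_def divide_simps) (simp_all add: algebra_simps)
qed

lemma zeta_ratio_at_point:
  assumes "s\<^sup>2 \<noteq> 1" "0 \<le> Re s"
  shows "zeta_ratio (zeta_of s) = (norm (s - 1))\<^sup>2 / (norm (s + 1))\<^sup>2"
proof (rule copy_ratio_eq)
  show "zeta_of s - \<beta> = s\<^sup>2 * (zeta_of s - \<alpha>)" using zeta_of_minus[OF assms(1)] by simp
  show "zeta_of s - \<alpha> \<noteq> 0" using zeta_of_minus(1)[OF assms(1)] assms parameters by simp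
qed (use assms in simp)

lemma zeta_ratio_at_partner:
  assumes "s\<^sup>2 \<noteq> 1" "\<alpha> * s\<^sup>2 \<noteq> \<beta>"
  shows "zeta_ratio (1 / zeta_of s) = copy_ratio (pp s) (qq s)"
proof -
  have "zeta_num s * (1 / zeta_of s - \<beta>) = pp s" "zeta_num s * (1 / zeta_of s - \<alpha>) = qq s"
  proof -
    have x: "zeta_num s \<noteq> 0" using assms by simp
    have *: "zeta_num s * (1 / zeta_of s - c) = (s\<^sup>2 - 1) - zeta_num s * c" for c
      unfolding right_diff_distrib[of "zeta_num s"] zeta_of_def using x by simp
    show "zeta_num s * (1 / zeta_of s - \<beta>) = pp s" "zeta_num s * (1 / zeta_of s - \<alpha>) = qq s"
      unfolding * by (simp_all add: pp_def qq_def power2_eq_square algebra_simps)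
  qed
  then show ?thesis using copy_ratio_scale[of "zeta_num s" "1 / zeta_of s - \<beta>" "1 / zeta_of s - \<alpha>"] assms
    by simp
qed

text \<open>
  Both sides of the first inequality are multiplied by \<open>|s - 1|\<^sup>2 |s + 1|\<^sup>2\<close>.
\<close>

lemma sheet1_condition:
  assumes "s\<^sup>2 \<noteq> 1" "\<alpha> * s\<^sup>2 \<noteq> \<beta>" "0 \<le> Re s"
  shows "zeta_ratio (zeta_of s) \<le> zeta_ratio (1 / zeta_of s) * (norm (zeta_of s))\<^sup>2 \<longleftrightarrow>
      norm (s - 1) ^ 4 \<le> sheet_bound s"
    and "zeta_ratio (zeta_of s) < zeta_ratio (1 / zeta_of s) * (norm (zeta_of s))\<^sup>2 \<longleftrightarrow>
      norm (s - 1) ^ 4 < sheet_bound s"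
proof -
  have ne: "s - 1 \<noteq> 0" "s + 1 \<noteq> 0" using assms(1) by (auto simp: eq_neg_iff_add_eq_0[symmetric])
  have f: "s\<^sup>2 - 1 = (s - 1) * (s + 1)" by (simp add: power2_eq_square algebra_simps)
  define c where "c = (norm (s - 1))\<^sup>2 * (norm (s + 1))\<^sup>2"
  have c: "0 < c" using ne by (simp add: c_def)
  have 1: "c * zeta_ratio (zeta_of s) = norm (s - 1) ^ 4"
    unfolding zeta_ratio_at_point[OF assms(1,3)] c_def using ne by (simp add: power2_eq_square power4_eq_xxxx)
  have 2: "c * (zeta_ratio (1 / zeta_of s) * (norm (zeta_of s))\<^sup>2) = sheet_bound s"
  proof -
    have "(norm (zeta_of s))\<^sup>2 = (norm (zeta_num s))\<^sup>2 / c"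
      unfolding zeta_of_def f c_def by (simp add: norm_divide norm_mult power_divide power_mult_distrib)
    then show ?thesis using c unfolding zeta_ratio_at_partner[OF assms(1,2)] by simp
  qed
  show "zeta_ratio (zeta_of s) \<le> zeta_ratio (1 / zeta_of s) * (norm (zeta_of s))\<^sup>2 \<longleftrightarrow>
      norm (s - 1) ^ 4 \<le> sheet_bound s"
    unfolding 1[symmetric] 2[symmetric] using c by simp
  show "zeta_ratio (zeta_of s) < zeta_ratio (1 / zeta_of s) * (norm (zeta_of s))\<^sup>2 \<longleftrightarrow>
      norm (s - 1) ^ 4 < sheet_bound s"
    unfolding 1[symmetric] 2[symmetric] using c by simp
qed

lemma sheet1_point_exists:
  assumes g: "green_function_at_infinity (zeta_cut A B) g" and E: "Some z \<notin> first_boundary A B g"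
  obtains s where "s \<in> sheet1" "s\<^sup>2 \<noteq> 1" "\<alpha> * s\<^sup>2 \<noteq> \<beta>" "z_of s = z"
    "sheet_point A B g (Some z) 1 = Some s"
proof -
  obtain \<zeta> where \<zeta>: "\<zeta> \<noteq> 0" "z = (\<zeta> + 1 / \<zeta>) / 2" "zeta_ratio \<zeta> < zeta_ratio (1 / \<zeta>) * (norm \<zeta>)\<^sup>2"
    "zeta_ratio \<zeta> < 1" "sheet_point A B g (Some z) 1 = surf_lift A B (Some \<zeta>)"
    using first_sheet_exists[OF g E] by blast
  have za: "\<zeta> \<noteq> \<alpha>" using \<zeta>(4) copy_ratio_zero_right[of "\<zeta> - \<beta>"] parameters by auto
  define s where "s = csqrt ((\<zeta> - \<beta>) / (\<zeta> - \<alpha>))"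
  have lift: "surf_lift A B (Some \<zeta>) = Some s"
    using za by (simp add: surf_lift_def s_def \<alpha>_eq \<beta>_eq)
  have "surf_zeta A B (Some s) = Some \<zeta>"
    using surf_zeta_lift(1)[OF AB(1) parameters(1,2), of "Some \<zeta>"] lift by simp
  then have s1: "s\<^sup>2 \<noteq> 1" and ze: "\<zeta> = zeta_of s"
    by (auto simp: surf_zeta_Some_eq split: if_splits)
  have sb: "\<alpha> * s\<^sup>2 \<noteq> \<beta>" using \<zeta>(1) by (auto simp: ze zeta_of_def)
  have Re0: "0 \<le> Re s" unfolding s_def by (rule Re_csqrt)
  have "Re s \<noteq> 0"
  proof
    assume "Re s = 0"
    then have "(norm (s - 1))\<^sup>2 = (norm (s + 1))\<^sup>2" unfolding norm_add_one_sq by simp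
    moreover have "s + 1 \<noteq> 0" using s1 by (auto simp: eq_neg_iff_add_eq_0[symmetric])
    ultimately show False using \<zeta>(4) zeta_ratio_at_point[OF s1 Re0] by (simp add: ze)
  qed
  then have "s \<in> sheet1"
    using Re0 sheet1_condition(2)[OF s1 sb Re0] \<zeta>(3) by (simp add: sheet1_def ze)
  moreover have "z_of s = z" using z_of_zeta[OF s1 sb] \<zeta>(2) unfolding ze by (simp only:)
  ultimately show ?thesis using \<zeta>(5) lift by (intro that[of s] s1 sb) simp_all
qed

text \<open>
  On the boundary of the first sheet two of the values of \<open>u\<close> agree and no other value is smaller, so
  its projection belongs to \<open>E\<close>.
\<close>

lemma boundary_of_sheet1:
  assumes g: "green_function_at_infinity (zeta_cut A B) g"
    and s: "s\<^sup>2 \<noteq> 1" "\<alpha> * s\<^sup>2 \<noteq> \<beta>" "0 \<le> Re s"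
      "norm (s - 1) ^ 4 \<le> sheet_bound s"
    and E: "Some (z_of s) \<notin> first_boundary A B g"
  shows "s \<in> sheet1"
proof -
  have z0: "zeta_of s \<noteq> 0" by (rule zeta_of_nonzero[OF s(1,2)])
  have le: "zeta_ratio (zeta_of s) \<le> zeta_ratio (1 / zeta_of s) * (norm (zeta_of s))\<^sup>2"
    using sheet1_condition(1)[OF s(1-3)] s(4) by blast
  note ls = first_sheet_least[OF g z0 le E[unfolded z_of_zeta[OF s(1,2)]]]
  have "Re s \<noteq> 0"
  proof
    assume "Re s = 0"
    then have "(norm (s - 1))\<^sup>2 = (norm (s + 1))\<^sup>2" unfolding norm_add_one_sq by simp
    moreover have "s + 1 \<noteq> 0" using s(1) by (auto simp: eq_neg_iff_add_eq_0[symmetric])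
    ultimately show False using ls(2) zeta_ratio_at_point[OF s(1,3)] by simp
  qed
  then show ?thesis using s(3) ls(1) sheet1_condition(2)[OF s(1-3)] by (simp add: sheet1_def)
qed

lemma continuous_on_partner_ratio: "continuous_on S (\<lambda>s. copy_ratio (pp s) (qq s))"
  using pp_or_qq by (intro continuous_on_copy_ratio) (auto simp: pp_def qq_def intro!: continuous_intros)

lemma open_sheet1: "open sheet1"
proof -
  have "open {s. 0 < Re s}" by (rule open_halfspace_Re_gt)
  moreover have "open {s. norm (s - 1) ^ 4 < sheet_bound s}"
    by (intro open_Collect_less continuous_intros continuous_on_partner_ratio)
  ultimately have "open ({s. 0 < Re s} \<inter> {s. norm (s - 1) ^ 4 < sheet_bound s})"
    by (rule open_Int)
  then show ?thesis by (simp add: sheet1_def Collect_conj_eq)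
qed

lemma closure_sheet1:
  assumes "s \<in> closure sheet1"
  shows "0 \<le> Re s" "norm (s - 1) ^ 4 \<le> sheet_bound s"
proof -
  let ?C = "{s. 0 \<le> Re s} \<inter> {s. norm (s - 1) ^ 4 \<le> sheet_bound s}"
  have "closed {s. 0 \<le> Re s}" by (rule closed_halfspace_Re_ge)
  moreover have "closed {s. norm (s - 1) ^ 4 \<le> sheet_bound s}"
    by (intro closed_Collect_le continuous_intros continuous_on_partner_ratio)
  ultimately have "closed ?C" by (rule closed_Int)
  moreover have "sheet1 \<subseteq> ?C" by (auto simp: sheet1_def)
  ultimately have "closure sheet1 \<subseteq> ?C" by (rule closure_minimal[rotated])
  then show "0 \<le> Re s" "norm (s - 1) ^ 4 \<le> sheet_bound s"
    using assms by auto
qed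

lemma one_in_sheet1: "1 \<in> sheet1"
proof -
  have "pp 1 - qq 1 = (\<alpha> - \<beta>)\<^sup>2" unfolding pp_qq_identities(2) by (simp add: power2_eq_square)
  then have "pp 1 \<noteq> qq 1" using parameters by auto
  then have "0 < copy_ratio (pp 1) (qq 1)" using copy_ratio_bounds(3)[OF pp_or_qq] by blast
  then show ?thesis using parameters by (simp add: sheet1_def)
qed

lemma sheet1_nonzero:
  assumes "s \<in> sheet1"
  shows "s \<noteq> 0" "s + 1 \<noteq> 0" "\<alpha> * s\<^sup>2 \<noteq> \<beta>" "s \<noteq> 1 \<Longrightarrow> s\<^sup>2 \<noteq> 1"
proof -
  have R: "0 < Re s" using assms by (simp add: sheet1_def)
  then show "s \<noteq> 0" by auto
  have "Re (s + 1) \<noteq> 0" using R by simp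
  then show s1: "s + 1 \<noteq> 0" by (metis zero_complex.sel(1))
  show "\<alpha> * s\<^sup>2 \<noteq> \<beta>"
  proof
    assume "\<alpha> * s\<^sup>2 = \<beta>"
    then have "norm (s - 1) ^ 4 < 0" using assms by (simp add: sheet1_def)
    then show False by (simp add: not_less[symmetric])
  qed
  show "s\<^sup>2 \<noteq> 1" if "s \<noteq> 1" using that s1 by (auto simp: power2_eq_1_iff)
qed

text \<open>
  The point \<open>s = \<infinity>\<close> lies over \<open>\<zeta> = \<alpha>\<close>. There the bound grows like \<open>|\<alpha>|\<^sup>2 |s|\<^sup>4\<close>, which is smaller
  than \<open>|s - 1|\<^sup>4\<close> since \<open>|\<alpha>| < 1\<close>.
\<close>

lemma bounded_sheet1: "bounded sheet1"
proof -
  define a where "a = norm \<alpha>"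
  have a: "a < 1" using parameters by (simp add: a_def)
  have b1: "norm \<beta> < 1" using parameters by simp
  have "norm s \<le> 2 / (1 - a)" if "s \<in> sheet1" for s
  proof -
    have "norm (s - 1) ^ 4 < sheet_bound s"
      using that by (simp add: sheet1_def)
    also have "\<dots> \<le> 1 * (norm (zeta_num s))\<^sup>2"
      using copy_ratio_bounds[OF pp_or_qq] by (intro mult_right_mono) auto
    finally have "((norm (s - 1))\<^sup>2)\<^sup>2 < (norm (zeta_num s))\<^sup>2" by (simp add: power_mult[symmetric])
    then have "(norm (s - 1))\<^sup>2 < norm (zeta_num s)" by (rule power2_less_imp_less) simp
    also have "\<dots> \<le> norm (\<alpha> * s\<^sup>2) + norm \<beta>" by (rule norm_triangle_ineq4)
    also have "\<dots> \<le> a * (norm s)\<^sup>2 + 1" using b1 by (simp add: a_def norm_mult norm_power)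
    finally have 1: "(norm (s - 1))\<^sup>2 < a * (norm s)\<^sup>2 + 1" .
    have "Re s \<le> norm s" by (rule complex_Re_le_cmod)
    then have "(norm s)\<^sup>2 * (1 - a) < 2 * norm s"
      using 1 unfolding norm_add_one_sq by (simp add: algebra_simps)
    then have "norm s * (norm s * (1 - a) - 2) < 0" by (simp add: power2_eq_square algebra_simps)
    then have "norm s * (1 - a) < 2" by (simp add: mult_less_0_iff)
    then show ?thesis using a by (simp add: field_simps)
  qed
  then show ?thesis unfolding bounded_iff by blast
qed

end

section \<open>Removable singularities and growth\<close>

lemma eventually_notin_finite: "finite X \<Longrightarrow> \<forall>\<^sub>F z in at (a::complex). z \<notin> X"
  using islimpt_finite islimpt_iff_eventually by blast

lemma removable_finite:
  fixes f :: "complex \<Rightarrow> complex"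
  assumes "finite X" "f holomorphic_on - X" "\<And>x. x \<in> X \<Longrightarrow> f \<in> O[at x](\<lambda>_. 1)"
  shows "\<exists>g. g holomorphic_on UNIV \<and> (\<forall>z\<in>-X. g z = f z)"
  using assms
proof (induction X arbitrary: f rule: finite_induct)
  case empty
  then show ?case by auto
next
  case (insert x X)
  have o: "open (- X)" using insert.hyps by (simp add: finite_imp_closed open_Compl)
  have "\<exists>B. \<forall>\<^sub>F z in at x. norm (f z) \<le> B"
    using insert.prems(2)[OF insertI1] by (auto simp: bigo_def)
  moreover have h: "f holomorphic_on - X - {x}"
    using insert.prems(1) by (rule holomorphic_on_subset) auto
  moreover have xi: "x \<in> interior (- X)" using insert.hyps o by (simp add: interior_open)
  ultimately obtain f' where f': "f' holomorphic_on - X" "\<And>z. z \<in> - X - {x} \<Longrightarrow> f' z = f z"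
    using holomorphic_on_extend_bounded[OF h xi] by blast
  have "f' \<in> O[at y](\<lambda>_. 1)" if y: "y \<in> X" for y
  proof -
    have "\<forall>\<^sub>F z in at y. f z = f' z"
      using eventually_notin_finite[of "insert x X" y] insert.hyps
      by (auto elim!: eventually_mono simp: f'(2))
    then show ?thesis using insert.prems(2)[OF insertI2[OF y]] by (subst (asm) landau_o.big.in_cong) auto
  qed
  then obtain g where "g holomorphic_on UNIV" "\<forall>z\<in>-X. g z = f' z"
    using insert.IH[OF f'(1)] by blast
  then show ?case using f'(2) by (intro exI[of _ g]) auto
qed

lemma tendsto_imp_bigo_1:
  fixes f :: "complex \<Rightarrow> complex"
  shows "(f \<longlongrightarrow> c) F \<Longrightarrow> f \<in> O[F](\<lambda>_. 1)"
  by (rule bigoI_tendsto[of _ _ c]) auto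

lemma isCont_imp_bigo_1: "isCont f a \<Longrightarrow> f \<in> O[at a](\<lambda>_. 1 :: complex)" for f :: "complex \<Rightarrow> complex"
  unfolding isCont_def by (rule tendsto_imp_bigo_1)

lemma power_bigo_at_infinity: "i \<le> d \<Longrightarrow> (\<lambda>z::complex. z ^ i) \<in> O[at_infinity](\<lambda>z. z ^ d)"
  by (rule landau_o.big_mono) (auto simp: eventually_at_infinity norm_power intro!: exI[of _ 1] power_increasing)

lemma poly_bigo_at_infinity:
  assumes "degree p \<le> d"
  shows "poly p \<in> O[at_infinity](\<lambda>z::complex. z ^ d)"
proof -
  have "(\<lambda>z. \<Sum>i\<le>degree p. coeff p i * z ^ i) \<in> O[at_infinity](\<lambda>z. z ^ d)"
  proof (intro big_sum_in_bigo)
    fix i assume "i \<in> {..degree p}"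
    then have "(\<lambda>z::complex. z ^ i) \<in> O[at_infinity](\<lambda>z. z ^ d)"
      using assms by (intro power_bigo_at_infinity) auto
    then show "(\<lambda>z. coeff p i * z ^ i) \<in> O[at_infinity](\<lambda>z. z ^ d)"
      by (cases "coeff p i = 0") auto
  qed
  then show ?thesis by (simp add: poly_altdef[abs_def])
qed

text \<open>
  Liouville's theorem, with the Taylor coefficients collected in a polynomial.
\<close>

lemma polynomial_growth_imp_poly:
  assumes g: "g holomorphic_on UNIV" "g \<in> O[at_infinity](\<lambda>z. z ^ d)"
  obtains T where "degree T \<le> d" "\<And>z. poly T z = g z"
proof -
  obtain c where "\<forall>\<^sub>F z in at_infinity. norm (g z) \<le> c * norm (z ^ d)"
    using landau_o.bigE[OF g(2)] by blast
  then obtain b where b: "\<And>z. b \<le> norm z \<Longrightarrow> norm (g z) \<le> c * norm z ^ d"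
    unfolding eventually_at_infinity by (auto simp: norm_power)
  define T where "T = (\<Sum>k\<le>d. monom ((deriv ^^ k) g 0 / fact k) k)"
  show ?thesis
  proof (rule that[of T])
    show "degree T \<le> d" unfolding T_def
      by (intro degree_sum_le) (auto intro: order_trans[OF degree_monom_le])
    show "poly T z = g z" for z
      using Liouville_polynomial[OF g(1) b, where \<xi> = z] by (simp add: T_def poly_sum poly_monom)
  qed
qed

section \<open>The dual function\<close>

text \<open>
  The constant \<open>\<kappa>\<close> is determined by its square up to the sign, and the sign selects the branch: on the surface
  the function is \<open>\<kappa> (\<alpha> s\<^sup>2 - \<beta>) / s\<close>, which is \<open>F_of\<close> below.
\<close>

locale cut_surface_function = cut_surface +
  fixes \<kappa> :: complex
  assumes \<kappa>: "\<kappa>\<^sup>2 * (\<alpha> - \<beta>)\<^sup>2 = \<alpha> * \<beta>"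
begin

text \<open>
  \<open>w\<close> is \<open>((s - 1) / (s + 1))\<^sup>2 / \<zeta>\<close>, so that \<open>log |w|\<close> is the function \<open>u\<close> of the Nuttall partition.
\<close>

definition w_of :: "complex \<Rightarrow> complex" where
  "w_of s = 2 * (s - 1) ^ 4 / zden s"

definition F_of :: "complex \<Rightarrow> complex" where
  "F_of s = \<kappa> * zeta_num s / s"

text \<open>
  Up to a factor, the difference of the squares of \<open>F\<close> at \<open>s\<close> and at the points over \<open>1 / \<zeta>\<close>; it
  vanishes where the four values of \<open>F\<close> are not distinct.
\<close>

definition disc :: "complex \<Rightarrow> complex" where
  "disc s = (zeta_num s)\<^sup>2 * (pp s * qq s) - (\<alpha> - \<beta>)\<^sup>2 * s\<^sup>2 * (s\<^sup>2 - 1)\<^sup>2"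

text \<open>
  Let \<open>c\<close> be the value of \<open>F\<close> at \<open>s\<close> and \<open>e\<close> the square of its value over \<open>1 / \<zeta>\<close>. The Lagrange
  polynomial at \<open>c\<close> for the nodes \<open>c, -c\<close> and the square roots of \<open>e\<close> is
  \<open>(x + c) (x\<^sup>2 - e) / (2 c (c\<^sup>2 - e))\<close>. Replacing \<open>x\<^sup>i\<close> by \<open>v i\<close> in it gives the interpolating function
  \<open>Y\<close> of the introduction. Here \<open>dual_num\<close> is its numerator times \<open>s pp qq\<close>, and \<open>dual_comp\<close> is
  \<open>2 \<kappa>\<^sup>3 disc Y\<close>.
\<close>

definition dual_num :: "(nat \<Rightarrow> complex) \<Rightarrow> complex \<Rightarrow> complex" where
  "dual_num v s = (s * v 3 + \<kappa> * zeta_num s * v 2) * (pp s * qq s)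
     - \<alpha> * \<beta> * (s\<^sup>2 - 1)\<^sup>2 * (s * v 1 + \<kappa> * zeta_num s * v 0)"

definition dual_comp :: "(nat \<Rightarrow> complex) \<Rightarrow> complex \<Rightarrow> complex" where
  "dual_comp v s = dual_num v s * (s\<^sup>2 / zeta_num s)"

lemma \<kappa>_nonzero: "\<kappa> \<noteq> 0" using \<kappa> parameters by auto

lemma even_functions [simp]:
  "pp (- s) = pp s" "qq (- s) = qq s" "znum (- s) = znum s" "zden (- s) = zden s"
  "z_of (- s) = z_of s" "disc (- s) = disc s"
  by (simp_all add: pp_def qq_def znum_def zden_def z_of_def disc_def)

text \<open>
  All of these say how the basic functions transform under the involution \<open>\<zeta> \<mapsto> 1 / \<zeta>\<close>.
\<close>

lemma partner:
  assumes "s'\<^sup>2 * qq s = pp s" "qq s \<noteq> 0"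
  shows "\<alpha> * s'\<^sup>2 - \<beta> = (\<alpha> - \<beta>) * (s\<^sup>2 - 1) / qq s" (is ?a)
    and "s'\<^sup>2 - 1 = (\<alpha> - \<beta>) * zeta_num s / qq s" (is ?b)
    and "pp s' = (\<alpha> - \<beta>)\<^sup>2 * s\<^sup>2 / qq s" (is ?c)
    and "qq s' = (\<alpha> - \<beta>)\<^sup>2 / qq s" (is ?d)
    and "zden s' = ((\<alpha> - \<beta>) / qq s)\<^sup>2 * zden s" (is ?e)
    and "znum s' = ((\<alpha> - \<beta>) / qq s)\<^sup>2 * znum s" (is ?f)
    and "z_of s' = z_of s" (is ?g)
    and "disc s' = - (((\<alpha> - \<beta>) / qq s) ^ 4 * disc s)" (is ?h)
proof -
  have t: "s'\<^sup>2 = pp s / qq s" using assms by (simp add: eq_divide_eq)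
  have lin: "a * s'\<^sup>2 - b = (a * pp s - b * qq s) / qq s" for a b
    unfolding t using assms(2) by (simp add: diff_divide_distrib)
  show a: ?a unfolding lin pp_qq_identities ..
  show b: ?b using lin[of 1 1] pp_qq_identities(2)[of s] by simp
  show c: ?c unfolding pp_def[of s'] lin pp_qq_identities ..
  show d: ?d unfolding qq_def[of s'] lin pp_qq_identities ..
  show e: ?e unfolding zden_def[of s'] a b by (simp add: zden_def power2_eq_square)
  have "(d * y / q)\<^sup>2 + (d * x / q)\<^sup>2 = (d / q)\<^sup>2 * (x\<^sup>2 + y\<^sup>2)" for d x y q :: complex
    by (simp add: power_divide power_mult_distrib add_divide_distrib distrib_left add.commute)
  then show f: ?f unfolding znum_def a b .
  show ?g using parameters assms(2) unfolding z_of_def e f by simp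
  have "(d * y / q)\<^sup>2 * (d\<^sup>2 * u / q * (d\<^sup>2 / q)) - d\<^sup>2 * (p / q) * (d * x / q)\<^sup>2
      = - ((d / q) ^ 4 * (x\<^sup>2 * (p * q) - d\<^sup>2 * u * y\<^sup>2))" if "q \<noteq> 0" for d x y u p q :: complex
    using that by (simp add: power_divide power_mult_distrib divide_simps)
      (simp add: algebra_simps power2_eq_square power4_eq_xxxx)
  from this[OF assms(2)] show ?h unfolding disc_def a b c d unfolding t .
qed

text \<open>
  In the sum over \<open>s\<close> and \<open>- s\<close> the odd part cancels; what remains is linear in two of the four
  polynomials, and adding the contribution of \<open>\<plusminus> s'\<close> eliminates one of them.
\<close>

lemma pair_recovery:
  assumes "s'\<^sup>2 * qq s = pp s" "qq s \<noteq> 0" "disc s \<noteq> 0"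
  shows "s\<^sup>2 * (U * (pp s * qq s) - \<alpha> * \<beta> * (s\<^sup>2 - 1)\<^sup>2 * V) / disc s
       + s'\<^sup>2 * (U * (pp s' * qq s') - \<alpha> * \<beta> * (s'\<^sup>2 - 1)\<^sup>2 * V) / disc s' = \<kappa>\<^sup>2 * V"
proof -
  define d t p q x y D where "d = \<alpha> - \<beta>" and "t = s\<^sup>2" and "p = pp s" and "q = qq s"
    and "x = zeta_num s" and "y = s\<^sup>2 - 1" and "D = disc s"
  have ne: "d \<noteq> 0" "q \<noteq> 0" "D \<noteq> 0" using parameters assms by (auto simp: d_def q_def D_def)
  have t': "s'\<^sup>2 = p / q" using assms by (simp add: p_def q_def eq_divide_eq)
  have \<gamma>: "\<alpha> * \<beta> = \<kappa>\<^sup>2 * d\<^sup>2" using \<kappa> by (simp add: d_def)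
  have D: "D = x\<^sup>2 * (p * q) - d\<^sup>2 * t * y\<^sup>2"
    by (simp add: D_def disc_def x_def p_def q_def d_def t_def y_def)
  have "s'\<^sup>2 * (U * (pp s' * qq s') - \<alpha> * \<beta> * (s'\<^sup>2 - 1)\<^sup>2 * V) / disc s'
      = p / q * (U * (d\<^sup>2 * t / q * (d\<^sup>2 / q)) - \<kappa>\<^sup>2 * d\<^sup>2 * (d * x / q)\<^sup>2 * V) / (- ((d / q) ^ 4 * D))"
    unfolding partner(2,3,4,8)[OF assms(1,2)] unfolding t' \<gamma>
    by (simp add: d_def t_def q_def x_def D_def)
  also have "\<dots> = - (p * q * (U * t - \<kappa>\<^sup>2 * x\<^sup>2 * V)) / D"
    using ne by (simp add: field_simps power2_eq_square power4_eq_xxxx)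
  finally have 2: "s'\<^sup>2 * (U * (pp s' * qq s') - \<alpha> * \<beta> * (s'\<^sup>2 - 1)\<^sup>2 * V) / disc s'
      = - (p * q * (U * t - \<kappa>\<^sup>2 * x\<^sup>2 * V)) / D" .
  have 1: "s\<^sup>2 * (U * (pp s * qq s) - \<alpha> * \<beta> * (s\<^sup>2 - 1)\<^sup>2 * V) / disc s
      = t * (U * (p * q) - \<kappa>\<^sup>2 * d\<^sup>2 * y\<^sup>2 * V) / D"
    unfolding \<gamma> by (simp add: t_def p_def q_def y_def D_def)
  have "t * (U * (p * q) - \<kappa>\<^sup>2 * d\<^sup>2 * y\<^sup>2 * V) + - (p * q * (U * t - \<kappa>\<^sup>2 * x\<^sup>2 * V)) = \<kappa>\<^sup>2 * V * D"
    unfolding D by (simp add: algebra_simps)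
  then show ?thesis unfolding 1 2 add_divide_distrib[symmetric] using ne by simp
qed

lemma dual_comp_pair:
  assumes "\<alpha> * s\<^sup>2 \<noteq> \<beta>"
  shows "dual_comp v s + dual_comp v (- s)
      = 2 * \<kappa> * (s\<^sup>2 * (v 2 * (pp s * qq s) - \<alpha> * \<beta> * (s\<^sup>2 - 1)\<^sup>2 * v 0))"
    and "s \<noteq> 0 \<Longrightarrow> F_of s * dual_comp v s + F_of (- s) * dual_comp v (- s)
      = 2 * \<kappa> * (s\<^sup>2 * (v 3 * (pp s * qq s) - \<alpha> * \<beta> * (s\<^sup>2 - 1)\<^sup>2 * v 1))"
proof -
  define x where "x = zeta_num s"
  have x: "x \<noteq> 0" using assms by (simp add: x_def)
  have n: "dual_num v (- s) = dual_num v s - 2 * s * (v 3 * (pp s * qq s) - \<alpha> * \<beta> * (s\<^sup>2 - 1)\<^sup>2 * v 1)"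
    "dual_num v s + dual_num v (- s) = x * (2 * \<kappa> * (v 2 * (pp s * qq s) - \<alpha> * \<beta> * (s\<^sup>2 - 1)\<^sup>2 * v 0))"
    by (simp_all add: dual_num_def x_def algebra_simps)
  have "dual_comp v s + dual_comp v (- s) = (dual_num v s + dual_num v (- s)) * (s\<^sup>2 / x)"
    unfolding distrib_right by (simp add: dual_comp_def x_def)
  then show "dual_comp v s + dual_comp v (- s)
      = 2 * \<kappa> * (s\<^sup>2 * (v 2 * (pp s * qq s) - \<alpha> * \<beta> * (s\<^sup>2 - 1)\<^sup>2 * v 0))"
    unfolding n(2) using x by simp
  assume s: "s \<noteq> 0"
  have "F_of s * dual_comp v s + F_of (- s) * dual_comp v (- s)
      = (\<kappa> * x / s) * ((dual_num v s - dual_num v (- s)) * (s\<^sup>2 / x))"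
    unfolding left_diff_distrib right_diff_distrib by (simp add: F_of_def dual_comp_def x_def)
  also have "\<dots> = 2 * \<kappa> * (s\<^sup>2 * (v 3 * (pp s * qq s) - \<alpha> * \<beta> * (s\<^sup>2 - 1)\<^sup>2 * v 1))"
    unfolding n(1) using x s by (simp add: power2_eq_square)
  finally show "F_of s * dual_comp v s + F_of (- s) * dual_comp v (- s)
      = 2 * \<kappa> * (s\<^sup>2 * (v 3 * (pp s * qq s) - \<alpha> * \<beta> * (s\<^sup>2 - 1)\<^sup>2 * v 1))" .
qed

definition generic :: "complex \<Rightarrow> bool" where
  "generic s \<longleftrightarrow> s \<noteq> 0 \<and> s\<^sup>2 \<noteq> 1 \<and> \<alpha> * s\<^sup>2 \<noteq> \<beta> \<and> pp s \<noteq> 0 \<and> qq s \<noteq> 0 \<and> disc s \<noteq> 0"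

text \<open>
  Lagrange interpolation reproduces the monomials 1 (for \<open>j = 0\<close>) and \<open>x\<close> (for \<open>j = 1\<close>).
\<close>

lemma recovery:
  assumes s: "generic s" and s': "s'\<^sup>2 * qq s = pp s" and j: "j < 2"
  shows "F_of s ^ j * dual_comp v s / disc s + F_of (- s) ^ j * dual_comp v (- s) / disc s
       + (F_of s' ^ j * dual_comp v s' / disc s' + F_of (- s') ^ j * dual_comp v (- s') / disc s')
       = 2 * \<kappa> ^ 3 * v j"
proof -
  have q: "qq s \<noteq> 0" and d: "disc s \<noteq> 0" and b: "\<alpha> * s\<^sup>2 \<noteq> \<beta>" and s0: "s \<noteq> 0"
    using s by (auto simp: generic_def)
  have b': "\<alpha> * s'\<^sup>2 \<noteq> \<beta>"
    using partner(1)[OF s' q] s parameters by (auto simp: generic_def)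
  have s0': "s' \<noteq> 0" using s' s by (auto simp: generic_def)
  have "F_of s ^ j * dual_comp v s + F_of (- s) ^ j * dual_comp v (- s)
      = 2 * \<kappa> * (s\<^sup>2 * (v (j + 2) * (pp s * qq s) - \<alpha> * \<beta> * (s\<^sup>2 - 1)\<^sup>2 * v j))"
    "F_of s' ^ j * dual_comp v s' + F_of (- s') ^ j * dual_comp v (- s')
      = 2 * \<kappa> * (s'\<^sup>2 * (v (j + 2) * (pp s' * qq s') - \<alpha> * \<beta> * (s'\<^sup>2 - 1)\<^sup>2 * v j))"
    using dual_comp_pair[OF b, of v] dual_comp_pair[OF b', of v] s0 s0' j
    by (cases "j = 0"; simp add: numeral_3_eq_3 numeral_2_eq_2; fail | cases "j = 1"; simp add: eval_nat_numeral)+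
  then have "F_of s ^ j * dual_comp v s / disc s + F_of (- s) ^ j * dual_comp v (- s) / disc s
       + (F_of s' ^ j * dual_comp v s' / disc s' + F_of (- s') ^ j * dual_comp v (- s') / disc s')
      = 2 * \<kappa> * (s\<^sup>2 * (v (j + 2) * (pp s * qq s) - \<alpha> * \<beta> * (s\<^sup>2 - 1)\<^sup>2 * v j)) / disc s
       + 2 * \<kappa> * (s'\<^sup>2 * (v (j + 2) * (pp s' * qq s') - \<alpha> * \<beta> * (s'\<^sup>2 - 1)\<^sup>2 * v j)) / disc s'"
    by (simp only: add_divide_distrib[symmetric])
  also have "\<dots> = 2 * \<kappa> * (\<kappa>\<^sup>2 * v j)"
    unfolding pair_recovery[OF s' q d, of "v (j + 2)" "v j", symmetric] by (simp add: distrib_left mult.assoc)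
  finally show ?thesis by (simp add: power3_eq_cube power2_eq_square)
qed

end

lemma bigo_power_mult:
  assumes "f \<in> O[F](\<lambda>s::complex. s ^ a)" "g \<in> O[F](\<lambda>s. s ^ b)"
  shows "(\<lambda>s. f s * g s) \<in> O[F](\<lambda>s. s ^ (a + b))"
  using landau_o.big.mult[OF assms] by (simp add: power_add)

lemma one_over_at_infinity: "((\<lambda>s::complex. 1 / s) \<longlongrightarrow> 0) at_infinity"
  using tendsto_inverse_0 by (rule Lim_transform_eventually) (simp add: inverse_eq_divide)

lemma bigo_1_power: "f \<in> O[F](\<lambda>_. 1) \<Longrightarrow> (\<lambda>s. f s ^ n) \<in> O[F](\<lambda>_. 1 :: complex)"
  for f :: "complex \<Rightarrow> complex"
  by (induction n) (auto intro: landau_o.big.mult_in_1)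

context cut_surface_function
begin

lemma eventually_not_pole: "\<forall>\<^sub>F s in at s0. s\<^sup>2 \<noteq> 1 \<and> \<alpha> * s\<^sup>2 \<noteq> \<beta>"
  using eventually_notin_finite[OF finite_poles, of s0] by simp

lemma zden_eq_0_iff: "zden s = 0 \<longleftrightarrow> s\<^sup>2 = 1 \<or> \<alpha> * s\<^sup>2 = \<beta>"
  by (auto simp: zden_def)

lemma znum_nonzero:
  assumes "zden s = 0"
  shows "znum s \<noteq> 0"
proof (cases "s\<^sup>2 = 1")
  case True
  then show ?thesis using parameters by (simp add: znum_def)
next
  case False
  then show ?thesis using assms by (simp add: znum_def zden_def)
qed

lemma continuous_coefficients:
  "continuous_on UNIV pp" "continuous_on UNIV qq" "continuous_on UNIV znum" "continuous_on UNIV zden"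
  unfolding pp_def qq_def znum_def zden_def by (intro continuous_intros)+

lemma isCont_coefficients [continuous_intros, simp]: "isCont pp s" "isCont qq s" "isCont znum s" "isCont zden s"
  using continuous_coefficients by (simp_all add: continuous_on_eq_continuous_at)

lemma z_of_at_infinity:
  assumes "zden s0 = 0"
  shows "filterlim z_of at_infinity (at s0)"
  unfolding z_of_def
proof (rule filterlim_divide_at_infinity)
  show "(znum \<longlongrightarrow> znum s0) (at s0)" using isCont_coefficients(3) unfolding isCont_def .
  show "filterlim zden (at 0) (at s0)"
    unfolding filterlim_at
  proof
    show "\<forall>\<^sub>F s in at s0. zden s \<in> UNIV \<and> zden s \<noteq> 0"
      using eventually_not_pole[of s0] by eventually_elim (simp add: zden_eq_0_iff)
    show "(zden \<longlongrightarrow> 0) (at s0)" using isCont_coefficients(4)[of s0] assms unfolding isCont_def by simp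
  qed
qed (use znum_nonzero[OF assms] in simp)

lemma w_of_nonzero: "s\<^sup>2 \<noteq> 1 \<Longrightarrow> \<alpha> * s\<^sup>2 \<noteq> \<beta> \<Longrightarrow> w_of s \<noteq> 0"
  by (auto simp: w_of_def zden_def)

text \<open>
  If \<open>c\<close> is one of the other three values of \<open>F\<close>, the Lagrange polynomial vanishes at \<open>c\<close>; so
  \<open>dual_num\<close> depends only on the remainders \<open>v 0 c\<^sup>i - v i\<close>, which the approximation conditions make
  small.
\<close>

lemma dual_num_remainder:
  "dual_num v s = v 0 * ((s * c + \<kappa> * zeta_num s) * (c\<^sup>2 * (pp s * qq s) - \<alpha> * \<beta> * (s\<^sup>2 - 1)\<^sup>2))
     - ((s * (v 0 * c ^ 3 - v 3) + \<kappa> * zeta_num s * (v 0 * c ^ 2 - v 2)) * (pp s * qq s)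
        - \<alpha> * \<beta> * (s\<^sup>2 - 1)\<^sup>2 * (s * (v 0 * c ^ 1 - v 1)))"
  by (simp add: dual_num_def power2_eq_square power3_eq_cube algebra_simps)

text \<open>
  The polynomial \<open>T\<^sub>n\<close> of the introduction, as a rational expression.
\<close>

definition dual :: "nat \<Rightarrow> (nat \<Rightarrow> complex poly) \<Rightarrow> complex \<Rightarrow> complex" where
  "dual n V s = w_of s ^ n * dual_comp (\<lambda>j. poly (V j) (z_of s)) s"

text \<open>
  The degrees are at most \<open>3 n\<close>, and \<open>w z\<^sup>3\<close> is finite at \<open>s = 1\<close>.
\<close>

lemma dual_bounded_at_one:
  assumes deg: "\<And>j. j < 4 \<Longrightarrow> degree (V j) \<le> 3 * n"
  shows "dual n V \<in> O[at 1](\<lambda>_. 1)"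
proof -
  have zd: "zden 1 = 0" by (simp add: zden_def)
  define h where "h = (\<lambda>s. 2 * znum s ^ 3 / (16 * (zeta_num s) ^ 4 * (s + 1) ^ 4))"
  have h: "isCont h 1" unfolding h_def using parameters by (intro continuous_intros) auto
  have wz: "w_of s * z_of s ^ 3 = h s" if "s\<^sup>2 \<noteq> 1" "\<alpha> * s\<^sup>2 \<noteq> \<beta>" for s
  proof -
    have y: "s\<^sup>2 - 1 = (s - 1) * (s + 1)" by (simp add: power2_eq_square algebra_simps)
    have u: "s - 1 \<noteq> 0" using that(1) by auto
    have c: "2 * u ^ 4 * N / (2 * X * (u * v)) ^ 4 = 2 * N / (16 * X ^ 4 * v ^ 4)" if "u \<noteq> 0"
      for u v X N :: complex
      using that by (simp add: power_mult_distrib)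
    have "w_of s * z_of s ^ 3 = 2 * (s - 1) ^ 4 * znum s ^ 3 / zden s ^ 4"
      by (simp add: w_of_def z_of_def power_divide power4_eq_xxxx power3_eq_cube)
    then show ?thesis unfolding zden_def y h_def c[OF u] .
  qed
  have v: "(\<lambda>s. w_of s ^ n * poly (V j) (z_of s)) \<in> O[at 1](\<lambda>_. 1)" if "j < 4" for j
  proof -
    have "(\<lambda>s. poly (V j) (z_of s)) \<in> O[at 1](\<lambda>s. z_of s ^ (3 * n))"
      using landau_o.big.compose[OF poly_bigo_at_infinity[OF deg[OF that]] z_of_at_infinity[OF zd]] .
    then have "(\<lambda>s. w_of s ^ n * poly (V j) (z_of s)) \<in> O[at 1](\<lambda>s. w_of s ^ n * z_of s ^ (3 * n))"
      by (rule landau_o.big.mult[OF landau_o.big_refl])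
    also have "(\<lambda>s. w_of s ^ n * z_of s ^ (3 * n)) \<in> O[at 1](\<lambda>_. 1)"
    proof (subst landau_o.big.in_cong)
      show "\<forall>\<^sub>F s in at 1. w_of s ^ n * z_of s ^ (3 * n) = h s ^ n"
        using eventually_not_pole[of 1]
        by eventually_elim (simp add: wz[symmetric] power_mult_distrib power_mult)
      show "(\<lambda>s. h s ^ n) \<in> O[at 1](\<lambda>_. 1)" by (intro bigo_1_power isCont_imp_bigo_1 h)
    qed
    finally show ?thesis .
  qed
  have c: "(\<lambda>s. s) \<in> O[at 1](\<lambda>_. 1 :: complex)" "(\<lambda>s. \<kappa> * zeta_num s) \<in> O[at 1](\<lambda>_. 1)"
    "(\<lambda>s. pp s * qq s) \<in> O[at 1](\<lambda>_. 1)" "(\<lambda>s. \<alpha> * \<beta> * (s\<^sup>2 - 1)\<^sup>2) \<in> O[at 1](\<lambda>_. 1)"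
    "(\<lambda>s. s\<^sup>2 / zeta_num s) \<in> O[at 1](\<lambda>_. 1)"
    using parameters by (intro isCont_imp_bigo_1 continuous_intros; simp)+
  let ?v = "\<lambda>j s. w_of s ^ n * poly (V j) (z_of s)"
  have "(\<lambda>s. ((s * ?v 3 s + \<kappa> * zeta_num s * ?v 2 s) * (pp s * qq s)
     - \<alpha> * \<beta> * (s\<^sup>2 - 1)\<^sup>2 * (s * ?v 1 s + \<kappa> * zeta_num s * ?v 0 s)) * (s\<^sup>2 / zeta_num s))
     \<in> O[at 1](\<lambda>_. 1)"
    by (intro landau_o.big.mult_in_1 sum_in_bigo c v) simp_all
  also have "(\<lambda>s. ((s * ?v 3 s + \<kappa> * zeta_num s * ?v 2 s) * (pp s * qq s)
     - \<alpha> * \<beta> * (s\<^sup>2 - 1)\<^sup>2 * (s * ?v 1 s + \<kappa> * zeta_num s * ?v 0 s)) * (s\<^sup>2 / zeta_num s)) = dual n V"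
  proof
    fix s
    have "((s * (W * a) + k * (W * b)) * p - g * (s * (W * c) + k * (W * d))) * r
        = W * (((s * a + k * b) * p - g * (s * c + k * d)) * r)" for W a b c d k p g r :: complex
      by (simp add: algebra_simps)
    then show "((s * ?v 3 s + \<kappa> * zeta_num s * ?v 2 s) * (pp s * qq s)
     - \<alpha> * \<beta> * (s\<^sup>2 - 1)\<^sup>2 * (s * ?v 1 s + \<kappa> * zeta_num s * ?v 0 s)) * (s\<^sup>2 / zeta_num s) = dual n V s"
      unfolding dual_def dual_comp_def dual_num_def by blast
  qed
  finally show ?thesis .
qed

text \<open>
  Here \<open>w\<close> has the order of \<open>z\<close> and the remainders have the order of \<open>z\<^sup>-\<^sup>n\<^sup>-\<^sup>1\<close>; the additional power
  of \<open>z\<close> pays for the zero of \<open>F\<close> over \<open>\<zeta> = 0\<close>, by which \<open>dual_comp\<close> is divided. The last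
  hypothesis says that the branch of \<open>f\<close> at infinity is one of the values of \<open>F\<close> at the other three
  points.
\<close>

lemma dual_bounded_at_other_infinities:
  assumes tII: "\<And>j. j \<in> {1,2,3} \<Longrightarrow>
      (\<lambda>z. poly (V 0) z * f z ^ j - poly (V j) z) \<in> O[at_infinity](\<lambda>z. 1 / z ^ (n + 1))"
    and s0: "zden s0 = 0"
    and f: "\<forall>\<^sub>F s in at s0. (s * f (z_of s) + \<kappa> * zeta_num s) *
        ((f (z_of s))\<^sup>2 * (pp s * qq s) - \<alpha> * \<beta> * (s\<^sup>2 - 1)\<^sup>2) = 0"
  shows "dual n V \<in> O[at s0](\<lambda>_. 1)"
proof -
  have zinf: "filterlim z_of at_infinity (at s0)" by (rule z_of_at_infinity[OF s0])
  have zn0: "\<forall>\<^sub>F s in at s0. z_of s \<noteq> 0"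
    using zinf unfolding filterlim_at_infinity[OF order_refl] by (auto elim!: allE[of _ 1] eventually_mono)
  have znum: "\<forall>\<^sub>F s in at s0. znum s \<noteq> 0"
    using isCont_coefficients(3)[of s0] znum_nonzero[OF s0] unfolding isCont_def
    by (rule tendsto_imp_eventually_ne)
  define e where "e = (\<lambda>j s. (poly (V 0) (z_of s) * f (z_of s) ^ j - poly (V j) (z_of s)) * z_of s ^ (n + 1))"
  have e: "e j \<in> O[at s0](\<lambda>_. 1)" if "j \<in> {1,2,3}" for j
  proof -
    have "(\<lambda>s. poly (V 0) (z_of s) * f (z_of s) ^ j - poly (V j) (z_of s)) \<in> O[at s0](\<lambda>s. 1 / z_of s ^ (n + 1))"
      using landau_o.big.compose[OF tII[OF that] zinf] .
    then have "e j \<in> O[at s0](\<lambda>s. 1 / z_of s ^ (n + 1) * z_of s ^ (n + 1))"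
      unfolding e_def by (rule landau_o.big.mult) (rule landau_o.big_refl)
    moreover have "\<forall>\<^sub>F s in at s0. 1 / z_of s ^ (n + 1) * z_of s ^ (n + 1) = 1"
      using zn0 by eventually_elim simp
    ultimately show ?thesis by (subst (asm) landau_o.big.cong) auto
  qed
  have zs0: "znum s0 \<noteq> 0" by (rule znum_nonzero[OF s0])
  have c: "(\<lambda>s. s) \<in> O[at s0](\<lambda>_. 1 :: complex)" "(\<lambda>s. \<kappa> * zeta_num s) \<in> O[at s0](\<lambda>_. 1)"
    "(\<lambda>s. pp s * qq s) \<in> O[at s0](\<lambda>_. 1)" "(\<lambda>s. \<alpha> * \<beta> * (s\<^sup>2 - 1)\<^sup>2) \<in> O[at s0](\<lambda>_. 1)"
    "(\<lambda>s. 2 * (s - 1) ^ 4 / znum s) \<in> O[at s0](\<lambda>_. 1)" "(\<lambda>s. 2 * s\<^sup>2 * (s\<^sup>2 - 1) / znum s) \<in> O[at s0](\<lambda>_. 1)"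
    using zs0 by (intro isCont_imp_bigo_1 continuous_intros; simp)+
  have "(\<lambda>s. (2 * (s - 1) ^ 4 / znum s) ^ n * (2 * s\<^sup>2 * (s\<^sup>2 - 1) / znum s) *
      (- ((s * e 3 s + \<kappa> * zeta_num s * e 2 s) * (pp s * qq s) - \<alpha> * \<beta> * (s\<^sup>2 - 1)\<^sup>2 * (s * e 1 s))))
      \<in> O[at s0](\<lambda>_. 1)" (is "?h \<in> _")
    unfolding landau_o.big.uminus_in_iff
    by (intro landau_o.big.mult_in_1 bigo_1_power sum_in_bigo c e landau_o.big.uminus_in_iff[THEN iffD2]) simp_all
  moreover have "\<forall>\<^sub>F s in at s0. dual n V s = ?h s"
    using f znum zn0 eventually_not_pole[of s0]
  proof eventually_elim
    case (elim s)
    have z: "zden s \<noteq> 0" using elim(4) by (simp add: zden_eq_0_iff)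
    have w: "w_of s = 2 * (s - 1) ^ 4 / znum s * z_of s"
      using z elim by (simp add: w_of_def z_of_def)
    have x: "s\<^sup>2 / zeta_num s = 2 * s\<^sup>2 * (s\<^sup>2 - 1) / znum s * z_of s"
    proof -
      have "a / X = 2 * a * Y / N * (N / (2 * X * Y))" if "N \<noteq> 0" "X \<noteq> 0" "Y \<noteq> 0" for a X Y N :: complex
        using that by (simp add: field_simps)
      then show ?thesis unfolding z_of_def zden_def by this (use elim in auto)
    qed
    define g where "g = (\<lambda>j. poly (V 0) (z_of s) * f (z_of s) ^ j - poly (V j) (z_of s))"
    have num: "dual_num (\<lambda>j. poly (V j) (z_of s)) s
        = - ((s * g 3 + \<kappa> * zeta_num s * g 2) * (pp s * qq s) - \<alpha> * \<beta> * (s\<^sup>2 - 1)\<^sup>2 * (s * g 1))"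
      unfolding dual_num_remainder[of "\<lambda>j. poly (V j) (z_of s)" s "f (z_of s)"] elim(1) g_def by simp
    have "(a * z) ^ n * (- ((s * g3 + k * g2) * p - q * (s * g1)) * (b * z))
       = a ^ n * b * (- ((s * (g3 * z ^ (n + 1)) + k * (g2 * z ^ (n + 1))) * p - q * (s * (g1 * z ^ (n + 1)))))"
      for a b z g1 g2 g3 k p q :: complex
      by (simp add: power_mult_distrib algebra_simps)
    then show ?case unfolding dual_def dual_comp_def num w x e_def g_def by blast
  qed
  ultimately show ?thesis by (subst landau_o.big.in_cong)
qed

lemma z_of_limit: "(z_of \<longlongrightarrow> (\<alpha>\<^sup>2 + 1) / (2 * \<alpha>)) at_infinity"
  and w_of_limit: "(w_of \<longlongrightarrow> 2 / (2 * \<alpha>)) at_infinity"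
  and factor_limit: "((\<lambda>s. s\<^sup>2 / zeta_num s) \<longlongrightarrow> 1 / \<alpha>) at_infinity"
proof -
  have ev: "\<forall>\<^sub>F s in at_infinity. s \<noteq> (0::complex)"
    unfolding eventually_at_infinity by (rule exI[of _ 1]) auto
  define X Y where "X = (\<lambda>s. \<alpha> - \<beta> * (1 / s)\<^sup>2)" and "Y = (\<lambda>s::complex. 1 - (1 / s)\<^sup>2)"
  have lims: "(X \<longlongrightarrow> \<alpha> - \<beta> * 0\<^sup>2) at_infinity" "(Y \<longlongrightarrow> 1 - 0\<^sup>2) at_infinity"
    unfolding X_def Y_def by (intro tendsto_intros one_over_at_infinity)+
  have xs: "zeta_num s = s\<^sup>2 * X s" "s\<^sup>2 - 1 = s\<^sup>2 * Y s" "s - 1 = s * (1 - 1 / s)" if "s \<noteq> 0" for s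
    using that by (simp_all add: X_def Y_def algebra_simps power_divide)
  have zn: "znum s = s ^ 4 * ((X s)\<^sup>2 + (Y s)\<^sup>2)" "zden s = s ^ 4 * (2 * X s * Y s)" if "s \<noteq> 0" for s
    unfolding znum_def zden_def xs[OF that] by (simp_all add: power2_eq_square power4_eq_xxxx algebra_simps)
  have "((\<lambda>s. ((X s)\<^sup>2 + (Y s)\<^sup>2) / (2 * X s * Y s)) \<longlongrightarrow> ((\<alpha> - \<beta> * 0\<^sup>2)\<^sup>2 + (1 - 0\<^sup>2)\<^sup>2) / (2 * (\<alpha> - \<beta> * 0\<^sup>2) * (1 - 0\<^sup>2))) at_infinity"
    by (intro tendsto_intros lims) (use parameters in auto)
  then have "((\<lambda>s. ((X s)\<^sup>2 + (Y s)\<^sup>2) / (2 * X s * Y s)) \<longlongrightarrow> (\<alpha>\<^sup>2 + 1) / (2 * \<alpha>)) at_infinity" by simp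
  then show "(z_of \<longlongrightarrow> (\<alpha>\<^sup>2 + 1) / (2 * \<alpha>)) at_infinity"
    by (rule Lim_transform_eventually) (use ev in \<open>eventually_elim, simp add: z_of_def zn\<close>)
  have "((\<lambda>s. 2 * (1 - 1 / s) ^ 4 / (2 * X s * Y s)) \<longlongrightarrow> 2 * (1 - 0) ^ 4 / (2 * (\<alpha> - \<beta> * 0\<^sup>2) * (1 - 0\<^sup>2))) at_infinity"
    by (intro tendsto_intros lims one_over_at_infinity) (use parameters in auto)
  then have "((\<lambda>s. 2 * (1 - 1 / s) ^ 4 / (2 * X s * Y s)) \<longlongrightarrow> 2 / (2 * \<alpha>)) at_infinity" by simp
  then show "(w_of \<longlongrightarrow> 2 / (2 * \<alpha>)) at_infinity"
  proof (rule Lim_transform_eventually)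
    show "\<forall>\<^sub>F s in at_infinity. 2 * (1 - 1 / s) ^ 4 / (2 * X s * Y s) = w_of s"
      using ev
    proof eventually_elim
      case (elim s)
      have "w_of s = (s ^ 4 * (2 * (1 - 1 / s) ^ 4)) / (s ^ 4 * (2 * X s * Y s))"
        unfolding w_of_def zn[OF elim] xs(3)[OF elim] power_mult_distrib by (simp add: mult.left_commute)
      then show ?case using elim by simp
    qed
  qed
  have "((\<lambda>s. 1 / X s) \<longlongrightarrow> 1 / (\<alpha> - \<beta> * 0\<^sup>2)) at_infinity"
    by (intro tendsto_intros lims) (use parameters in auto)
  then have "((\<lambda>s. 1 / X s) \<longlongrightarrow> 1 / \<alpha>) at_infinity" by simp
  then show "((\<lambda>s. s\<^sup>2 / zeta_num s) \<longlongrightarrow> 1 / \<alpha>) at_infinity"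
    by (rule Lim_transform_eventually) (use ev in \<open>eventually_elim, simp add: xs(1)\<close>)
qed

text \<open>
  The point \<open>s = \<infinity>\<close> lies over a finite \<open>z\<close>, so only the explicit polynomial factors grow.
\<close>

lemma dual_growth: "dual n V \<in> O[at_infinity](\<lambda>s. s ^ 6)"
proof -
  define v where "v = (\<lambda>j s. poly (V j) (z_of s))"
  have v: "v j \<in> O[at_infinity](\<lambda>s. s ^ 0)" for j
    unfolding v_def power_0 by (rule tendsto_imp_bigo_1[OF isCont_tendsto_compose[OF poly_isCont z_of_limit]])
  have w: "(\<lambda>s. w_of s ^ n) \<in> O[at_infinity](\<lambda>s. s ^ 0)"
    unfolding power_0 by (intro bigo_1_power tendsto_imp_bigo_1[OF w_of_limit])
  have r: "(\<lambda>s. s\<^sup>2 / zeta_num s) \<in> O[at_infinity](\<lambda>s. s ^ 0)"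
    unfolding power_0 by (rule tendsto_imp_bigo_1[OF factor_limit])
  have quad: "(\<lambda>s. a * s\<^sup>2 - b) \<in> O[at_infinity](\<lambda>s. s ^ 2)" for a b :: complex
  proof -
    have "degree [:- b, 0, a:] \<le> 2" using degree_pCons_le[of 0 "[:a:]"] by auto
    moreover have "poly [:- b, 0, a:] = (\<lambda>s. a * s\<^sup>2 - b)"
      by (auto simp: fun_eq_iff power2_eq_square algebra_simps)
    ultimately show ?thesis using poly_bigo_at_infinity by metis
  qed
  have x: "(\<lambda>s. \<kappa> * zeta_num s) \<in> O[at_infinity](\<lambda>s. s ^ 2)"
    using quad[of "\<kappa> * \<alpha>" "\<kappa> * \<beta>"] by (simp add: algebra_simps)
  have y: "(\<lambda>s. \<alpha> * \<beta> * (s\<^sup>2 - 1)\<^sup>2) \<in> O[at_infinity](\<lambda>s. s ^ 4)"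
  proof -
    have "(\<lambda>s. \<alpha> * \<beta> * (s\<^sup>2 - 1)\<^sup>2) = (\<lambda>s. (\<alpha> * \<beta> * s\<^sup>2 - \<alpha> * \<beta>) * (1 * s\<^sup>2 - 1))"
      by (auto simp: fun_eq_iff power2_eq_square algebra_simps)
    then show ?thesis
      using bigo_power_mult[OF quad[of "\<alpha> * \<beta>" "\<alpha> * \<beta>"] quad[of 1 1]] by simp
  qed
  have pq: "(\<lambda>s. pp s * qq s) \<in> O[at_infinity](\<lambda>s. s ^ 4)"
    using bigo_power_mult[OF quad quad] unfolding pp_def qq_def by fastforce
  have s: "(\<lambda>s. s) \<in> O[at_infinity](\<lambda>s::complex. s ^ 1)" by simp
  have up: "h \<in> O[at_infinity](\<lambda>s. s ^ d)" if "h \<in> O[at_infinity](\<lambda>s. s ^ c)" "c \<le> d"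
    for h :: "complex \<Rightarrow> complex" and c d
    using landau_o.big_trans[OF that(1) power_bigo_at_infinity[OF that(2)]] .
  have 1: "(\<lambda>s. s * v j s + \<kappa> * zeta_num s * v i s) \<in> O[at_infinity](\<lambda>s. s ^ 2)" for i j
    using up[OF bigo_power_mult[OF s v[of j]], of 2] bigo_power_mult[OF x v[of i]]
    by (intro sum_in_bigo) simp_all
  have 2: "(\<lambda>s. (s * v 3 s + \<kappa> * zeta_num s * v 2 s) * (pp s * qq s)
     - \<alpha> * \<beta> * (s\<^sup>2 - 1)\<^sup>2 * (s * v 1 s + \<kappa> * zeta_num s * v 0 s)) \<in> O[at_infinity](\<lambda>s. s ^ 6)"
    using bigo_power_mult[OF 1[of 3 2] pq] bigo_power_mult[OF y 1[of 1 0]]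
    by (intro sum_in_bigo) simp_all
  have "(\<lambda>s. w_of s ^ n * (((s * v 3 s + \<kappa> * zeta_num s * v 2 s) * (pp s * qq s)
     - \<alpha> * \<beta> * (s\<^sup>2 - 1)\<^sup>2 * (s * v 1 s + \<kappa> * zeta_num s * v 0 s)) * (s\<^sup>2 / zeta_num s)))
     \<in> O[at_infinity](\<lambda>s. s ^ (0 + (6 + 0)))"
    by (intro bigo_power_mult w 2 r)
  then show ?thesis by (simp add: dual_def[abs_def] dual_comp_def dual_num_def v_def)
qed

lemma dual_holomorphic: "dual n V holomorphic_on - {s. s\<^sup>2 = 1 \<or> \<alpha> * s\<^sup>2 = \<beta>}"
proof -
  let ?S = "- {s. s\<^sup>2 = 1 \<or> \<alpha> * s\<^sup>2 = \<beta>}"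
  have h: "pp holomorphic_on ?S" "qq holomorphic_on ?S" "znum holomorphic_on ?S" "zden holomorphic_on ?S"
    unfolding pp_def[abs_def] qq_def[abs_def] znum_def[abs_def] zden_def[abs_def] by (intro holomorphic_intros)+
  have z: "z_of holomorphic_on ?S"
    unfolding z_of_def by (intro holomorphic_intros h) (auto simp: zden_eq_0_iff)
  have w: "w_of holomorphic_on ?S"
    unfolding w_of_def by (intro holomorphic_intros h) (auto simp: zden_eq_0_iff)
  have r: "(\<lambda>s. s\<^sup>2 / zeta_num s) holomorphic_on ?S"
    by (intro holomorphic_intros) auto
  have p: "(\<lambda>s. poly (V j) (z_of s)) holomorphic_on ?S" for j
    using holomorphic_on_compose[OF z, of "poly (V j)"] by (simp add: o_def poly_holomorphic_on)
  show ?thesis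
    unfolding dual_def[abs_def] dual_comp_def dual_num_def
    by (intro holomorphic_on_mult holomorphic_on_power holomorphic_on_add holomorphic_on_diff
        holomorphic_on_const holomorphic_on_ident h p w r)
qed

lemma dual_polynomial:
  assumes deg: "\<And>j. j < 4 \<Longrightarrow> degree (V j) \<le> 3 * n"
    and tII: "\<And>j. j \<in> {1,2,3} \<Longrightarrow>
      (\<lambda>z. poly (V 0) z * f z ^ j - poly (V j) z) \<in> O[at_infinity](\<lambda>z. 1 / z ^ (n + 1))"
    and f: "\<And>s0. s0 = - 1 \<or> \<alpha> * s0\<^sup>2 = \<beta> \<Longrightarrow>
      \<forall>\<^sub>F s in at s0. (s * f (z_of s) + \<kappa> * zeta_num s) *
        ((f (z_of s))\<^sup>2 * (pp s * qq s) - \<alpha> * \<beta> * (s\<^sup>2 - 1)\<^sup>2) = 0"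
  obtains T where "degree T \<le> 6" "\<And>s. s\<^sup>2 \<noteq> 1 \<Longrightarrow> \<alpha> * s\<^sup>2 \<noteq> \<beta> \<Longrightarrow> poly T s = dual n V s"
proof -
  let ?X = "{s. s\<^sup>2 = 1 \<or> \<alpha> * s\<^sup>2 = \<beta>}"
  have "dual n V \<in> O[at x](\<lambda>_. 1)" if "x \<in> ?X" for x
  proof (cases "x = 1")
    case True
    then show ?thesis using dual_bounded_at_one[of V n] deg by simp
  next
    case False
    then have "x = - 1 \<or> \<alpha> * x\<^sup>2 = \<beta>" using that by (auto simp: power2_eq_1_iff)
    then show ?thesis using dual_bounded_at_other_infinities[OF tII _ f] that
      by (auto simp: zden_eq_0_iff)
  qed
  then obtain g where g: "g holomorphic_on UNIV" "\<And>z. z \<in> - ?X \<Longrightarrow> g z = dual n V z"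
    using removable_finite[OF finite_poles dual_holomorphic] by blast
  have "\<forall>\<^sub>F s in at_infinity. s \<notin> ?X"
  proof -
    obtain b where "\<And>x. x \<in> ?X \<Longrightarrow> norm x \<le> b"
      using finite_imp_bounded[OF finite_poles] unfolding bounded_iff by blast
    then show ?thesis unfolding eventually_at_infinity by (intro exI[of _ "b + 1"]) force
  qed
  then have "\<forall>\<^sub>F s in at_infinity. g s = dual n V s"
    by eventually_elim (use g(2) in auto)
  then have "g \<in> O[at_infinity](\<lambda>s. s ^ 6)"
    using dual_growth[of n V] by (subst landau_o.big.in_cong)
  then obtain T where "degree T \<le> 6" "\<And>z. poly T z = g z"
    using polynomial_growth_imp_poly[OF g(1)] by blast
  then show ?thesis using that g(2) by auto
qed

end

section \<open>Convergence on the first sheet\<close>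

text \<open>
  The numerator of \<open>p (x / y)\<close> for the denominator \<open>y\<^sup>d\<close>. It makes the function \<open>normalized\<close> below
  holomorphic at the point \<open>s = 1\<close> over infinity, and zeros of \<open>p\<close> become explicit factors.
\<close>

definition homogenize :: "nat \<Rightarrow> complex poly \<Rightarrow> complex \<Rightarrow> complex \<Rightarrow> complex" where
  "homogenize d p x y = (\<Sum>i\<le>d. coeff p i * x ^ i * y ^ (d - i))"

lemma homogenize_eval:
  assumes "y \<noteq> 0" "degree p \<le> d"
  shows "homogenize d p x y = y ^ d * poly p (x / y)"
proof -
  have "poly p (x / y) = (\<Sum>i\<le>d. coeff p i * (x / y) ^ i)"
    unfolding poly_altdef using assms(2) by (intro sum.mono_neutral_left) (auto simp: coeff_eq_0)
  then show ?thesis unfolding homogenize_def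
    using assms(1) by (auto simp: sum_distrib_left power_divide power_diff intro!: sum.cong)
qed

lemma homogenize_smult: "homogenize d (smult c p) x y = c * homogenize d p x y"
  by (simp add: homogenize_def sum_distrib_left mult.assoc)

lemma homogenize_linear_factor:
  assumes "degree p \<le> d"
  shows "homogenize (Suc d) ([:- c, 1:] * p) x y = (x - c * y) * homogenize d p x y"
proof (cases "y = 0")
  case True
  have "homogenize d p x 0 = coeff p d * x ^ d" for d p
    unfolding homogenize_def by (subst sum.remove[of _ d]) (auto intro!: sum.neutral)
  moreover have "coeff p (Suc d) = 0" using assms by (simp add: coeff_eq_0)
  ultimately show ?thesis using True by (simp add: coeff_pCons)
next
  case False
  have "degree ([:- c, 1:] * p) \<le> Suc d"
    using assms degree_mult_le[of "[:- c, 1:]" p] by (simp del: mult_pCons_left)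
  then have "homogenize (Suc d) ([:- c, 1:] * p) x y = y ^ Suc d * poly ([:- c, 1:] * p) (x / y)"
    by (rule homogenize_eval[OF False])
  also have "\<dots> = (x - c * y) * (y ^ d * poly p (x / y))"
    using False by (simp add: field_simps)
  also have "\<dots> = (x - c * y) * homogenize d p x y"
    by (simp only: homogenize_eval[OF False assms])
  finally show ?thesis .
qed

lemma homogenize_linear_factors:
  assumes "degree p \<le> d"
  shows "homogenize (d + m) ((\<Prod>i<m. [:- z i, 1:]) * p) x y = (\<Prod>i<m. x - z i * y) * homogenize d p x y"
proof (induction m)
  case (Suc m)
  have "degree ((\<Prod>i<m. [:- z i, 1:]) * p) \<le> d + m"
  proof -
    have "degree (\<Prod>i<m. [:- z i, 1:]) \<le> (\<Sum>i<m. degree [:- z i, 1:])" using degree_prod_sum_le[of "{..<m}" "\<lambda>i. [:- z i, 1:]"] by (simp add: o_def)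
    then show ?thesis using assms degree_mult_le[of "\<Prod>i<m. [:- z i, 1:]" p] by simp
  qed
  note deg = this
  have e: "(\<Prod>i<Suc m. [:- z i, 1:]) * p = [:- z m, 1:] * ((\<Prod>i<m. [:- z i, 1:]) * p)"
    by (simp only: prod.lessThan_Suc mult_ac)
  show ?case
    unfolding e add_Suc_right homogenize_linear_factor[OF deg] Suc.IH by (simp only: prod.lessThan_Suc mult_ac)
qed simp

lemma compact_bounded_above:
  fixes h :: "complex \<Rightarrow> real"
  assumes "compact K" "continuous_on K h"
  obtains B where "0 \<le> B" "\<And>s. s \<in> K \<Longrightarrow> h s \<le> B"
proof -
  have "bounded (h ` K)" using assms by (simp add: compact_imp_bounded compact_continuous_image)
  then obtain B where "\<And>s. s \<in> K \<Longrightarrow> norm (h s) \<le> B" unfolding bounded_iff by blast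
  then show ?thesis by (intro that[of "max 0 B"]) (fastforce simp: max_def)+
qed

lemma compact_bounded_below_one:
  fixes h :: "complex \<Rightarrow> real"
  assumes "compact K" "continuous_on K h" "\<And>s. s \<in> K \<Longrightarrow> h s < 1"
  obtains \<rho> where "0 \<le> \<rho>" "\<rho> < 1" "\<And>s. s \<in> K \<Longrightarrow> h s \<le> \<rho>"
proof (cases "K = {}")
  case True
  then show ?thesis by (intro that[of 0]) auto
next
  case False
  then obtain m where "m \<in> K" "\<And>s. s \<in> K \<Longrightarrow> h s \<le> h m"
    using continuous_attains_sup[OF assms(1) _ assms(2)] by blast
  then show ?thesis using assms(3) by (intro that[of "max 0 (h m)"]) (auto simp: le_max_iff_disj)
qed

context cut_surface_function
begin

text \<open>
  This is \<open>2 \<kappa>\<^sup>3 p(z) w\<^sup>n disc\<close>, written without the singularity at \<open>s = 1\<close>.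
\<close>

definition normalized :: "nat \<Rightarrow> complex poly \<Rightarrow> complex \<Rightarrow> complex" where
  "normalized n p s = 2 * \<kappa> ^ 3 * homogenize (3 * n) p (znum s) (zden s) * disc s
     / (8 ^ n * (zeta_num s * (s + 1)) ^ (4 * n))"

lemma normalized_eq:
  assumes "degree p \<le> 3 * n" "s\<^sup>2 \<noteq> 1" "\<alpha> * s\<^sup>2 \<noteq> \<beta>"
  shows "normalized n p s = 2 * \<kappa> ^ 3 * poly p (z_of s) * w_of s ^ n * disc s"
proof -
  have z: "zden s \<noteq> 0" using assms by (simp add: zden_eq_0_iff)
  define X u where "X = zeta_num s * (s + 1)" and "u = s - 1"
  have ne: "X \<noteq> 0" "u \<noteq> 0" using assms(2,3) by (auto simp: X_def u_def eq_neg_iff_add_eq_0[symmetric])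
  have zd: "zden s = 2 * X * u" by (simp add: zden_def X_def u_def power2_eq_square algebra_simps)
  have "zden s ^ (3 * n) / (8 ^ n * X ^ (4 * n)) = (2 * u ^ 4 / (2 * X * u)) ^ n"
  proof -
    have "zden s ^ (3 * n) / (8 ^ n * X ^ (4 * n)) = ((2 * X * u) ^ 3 / (8 * X ^ 4)) ^ n"
      unfolding zd by (simp add: power_mult power_divide power_mult_distrib)
    also have "(2 * X * u) ^ 3 / (8 * X ^ 4) = 2 * u ^ 4 / (2 * X * u)"
      using ne by (simp add: field_simps power3_eq_cube power4_eq_xxxx)
    finally show ?thesis .
  qed
  then have w: "zden s ^ (3 * n) / (8 ^ n * X ^ (4 * n)) = w_of s ^ n"
    by (simp add: w_of_def zd u_def)
  have "normalized n p s = 2 * \<kappa> ^ 3 * poly p (z_of s) * (zden s ^ (3 * n) / (8 ^ n * X ^ (4 * n))) * disc s"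
    unfolding normalized_def homogenize_eval[OF z assms(1)] z_of_def X_def by simp
  then show ?thesis by (simp add: w)
qed

lemma normalized_smult: "normalized n (smult c p) s = c * normalized n p s"
  by (simp add: normalized_def homogenize_smult)

lemma holomorphic_coefficients [holomorphic_intros]:
  "pp holomorphic_on S" "qq holomorphic_on S" "znum holomorphic_on S" "zden holomorphic_on S"
  "disc holomorphic_on S"
  unfolding pp_def[abs_def] qq_def[abs_def] znum_def[abs_def] zden_def[abs_def] disc_def[abs_def]
  by (intro holomorphic_intros)+

lemma normalized_holomorphic: "normalized n p holomorphic_on sheet1"
  unfolding normalized_def[abs_def] homogenize_def
  by (intro holomorphic_intros) (auto simp: sheet1_nonzero(1,2,3))

lemma F_of_holomorphic: "F_of holomorphic_on sheet1"
  unfolding F_of_def[abs_def] by (intro holomorphic_intros) (auto simp: sheet1_nonzero(1,2,3))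

text \<open>
  Each condition excludes the zeros of a polynomial in \<open>s\<close> that is not identically 0, as its value at 1
  (at 0 for \<open>s\<^sup>2 - 1\<close>) shows.
\<close>

lemma finite_nongeneric: "finite {s. \<not> generic s}"
proof -
  define xP yP pP qP where "xP = [:- \<beta>, 0, \<alpha>:]" and "yP = [:- 1, 0, 1 :: complex:]"
    and "pP = [:- (1 - \<beta>\<^sup>2), 0, 1 - \<alpha> * \<beta>:]" and "qP = [:- (1 - \<alpha> * \<beta>), 0, 1 - \<alpha>\<^sup>2:]"
  define dP where "dP = xP\<^sup>2 * (pP * qP) - smult ((\<alpha> - \<beta>)\<^sup>2) ([:0, 0, 1:] * yP\<^sup>2)"
  have ev: "poly xP s = zeta_num s" "poly yP s = s\<^sup>2 - 1" "poly pP s = pp s" "poly qP s = qq s" for s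
    by (simp_all add: xP_def yP_def pP_def qP_def pp_def qq_def power2_eq_square algebra_simps)
  have dev: "poly dP s = disc s" for s
    unfolding dP_def disc_def by (simp add: ev power2_eq_square)
  have p1: "pp 1 = - \<beta> * (\<alpha> - \<beta>)" "qq 1 = - \<alpha> * (\<alpha> - \<beta>)"
    by (simp_all add: pp_def qq_def power2_eq_square algebra_simps)
  have "poly xP 1 \<noteq> 0" "poly yP 0 \<noteq> 0" "poly pP 1 \<noteq> 0" "poly qP 1 \<noteq> 0" "poly dP 1 \<noteq> 0" "poly [:0, 1:] 1 \<noteq> (0 :: complex)"
    unfolding ev dev disc_def p1 using parameters by simp_all
  then have "xP \<noteq> 0" "yP \<noteq> 0" "pP \<noteq> 0" "qP \<noteq> 0" "dP \<noteq> 0" by auto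
  then have "finite (\<Union>P\<in>{[:0, 1:], xP, yP, pP, qP, dP}. {s. poly P s = 0})"
    using poly_roots_finite by (intro finite_UN_I) auto
  then show ?thesis
    by (rule finite_subset[rotated]) (auto simp: generic_def ev dev)
qed

lemma w_of_ratio_minus:
  assumes "zden s \<noteq> 0" "s + 1 \<noteq> 0"
  shows "norm (w_of s) = norm (s - 1) ^ 4 / norm (s + 1) ^ 4 * norm (w_of (- s))"
proof -
  have "norm (- s - 1) = norm (s + 1)" by (metis minus_add_distrib norm_minus_cancel add.commute diff_conv_add_uminus)
  then show ?thesis using assms by (simp add: w_of_def norm_divide norm_mult norm_power)
qed

text \<open>
  The value of \<open>|w|\<close> at each of the two points \<open>\<plusminus> s'\<close> is at least the one at the point in the right
  half-plane, which \<open>copy_ratio\<close> describes.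
\<close>

lemma w_of_ratio_partner:
  assumes s: "generic s" and s': "s'\<^sup>2 * qq s = pp s"
  shows "norm (w_of s) * sheet_bound s \<le> norm (s - 1) ^ 4 * norm (w_of s')"
proof -
  have q: "qq s \<noteq> 0" and x: "zeta_num s \<noteq> 0" and z: "zden s \<noteq> 0"
    using s by (auto simp: generic_def zden_eq_0_iff)
  define e where "e = (\<alpha> - \<beta>) / qq s"
  have e: "e \<noteq> 0" using parameters q by (simp add: e_def)
  have p: "s'\<^sup>2 - 1 = e * zeta_num s" "zden s' = e\<^sup>2 * zden s"
    using partner(2,5)[OF s' q] by (simp_all add: e_def)
  have "s'\<^sup>2 - 1 \<noteq> 0" unfolding p using e x by simp
  then have s1: "s' \<noteq> - 1" "s' + 1 \<noteq> 0" by (auto simp: eq_neg_iff_add_eq_0[symmetric])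
  have f: "norm (s'\<^sup>2 - 1) = norm (s' - 1) * norm (s' + 1)"
    by (simp add: norm_mult[symmetric] power2_eq_square algebra_simps)
  have "copy_ratio (pp s) (qq s) \<le> (norm (s' - 1))\<^sup>2 / (norm (s' + 1))\<^sup>2"
    using copy_ratio_le[OF s'[symmetric] q s1(1)] .
  then have "copy_ratio (pp s) (qq s) * (norm (s'\<^sup>2 - 1))\<^sup>2 \<le> (norm (s' - 1))\<^sup>2 / (norm (s' + 1))\<^sup>2 * (norm (s'\<^sup>2 - 1))\<^sup>2"
    by (rule mult_right_mono) simp
  also have "\<dots> = norm (s' - 1) ^ 4"
    unfolding f using s1(2) by (simp add: power_mult_distrib power2_eq_square power4_eq_xxxx)
  finally have "(norm e)\<^sup>2 * sheet_bound s \<le> norm (s' - 1) ^ 4"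
    unfolding p by (simp add: norm_mult power_mult_distrib mult.left_commute)
  then have "norm (w_of s) / (norm e)\<^sup>2 * ((norm e)\<^sup>2 * sheet_bound s)
      \<le> norm (w_of s) / (norm e)\<^sup>2 * norm (s' - 1) ^ 4"
    by (rule mult_left_mono) simp
  moreover have "norm (w_of s) / (norm e)\<^sup>2 * norm (s' - 1) ^ 4 = norm (s - 1) ^ 4 * norm (w_of s')"
    unfolding w_of_def p(2) by (simp add: norm_divide norm_mult norm_power mult_ac)
  ultimately show ?thesis using e by simp
qed

lemma generic_partner:
  assumes s: "generic s" and s': "s'\<^sup>2 * qq s = pp s"
  shows "s'\<^sup>2 \<noteq> 1" "\<alpha> * s'\<^sup>2 \<noteq> \<beta>" "s' \<noteq> 0"
  using partner(1,2)[OF s'] s s' parameters by (auto simp: generic_def)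

text \<open>
  The four terms of \<open>recovery\<close> after multiplication by \<open>w(s)\<^sup>n disc(s)\<close>; the three terms for the other
  points carry the factor \<open>(w(s) / w(t))\<^sup>n\<close>.
\<close>

lemma normalized_error:
  assumes V: "\<And>j. j < 4 \<Longrightarrow> degree (V j) \<le> 3 * n"
    and T: "\<And>s. s\<^sup>2 \<noteq> 1 \<Longrightarrow> \<alpha> * s\<^sup>2 \<noteq> \<beta> \<Longrightarrow> poly T s = dual n V s"
    and s: "generic s" and s': "s'\<^sup>2 * qq s = pp s" and j: "j < 2"
    and \<rho>: "norm (w_of s) \<le> \<rho> * norm (w_of (- s))" "norm (w_of s) \<le> \<rho> * norm (w_of s')"
      "norm (w_of s) \<le> \<rho> * norm (w_of (- s'))"
    and C: "\<And>t. t \<in> {- s, s', - s'} \<Longrightarrow> norm (F_of t ^ j * poly T t) \<le> C" "norm (qq s / (\<alpha> - \<beta>)) ^ 4 \<le> D"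
  shows "norm (normalized n (V j) s - F_of s ^ j * poly T s) \<le> \<rho> ^ n * (C + 2 * D * C)"
proof -
  have q: "qq s \<noteq> 0" and d: "disc s \<noteq> 0" and b: "\<alpha> * s\<^sup>2 \<noteq> \<beta>" and y: "s\<^sup>2 \<noteq> 1"
    using s by (auto simp: generic_def)
  note s'n = generic_partner[OF s s']
  define v where "v = (\<lambda>j. poly (V j) (z_of s))"
  have C0: "0 \<le> C" using C(1)[of s'] norm_ge_zero order_trans by blast
  have zz: "z_of s' = z_of s" using partner(7)[OF s' q] .
  have X: "w_of s ^ n * dual_comp v t = (w_of s / w_of t) ^ n * poly T t" if "t \<in> {s, - s, s', - s'}" for t
  proof -
    have t: "t\<^sup>2 \<noteq> 1" "\<alpha> * t\<^sup>2 \<noteq> \<beta>" using that b y s'n by auto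
    have "z_of t = z_of s" using that zz by auto
    then have "poly T t = w_of t ^ n * dual_comp v t" unfolding T[OF t] dual_def v_def by simp
    then show ?thesis using w_of_nonzero[OF t] by (simp add: power_divide)
  qed
  define G where "G = (\<lambda>t. F_of t ^ j * poly T t)"
  define h where "h = - ((qq s / (\<alpha> - \<beta>)) ^ 4)"
  have ds': "disc s / disc s' = h"
    unfolding partner(8)[OF s' q] h_def using d q parameters by (simp add: power_divide field_simps)
  have summand: "F_of t ^ j * dual_comp v t / disc u * (w_of s ^ n * disc s) = disc s / disc u * ((w_of s / w_of t) ^ n * G t)"
    if "t \<in> {s, - s, s', - s'}" for t u
    using X[OF that] by (simp add: G_def mult_ac)
  have "normalized n (V j) s = 2 * \<kappa> ^ 3 * v j * (w_of s ^ n * disc s)"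
    using normalized_eq[OF V y b] j by (simp add: v_def)
  also have "\<dots> = (F_of s ^ j * dual_comp v s / disc s + F_of (- s) ^ j * dual_comp v (- s) / disc s
       + (F_of s' ^ j * dual_comp v s' / disc s' + F_of (- s') ^ j * dual_comp v (- s') / disc s'))
       * (w_of s ^ n * disc s)"
    unfolding recovery[OF s s' j] ..
  also have "\<dots> = (w_of s / w_of s) ^ n * G s + (w_of s / w_of (- s)) ^ n * G (- s)
       + (h * ((w_of s / w_of s') ^ n * G s') + h * ((w_of s / w_of (- s')) ^ n * G (- s')))"
    unfolding distrib_right summand[of s s, OF insertI1] summand[of "- s" s, OF insertI2[OF insertI1]]
      summand[of s' s', OF insertI2[OF insertI2[OF insertI1]]]
      summand[of "- s'" s', OF insertI2[OF insertI2[OF insertI2[OF insertI1]]]] ds'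
    using d by simp
  finally have e: "normalized n (V j) s - G s = (w_of s / w_of (- s)) ^ n * G (- s)
       + (h * ((w_of s / w_of s') ^ n * G s') + h * ((w_of s / w_of (- s')) ^ n * G (- s')))"
    using w_of_nonzero[OF y b] by simp
  have bd: "norm ((w_of s / w_of t) ^ n * G t) \<le> \<rho> ^ n * C" if t: "t \<in> {- s, s', - s'}" for t
  proof -
    have "t\<^sup>2 \<noteq> 1" "\<alpha> * t\<^sup>2 \<noteq> \<beta>" using t b y s'n by auto
    then have "w_of t \<noteq> 0" by (rule w_of_nonzero)
    then have "norm (w_of s / w_of t) \<le> \<rho>" using \<rho> t by (auto simp: norm_divide divide_le_eq)
    then have le: "norm (w_of s / w_of t) ^ n \<le> \<rho> ^ n" by (rule power_mono) simp
    then have "0 \<le> \<rho> ^ n" using order_trans[OF zero_le_power[OF norm_ge_zero]] by blast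
    with le show ?thesis unfolding norm_mult norm_power
      using C(1)[OF t] C0 by (intro mult_mono) (auto simp: G_def norm_mult norm_power)
  qed
  have h: "norm h \<le> D" using C(2) by (simp add: h_def norm_power)
  have D: "0 \<le> D" using h norm_ge_zero order_trans by blast
  have hb: "norm (h * ((w_of s / w_of t) ^ n * G t)) \<le> D * (\<rho> ^ n * C)" if t: "t \<in> {- s, s', - s'}" for t
    unfolding norm_mult[of h] using h bd[OF t] D by (intro mult_mono) auto
  have "norm (normalized n (V j) s - G s) \<le> \<rho> ^ n * C + (D * (\<rho> ^ n * C) + D * (\<rho> ^ n * C))"
    unfolding e by (intro norm_triangle_le add_mono bd hb) simp_all
  then show ?thesis by (simp add: G_def algebra_simps)
qed

end

lemma norm_poly_le_sum_coeff:
  fixes p :: "complex poly"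
  assumes "degree p \<le> d" "norm t \<le> R"
  shows "norm (poly p t) \<le> (\<Sum>i\<le>d. norm (coeff p i) * R ^ i)"
proof -
  have "poly p t = (\<Sum>i\<le>d. coeff p i * t ^ i)"
    unfolding poly_altdef using assms(1) by (intro sum.mono_neutral_left) (auto simp: coeff_eq_0)
  also have "norm \<dots> \<le> (\<Sum>i\<le>d. norm (coeff p i * t ^ i))" by (rule norm_sum)
  also have "\<dots> \<le> (\<Sum>i\<le>d. norm (coeff p i) * R ^ i)"
    using assms(2) by (intro sum_mono) (simp add: norm_mult norm_power mult_left_mono power_mono)
  finally show ?thesis .
qed

context cut_surface_function
begin

text \<open>
  On a circle in the first sheet that avoids the finitely many nongeneric points, the ratios
  \<open>|w(s) / w(t)|\<close> are bounded by some \<open>\<rho> < 1\<close>, and all other quantities are bounded; so the error is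
  \<open>O(\<rho>\<^sup>n)\<close>. The maximum principle carries the convergence to the disc.
\<close>

lemma normalized_limit:
  assumes V: "\<And>k j. j < 4 \<Longrightarrow> degree (V k j) \<le> 3 * n k"
    and T: "\<And>k s. s\<^sup>2 \<noteq> 1 \<Longrightarrow> \<alpha> * s\<^sup>2 \<noteq> \<beta> \<Longrightarrow> poly (T k) s = dual (n k) (V k) s"
    and deg: "\<And>k. degree (T k) \<le> d" "degree L \<le> d"
    and n: "filterlim n at_top sequentially"
    and lim: "\<And>i. i \<le> d \<Longrightarrow> (\<lambda>k. coeff (T k) i) \<longlonglongrightarrow> coeff L i"
    and j: "j < 2"
  shows "locally_uniform_limit sheet1 (\<lambda>k. normalized (n k) (V k j)) (\<lambda>s. F_of s ^ j * poly L s)"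
  unfolding locally_uniform_limit_def
proof
  fix c assume "c \<in> sheet1"
  then obtain r0 where r0: "0 < r0" "cball c r0 \<subseteq> sheet1"
    using open_sheet1 open_contains_cball by blast
  obtain r where r: "0 < r" "r < r0" "sphere c r \<inter> {s. \<not> generic s} = {}"
    using small_radius_avoiding_finite[OF finite_nongeneric r0(1)] by blast
  define K where "K = sphere c r"
  have cK: "compact K" by (simp add: K_def)
  have gen: "generic s" "s \<in> sheet1" if "s \<in> K" for s
    using that r r0 by (auto simp: K_def subset_iff)
  have K0: "pp s \<noteq> 0" "qq s \<noteq> 0" "s \<noteq> 0" "\<alpha> * s\<^sup>2 \<noteq> \<beta>" "s + 1 \<noteq> 0" if "s \<in> K" for s
    using gen[OF that] sheet1_nonzero by (auto simp: generic_def)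
  note cpq = continuous_coefficients(1,2)[THEN continuous_on_subset, OF subset_UNIV, of K]
  have crp: "0 < sheet_bound s" if "s \<in> K" for s
  proof -
    have "norm (s - 1) ^ 4 < sheet_bound s"
      using gen(2)[OF that] by (simp add: sheet1_def)
    then show ?thesis by (rule le_less_trans[rotated]) simp
  qed
  note ccr = continuous_on_partner_ratio[of K]
  have cont: "continuous_on K (\<lambda>s. norm s)" "continuous_on K (\<lambda>s. norm (pp s / qq s))"
    "continuous_on K (\<lambda>s. (norm (\<kappa> * ((\<alpha> - \<beta>) * (s\<^sup>2 - 1) / qq s)))\<^sup>2 / norm (pp s / qq s))"
    "continuous_on K (\<lambda>s. norm (qq s / (\<alpha> - \<beta>)) ^ 4)" "continuous_on K (\<lambda>s. norm (F_of s))"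
    unfolding F_of_def using K0 parameters by (auto intro!: continuous_intros cpq)
  obtain B0 where B0: "0 \<le> B0" "\<And>s. s \<in> K \<Longrightarrow> norm s \<le> B0"
    using compact_bounded_above[OF cK cont(1)] by blast
  obtain B1 where B1: "0 \<le> B1" "\<And>s. s \<in> K \<Longrightarrow> norm (pp s / qq s) \<le> B1"
    using compact_bounded_above[OF cK cont(2)] by blast
  obtain B2 where B2: "0 \<le> B2"
    "\<And>s. s \<in> K \<Longrightarrow> (norm (\<kappa> * ((\<alpha> - \<beta>) * (s\<^sup>2 - 1) / qq s)))\<^sup>2 / norm (pp s / qq s) \<le> B2"
    using compact_bounded_above[OF cK cont(3)] by blast
  obtain D where D: "0 \<le> D" "\<And>s. s \<in> K \<Longrightarrow> norm (qq s / (\<alpha> - \<beta>)) ^ 4 \<le> D"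
    using compact_bounded_above[OF cK cont(4)] by blast
  obtain B4 where B4: "0 \<le> B4" "\<And>s. s \<in> K \<Longrightarrow> norm (F_of s) \<le> B4"
    using compact_bounded_above[OF cK cont(5)] by blast
  obtain \<rho>1 where \<rho>1: "0 \<le> \<rho>1" "\<rho>1 < 1" "\<And>s. s \<in> K \<Longrightarrow> norm (s - 1) ^ 4 / norm (s + 1) ^ 4 \<le> \<rho>1"
  proof (rule compact_bounded_below_one[OF cK])
    show "continuous_on K (\<lambda>s. norm (s - 1) ^ 4 / norm (s + 1) ^ 4)"
      using K0(5) by (intro continuous_intros) auto
    fix s assume s: "s \<in> K"
    have "(norm (s - 1))\<^sup>2 < (norm (s + 1))\<^sup>2"
      using gen(2)[OF s] unfolding norm_add_one_sq by (simp add: sheet1_def)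
    then have "norm (s - 1) < norm (s + 1)" by (rule power_less_imp_less_base) simp
    then have "norm (s - 1) ^ 4 < norm (s + 1) ^ 4" by (intro power_strict_mono) auto
    then show "norm (s - 1) ^ 4 / norm (s + 1) ^ 4 < 1" using K0(5)[OF s] by (simp add: divide_less_eq)
  qed blast
  obtain \<rho>2 where \<rho>2: "0 \<le> \<rho>2" "\<rho>2 < 1"
    "\<And>s. s \<in> K \<Longrightarrow> norm (s - 1) ^ 4 / sheet_bound s \<le> \<rho>2"
  proof (rule compact_bounded_below_one[OF cK])
    show "continuous_on K (\<lambda>s. norm (s - 1) ^ 4 / sheet_bound s)"
      using crp by (intro continuous_intros ccr) (metis less_irrefl)
    fix s assume s: "s \<in> K"
    show "norm (s - 1) ^ 4 / sheet_bound s < 1"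
      using gen(2)[OF s] crp[OF s] by (subst divide_less_eq_1_pos) (simp_all add: sheet1_def)
  qed blast
  define \<rho> R BF where "\<rho> = max \<rho>1 \<rho>2" and "R = 1 + B0 + B1" and "BF = 1 + B4 + B2"
  have \<rho>: "0 \<le> \<rho>" "\<rho> < 1" using \<rho>1 \<rho>2 by (auto simp: \<rho>_def)
  have "\<exists>b. \<forall>k. norm (coeff (T k) i) \<le> b" if "i \<le> d" for i
    using convergent_imp_Bseq[OF convergentI[OF lim[OF that]]] unfolding Bseq_def by auto
  then obtain b where b: "\<And>i k. i \<le> d \<Longrightarrow> norm (coeff (T k) i) \<le> b i" by metis
  define CT where "CT = (\<Sum>i\<le>d. b i * R ^ i)"
  have R: "0 \<le> R" "1 \<le> BF" using B0 B1 B2 B4 by (auto simp: R_def BF_def)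
  have polyT: "norm (poly (T k) t) \<le> CT" if "norm t \<le> R" for k t
  proof -
    have "norm (poly (T k) t) \<le> (\<Sum>i\<le>d. norm (coeff (T k) i) * R ^ i)"
      using norm_poly_le_sum_coeff[OF deg(1) that] .
    also have "\<dots> \<le> CT" unfolding CT_def using b R by (intro sum_mono mult_right_mono) auto
    finally show ?thesis .
  qed
  have CT: "0 \<le> CT" using order_trans[OF norm_ge_zero polyT[of 0]] R by simp
  have small: "x \<le> 1 + B" if "x\<^sup>2 \<le> B" "0 \<le> B" for x B :: real
  proof (cases "x \<le> 1")
    case False
    then have "x * 1 \<le> x * x" by (intro mult_left_mono) auto
    then show ?thesis using that by (simp add: power2_eq_square)
  qed (use that in simp)
  have FBF: "norm (F_of t ^ j) \<le> BF" if "norm (F_of t) \<le> BF" for t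
  proof -
    have "j = 0 \<or> j = 1" using j by auto
    then show ?thesis using that R by auto
  qed
  define \<epsilon> where "\<epsilon> = (\<lambda>k. \<rho> ^ n k * (BF * CT + 2 * D * (BF * CT))
      + BF * (\<Sum>i\<le>d. norm (coeff (T k) i - coeff L i) * R ^ i))"
  have bound: "norm (normalized (n k) (V k j) s - F_of s ^ j * poly L s) \<le> \<epsilon> k" if s: "s \<in> K" for k s
  proof -
    \<comment> \<open>\<open>s'\<close> is not continuous in \<open>s\<close>, but the moduli that are needed are\<close>
    define s' where "s' = csqrt (pp s / qq s)"
    have s': "s'\<^sup>2 * qq s = pp s" using K0(2)[OF s] by (simp add: s'_def)
    have s'm: "(- s')\<^sup>2 * qq s = pp s" using s' by simp
    have ns': "norm s' \<le> R"
    proof -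
      have "(norm s')\<^sup>2 = norm (pp s / qq s)" by (simp add: s'_def norm_power[symmetric])
      then have "norm s' \<le> 1 + B1" using B1 s by (intro small) auto
      then show ?thesis using B0 by (simp add: R_def)
    qed
    have ns: "norm s \<le> R" using B0(2)[OF s] B1 by (simp add: R_def)
    have Fs: "norm (F_of s) \<le> BF" using B4(2)[OF s] B2 by (simp add: BF_def)
    have Fs': "norm (F_of s') \<le> BF"
    proof -
      have "(norm (F_of s'))\<^sup>2 = (norm (\<kappa> * (\<alpha> * s'\<^sup>2 - \<beta>)))\<^sup>2 / norm (s'\<^sup>2)"
        by (simp add: F_of_def norm_divide power_divide norm_power)
      also have "\<dots> = (norm (\<kappa> * ((\<alpha> - \<beta>) * (s\<^sup>2 - 1) / qq s)))\<^sup>2 / norm (pp s / qq s)"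
        unfolding partner(1)[OF s' K0(2)[OF s]] by (simp add: s'_def)
      also have "\<dots> \<le> B2" by (rule B2(2)[OF s])
      finally have "norm (F_of s') \<le> 1 + B2" using B2(1) by (rule small)
      then show ?thesis using B4 by (simp add: BF_def)
    qed
    have Fm: "norm (F_of (- t)) = norm (F_of t)" for t by (simp add: F_of_def norm_divide norm_mult)
    have CFT: "norm (F_of t ^ j * poly (T k) t) \<le> BF * CT" if t: "t \<in> {- s, s', - s'}" for t
      unfolding norm_mult using t ns ns' Fs Fs' Fm R CT
      by (intro mult_mono FBF polyT) auto
    have zd: "zden s \<noteq> 0" using gen(1)[OF s] by (simp add: generic_def zden_eq_0_iff)
    have rp: "norm (w_of s) \<le> \<rho> * norm (w_of t)" if t: "t\<^sup>2 * qq s = pp s" for t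
    proof -
      have "norm (w_of s) \<le> norm (s - 1) ^ 4 / sheet_bound s * norm (w_of t)"
        using w_of_ratio_partner[OF gen(1)[OF s] t] crp[OF s] by (simp add: pos_le_divide_eq)
      also have "\<dots> \<le> \<rho> * norm (w_of t)"
        using \<rho>2(3)[OF s] by (intro mult_right_mono) (auto simp: \<rho>_def)
      finally show ?thesis .
    qed
    have rm: "norm (w_of s) \<le> \<rho> * norm (w_of (- s))"
      unfolding w_of_ratio_minus[OF zd K0(5)[OF s]]
      using \<rho>1(3)[OF s] by (intro mult_right_mono) (auto simp: \<rho>_def)
    have "norm (normalized (n k) (V k j) s - F_of s ^ j * poly (T k) s) \<le> \<rho> ^ n k * (BF * CT + 2 * D * (BF * CT))"
      using normalized_error[OF V T gen(1)[OF s] s' j rm rp[OF s'] rp[OF s'm] CFT D(2)[OF s]] .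
    moreover have "norm (F_of s ^ j * poly (T k) s - F_of s ^ j * poly L s)
        \<le> BF * (\<Sum>i\<le>d. norm (coeff (T k) i - coeff L i) * R ^ i)"
    proof -
      have "norm (poly (T k - L) s) \<le> (\<Sum>i\<le>d. norm (coeff (T k - L) i) * R ^ i)"
        using deg ns by (intro norm_poly_le_sum_coeff degree_diff_le) auto
      then have "norm (F_of s ^ j) * norm (poly (T k - L) s) \<le> BF * (\<Sum>i\<le>d. norm (coeff (T k) i - coeff L i) * R ^ i)"
        using FBF[OF Fs] R by (intro mult_mono) auto
      then show ?thesis by (simp add: norm_mult[symmetric] right_diff_distrib)
    qed
    ultimately have "norm (normalized (n k) (V k j) s - F_of s ^ j * poly (T k) s)
        + norm (F_of s ^ j * poly (T k) s - F_of s ^ j * poly L s) \<le> \<epsilon> k"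
      unfolding \<epsilon>_def by (rule add_mono)
    then show ?thesis
      using norm_triangle_ineq[of "normalized (n k) (V k j) s - F_of s ^ j * poly (T k) s"
          "F_of s ^ j * poly (T k) s - F_of s ^ j * poly L s"] by simp
  qed
  have "\<epsilon> \<longlonglongrightarrow> 0 * (BF * CT + 2 * D * (BF * CT)) + BF * (\<Sum>i\<le>d. norm (coeff L i - coeff L i) * R ^ i)"
    unfolding \<epsilon>_def
  proof (intro tendsto_intros lim)
    show "(\<lambda>k. \<rho> ^ n k) \<longlonglongrightarrow> 0"
      using filterlim_compose[OF LIMSEQ_power_zero n, of \<rho>] \<rho> by simp
  qed auto
  then have \<epsilon>: "\<epsilon> \<longlonglongrightarrow> 0" by simp
  have "uniform_limit K (\<lambda>k. normalized (n k) (V k j)) (\<lambda>s. F_of s ^ j * poly L s) sequentially"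
  proof (rule uniform_limitI)
    fix e :: real assume "0 < e"
    then have "\<forall>\<^sub>F k in sequentially. \<epsilon> k < e" using \<epsilon> by (intro order_tendstoD)
    then show "\<forall>\<^sub>F k in sequentially. \<forall>s\<in>K. dist (normalized (n k) (V k j) s) (F_of s ^ j * poly L s) < e"
      by eventually_elim (auto simp: dist_norm intro: le_less_trans[OF bound])
  qed
  moreover have "cball c r \<subseteq> sheet1" using r r0 by force
  ultimately have "uniform_limit (cball c r) (\<lambda>k. normalized (n k) (V k j)) (\<lambda>s. F_of s ^ j * poly L s) sequentially"
    unfolding K_def using r(1)
    by (intro uniform_limit_sphere_imp_cball[where S = sheet1] normalized_holomorphic holomorphic_intros F_of_holomorphic) auto
  then show "\<exists>r>0. cball c r \<subseteq> sheet1 \<and>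
      uniform_limit (cball c r) (\<lambda>k. normalized (n k) (V k j)) (\<lambda>s. F_of s ^ j * poly L s) sequentially"
    using r(1) \<open>cball c r \<subseteq> sheet1\<close> by blast
qed

lemma dual_smult: "dual n (\<lambda>j. smult c (V j)) s = c * dual n V s"
  by (simp add: dual_def dual_comp_def dual_num_def algebra_simps)

text \<open>
  Otherwise \<open>V 0\<close> would vanish at all generic \<open>z\<close> by \<open>recovery\<close>.
\<close>

lemma dual_nonzero:
  assumes V: "\<And>j. j < 4 \<Longrightarrow> degree (V j) \<le> 3 * n"
    and T: "\<And>s. s\<^sup>2 \<noteq> 1 \<Longrightarrow> \<alpha> * s\<^sup>2 \<noteq> \<beta> \<Longrightarrow> poly T s = dual n V s"
    and V0: "V 0 \<noteq> 0"
  shows "T \<noteq> 0"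
proof
  assume T0: "T = 0"
  have "zden 1 = 0" by (simp add: zden_def)
  have "\<forall>\<^sub>F z in at_infinity. poly (V 0) z \<noteq> 0"
  proof -
    have "bounded {z. poly (V 0) z = 0}" using poly_roots_finite[OF V0] by (rule finite_imp_bounded)
    then obtain b where "\<And>x. poly (V 0) x = 0 \<Longrightarrow> norm x \<le> b" unfolding bounded_iff by auto
    then show ?thesis unfolding eventually_at_infinity by (intro exI[of _ "b + 1"]) force
  qed
  then have "\<forall>\<^sub>F s in at 1. poly (V 0) (z_of s) \<noteq> 0"
    using z_of_at_infinity[OF \<open>zden 1 = 0\<close>] by (rule eventually_compose_filterlim)
  moreover have "\<forall>\<^sub>F s in at 1. s \<notin> {s. \<not> generic s}"
    by (rule eventually_notin_finite[OF finite_nongeneric])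
  ultimately have "\<forall>\<^sub>F s in at (1::complex). poly (V 0) (z_of s) \<noteq> 0 \<and> generic s"
    by eventually_elim auto
  then obtain s where s: "poly (V 0) (z_of s) \<noteq> 0" "generic s"
    using eventually_happens'[of "at (1::complex)"] by auto
  define s' where "s' = csqrt (pp s / qq s)"
  have s': "s'\<^sup>2 * qq s = pp s" using s(2) by (simp add: s'_def generic_def)
  have 0: "dual_comp (\<lambda>j. poly (V j) (z_of s)) t = 0" if "t \<in> {s, - s, s', - s'}" for t
  proof -
    have t: "t\<^sup>2 \<noteq> 1" "\<alpha> * t\<^sup>2 \<noteq> \<beta>"
      using that s(2) generic_partner[OF s(2) s'] by (auto simp: generic_def)
    have "z_of t = z_of s" using that partner(7)[OF s'] s(2) by (auto simp: generic_def)
    then show ?thesis using T[OF t] w_of_nonzero[OF t] by (simp add: T0 dual_def)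
  qed
  have "2 * \<kappa> ^ 3 * poly (V 0) (z_of s) = 0"
    using recovery[OF s(2) s', of 0 "\<lambda>j. poly (V j) (z_of s)"] 0 by simp
  then show False using s(1) \<kappa>_nonzero by simp
qed

text \<open>
  Normalise the sum of the moduli of the coefficients to 1 and pick a subsequence along which all
  coefficients converge; the limit then has the same norm, hence is not 0.
\<close>

lemma normalized_subsequence:
  assumes V: "\<And>k j. j < 4 \<Longrightarrow> degree (V k j) \<le> 3 * n k" "\<And>k. V k 0 \<noteq> 0"
    and T: "\<And>k s. s\<^sup>2 \<noteq> 1 \<Longrightarrow> \<alpha> * s\<^sup>2 \<noteq> \<beta> \<Longrightarrow> poly (T k) s = dual (n k) (V k) s"
    and deg: "\<And>k. degree (T k) \<le> d"
    and n: "filterlim n at_top sequentially"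
  obtains r c L where "strict_mono (r :: nat \<Rightarrow> nat)" "\<And>k. c k \<noteq> 0" "L \<noteq> 0" "degree L \<le> d"
    "\<And>j. j < 2 \<Longrightarrow> locally_uniform_limit sheet1
       (\<lambda>k. normalized (n (r k)) (smult (c k) (V (r k) j))) (\<lambda>s. F_of s ^ j * poly L s)"
proof -
  define N where "N = (\<lambda>k. \<Sum>i\<le>d. norm (coeff (T k) i))"
  have N: "0 < N k" for k
  proof -
    have "T k \<noteq> 0" using dual_nonzero[OF V(1) T V(2)] .
    then have "0 < norm (coeff (T k) (degree (T k)))" by simp
    also have "\<dots> \<le> N k" unfolding N_def using deg[of k] by (intro member_le_sum) auto
    finally show ?thesis .
  qed
  define T' where "T' = (\<lambda>k. smult (1 / of_real (N k)) (T k))"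
  have cT': "norm (coeff (T' k) i) = norm (coeff (T k) i) / N k" for k i
    using N[of k] by (simp add: T'_def norm_divide norm_mult)
  have sum1: "(\<Sum>i\<le>d. norm (coeff (T' k) i)) = 1" for k
  proof -
    have "(\<Sum>i\<le>d. norm (coeff (T' k) i)) = (\<Sum>i\<le>d. norm (coeff (T k) i)) / N k"
      by (simp only: cT' sum_divide_distrib)
    also have "(\<Sum>i\<le>d. norm (coeff (T k) i)) = N k" by (simp only: N_def)
    finally show ?thesis using N[of k] by simp
  qed
  have "bounded (range (\<lambda>k. coeff (T' k) i))" if "i < Suc d" for i
  proof -
    have "norm (coeff (T' k) i) \<le> 1" for k
      unfolding sum1[of k, symmetric] using that by (intro member_le_sum) auto
    then show ?thesis unfolding bounded_iff by auto
  qed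
  then obtain r l where r: "strict_mono r" "\<And>i. i < Suc d \<Longrightarrow> (\<lambda>k. coeff (T' (r k)) i) \<longlonglongrightarrow> l i"
    using common_convergent_subsequence[of "Suc d" "\<lambda>i k. coeff (T' k) i"] by blast
  define L where "L = (\<Sum>i\<le>d. monom (l i) i)"
  have cL: "coeff L i = l i" if "i \<le> d" for i
    using that by (simp add: L_def coeff_sum)
  have dL: "degree L \<le> d"
    unfolding L_def by (intro degree_sum_le) (auto intro: order_trans[OF degree_monom_le])
  have "(\<lambda>k. \<Sum>i\<le>d. norm (coeff (T' (r k)) i)) \<longlonglongrightarrow> (\<Sum>i\<le>d. norm (l i))"
    by (intro tendsto_intros r(2)) auto
  then have "(\<Sum>i\<le>d. norm (l i)) = 1" unfolding sum1 by (simp add: LIMSEQ_const_iff)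
  then have L0: "L \<noteq> 0" using cL by (auto simp: sum_nonneg_eq_0_iff)
  show ?thesis
  proof (rule that[of r "\<lambda>k. 1 / of_real (N (r k))" L])
    fix j :: nat assume j: "j < 2"
    show "locally_uniform_limit sheet1
       (\<lambda>k. normalized (n (r k)) (smult (1 / of_real (N (r k))) (V (r k) j))) (\<lambda>s. F_of s ^ j * poly L s)"
    proof (rule normalized_limit[where V = "\<lambda>k j. smult (1 / of_real (N (r k))) (V (r k) j)"
          and n = "\<lambda>k. n (r k)" and T = "\<lambda>k. T' (r k)" and d = d])
      show "filterlim (\<lambda>k. n (r k)) at_top sequentially"
        using filterlim_compose[OF n filterlim_subseq[OF r(1)]] .
      show "poly (T' (r k)) s = dual (n (r k)) (\<lambda>j. smult (1 / of_real (N (r k))) (V (r k) j)) s"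
        if "s\<^sup>2 \<noteq> 1" "\<alpha> * s\<^sup>2 \<noteq> \<beta>" for k s
        unfolding dual_smult by (simp add: T'_def T[OF that])
      show "degree (smult (1 / of_real (N (r k))) (V (r k) j)) \<le> 3 * n (r k)" if "j < 4" for k j
        using V(1)[OF that, of "r k"] degree_smult_le order_trans by blast
      show "degree (T' (r k)) \<le> d" for k
        unfolding T'_def using deg[of "r k"] degree_smult_le order_trans by blast
      show "(\<lambda>k. coeff (T' (r k)) i) \<longlonglongrightarrow> coeff L i" if "i \<le> d" for i
        using r(2)[of i] that by (simp add: cL)
    qed (use dL j in auto)
  qed (use r dL L0 N in \<open>auto simp: less_imp_neq[symmetric]\<close>)
qed

text \<open>
  A factor \<open>z - z\<^sub>i\<close> becomes \<open>znum - z\<^sub>i zden\<close> up to a power of \<open>zden\<close>, and this polynomial in \<open>s\<close>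
  vanishes at each point over \<open>z\<^sub>i\<close>.
\<close>

lemma normalized_factor:
  fixes m :: nat and z \<sigma> :: "nat \<Rightarrow> complex"
  assumes p: "p = (\<Prod>i<m. [:- z i, 1:]) * p'" "degree p \<le> 3 * n" "p \<noteq> 0"
    and z: "\<And>i. i < m \<Longrightarrow> znum (\<sigma> i) = z i * zden (\<sigma> i)"
  obtains h where "h holomorphic_on sheet1" "\<And>s. normalized n p s = (\<Prod>i<m. s - \<sigma> i) * h s"
proof -
  define NP DP where "NP = [:- \<beta>, 0, \<alpha>:]\<^sup>2 + [:- 1, 0, 1:]\<^sup>2" and "DP = smult 2 ([:- \<beta>, 0, \<alpha>:] * [:- 1, 0, 1:])"
  have NP: "poly NP s = znum s" and DP: "poly DP s = zden s" for s
    by (simp_all add: NP_def DP_def znum_def zden_def power2_eq_square algebra_simps)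
  have "\<exists>C. NP - smult (z i) DP = [:- \<sigma> i, 1:] * C" if "i < m" for i
  proof -
    have "poly (NP - smult (z i) DP) (\<sigma> i) = 0" using z[OF that] by (simp add: NP DP)
    then show ?thesis unfolding poly_eq_0_iff_dvd dvd_def .
  qed
  then obtain C where C: "\<And>i. i < m \<Longrightarrow> NP - smult (z i) DP = [:- \<sigma> i, 1:] * C i" by metis
  have lin: "znum s - z i * zden s = (s - \<sigma> i) * poly (C i) s" if "i < m" for i s
  proof -
    have "znum s - z i * zden s = poly (NP - smult (z i) DP) s" by (simp add: NP DP)
    also have "\<dots> = (s - \<sigma> i) * poly (C i) s" unfolding C[OF that] by (simp add: algebra_simps)
    finally show ?thesis .
  qed
  have p'0: "p' \<noteq> 0" and P0: "(\<Prod>i<m. [:- z i, 1:]) \<noteq> 0" using p by auto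
  have "degree (\<Prod>i<m. [:- z i, 1:]) = m"
    by (subst degree_prod_sum_eq) auto
  then have deg: "m + degree p' \<le> 3 * n" using p degree_mult_eq[OF P0 p'0] by simp
  define h where "h = (\<lambda>s. 2 * \<kappa> ^ 3 * ((\<Prod>i<m. poly (C i) s) * homogenize (3 * n - m) p' (znum s) (zden s)) * disc s
     / (8 ^ n * (zeta_num s * (s + 1)) ^ (4 * n)))"
  show ?thesis
  proof (rule that[of h])
    show "h holomorphic_on sheet1"
      unfolding h_def homogenize_def by (intro holomorphic_intros) (auto simp: sheet1_nonzero(1,2,3))
    fix s
    have "homogenize (3 * n) p (znum s) (zden s) = (\<Prod>i<m. znum s - z i * zden s) * homogenize (3 * n - m) p' (znum s) (zden s)"
      using homogenize_linear_factors[of p' "3 * n - m" m z] deg p(1) by simp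
    also have "(\<Prod>i<m. znum s - z i * zden s) = (\<Prod>i<m. s - \<sigma> i) * (\<Prod>i<m. poly (C i) s)"
      by (simp add: lin prod.distrib)
    finally show "normalized n p s = (\<Prod>i<m. s - \<sigma> i) * h s"
      by (simp add: normalized_def h_def)
  qed
qed

text \<open>
  The only point over infinity in the closure of the first sheet is \<open>s = 1\<close>, which belongs to it; other
  limits lie in the first sheet unless they project to \<open>E\<close>.
\<close>

lemma limit_in_sheet1:
  assumes g: "green_function_at_infinity (zeta_cut A B) g"
    and \<sigma>: "\<sigma> \<longlonglongrightarrow> \<tau>" "\<And>k. \<sigma> k \<in> sheet1"
    and E: "zden \<tau> \<noteq> 0 \<Longrightarrow> Some (z_of \<tau>) \<notin> first_boundary A B g"
  shows "\<tau> \<in> sheet1"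
proof -
  have "\<tau> \<in> closure sheet1" using \<sigma> closure_sequential by blast
  note cl = closure_sheet1[OF this]
  show ?thesis
  proof (cases "zden \<tau> = 0")
    case False
    then show ?thesis using boundary_of_sheet1[OF g _ _ cl E] by (simp add: zden_eq_0_iff)
  next
    case True
    have "\<alpha> * \<tau>\<^sup>2 \<noteq> \<beta>"
    proof
      assume eq: "\<alpha> * \<tau>\<^sup>2 = \<beta>"
      then have "norm (\<tau> - 1) ^ 4 \<le> 0" using cl(2) by simp
      then have "\<tau> = 1" by simp
      then show False using eq parameters by simp
    qed
    then have "\<tau>\<^sup>2 = 1" using True by (simp add: zden_eq_0_iff)
    moreover have "\<tau> \<noteq> - 1" using cl(1) by auto
    ultimately have "\<tau> = 1" by (simp add: power2_eq_1_iff)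
    then show ?thesis using one_in_sheet1 by simp
  qed
qed

lemma isCont_z_of: "zden s \<noteq> 0 \<Longrightarrow> isCont z_of s"
  unfolding z_of_def by (intro continuous_intros) auto

end

section \<open>Zeros and convergence in capacity\<close>

lemma locally_uniform_limit_subseq:
  assumes "locally_uniform_limit S q l" "strict_mono r"
  shows "locally_uniform_limit S (\<lambda>k. q (r k)) l"
  using assms filterlim_compose[OF _ filterlim_subseq[OF assms(2)]]
  unfolding locally_uniform_limit_def by blast

text \<open>
  The starting point of both compactness arguments: a sequence of indices that violate the claim.
\<close>

lemma not_eventually_sequentially_obtains:
  assumes "\<not> (\<forall>\<^sub>F n in sequentially. P n)"
  obtains \<nu> where "filterlim \<nu> at_top sequentially" "\<And>k. 1 \<le> \<nu> k" "\<And>k. \<not> P (\<nu> k)"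
proof -
  have "\<exists>n. Suc k \<le> n \<and> \<not> P n" for k
    using assms unfolding eventually_sequentially by blast
  then obtain \<nu> where \<nu>: "\<And>k. Suc k \<le> \<nu> k" "\<And>k. \<not> P (\<nu> k)" by metis
  have "filterlim \<nu> at_top sequentially"
    by (rule filterlim_at_top_mono[OF filterlim_ident], rule always_eventually, rule allI, rule Suc_leD, rule \<nu>(1))
  moreover have "1 \<le> \<nu> k" for k using \<nu>(1)[of k] by simp
  ultimately show ?thesis using that \<nu>(2) by blast
qed

lemma proots_filter_factor:
  fixes p :: "complex poly"
  assumes "d < size (filter_mset R (proots p))"
  obtains z p' where "\<And>i. i \<le> d \<Longrightarrow> R (z i)" "p = (\<Prod>i<Suc d. [:- z i, 1:]) * p'"
proof -
  obtain xs where xs: "mset xs = filter_mset R (proots p)" using ex_mset by blast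
  have len: "Suc d \<le> length xs" using assms by (simp add: xs[symmetric])
  have Rx: "R x" if "x \<in> set xs" for x
  proof -
    have "x \<in># mset xs" using that by simp
    then show ?thesis unfolding xs by simp
  qed
  let ?f = "\<lambda>x. [:- x, 1:] :: complex poly"
  have part: "proots p = mset xs + filter_mset (\<lambda>x. \<not> R x) (proots p)"
    unfolding xs by (rule multiset_partition)
  have "(\<Prod>x\<in>#proots p. ?f x) = prod_list (map ?f xs) * (\<Prod>x\<in>#filter_mset (\<lambda>x. \<not> R x) (proots p). ?f x)"
    by (subst part) (simp only: image_mset_union prod_mset.union mset_map[symmetric] prod_mset_prod_list)
  also have "prod_list (map ?f xs) = prod_list (map ?f (take (Suc d) xs)) * prod_list (map ?f (drop (Suc d) xs))"
    by (metis append_take_drop_id map_append prod_list.append)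
  also have "prod_list (map ?f (take (Suc d) xs)) = (\<Prod>i<Suc d. ?f (xs ! i))"
    using len by (simp add: prod.list_conv_set_nth atLeast0LessThan del: prod.lessThan_Suc)
  finally have fac: "p = (\<Prod>i<Suc d. ?f (xs ! i)) * smult (lead_coeff p) (prod_list (map ?f (drop (Suc d) xs)) *
      (\<Prod>x\<in>#filter_mset (\<lambda>x. \<not> R x) (proots p). ?f x))"
    using complex_poly_decompose_multiset[of p] by (simp only: mult_smult_right mult.assoc)
  show ?thesis by (rule that[OF _ fac]) (use Rx len in auto)
qed

lemma open_Some_vimage: "openin sphere_top U \<Longrightarrow> open {z. Some z \<in> U}"
proof -
  assume "openin sphere_top U"
  then have "openin euclidean {x \<in> topspace euclidean. Some x \<in> U}"
    by (rule openin_continuous_map_preimage[OF continuous_map_Some])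
  then show ?thesis by simp
qed

context cut_surface_function
begin

text \<open>
  If the bound failed for infinitely many \<open>n\<close>, choose \<open>d + 1\<close> zeros for each, lift them to the first
  sheet and let them converge. The limits are in the first sheet because the zeros stay outside the
  neighbourhood \<open>U\<close> of \<open>E\<close>; so the limit polynomial would have \<open>d + 1\<close> zeros.
\<close>

lemma zeros_attracted:
  assumes g: "green_function_at_infinity (zeta_cut A B) g"
    and V: "\<And>n j. 1 \<le> n \<Longrightarrow> j < 4 \<Longrightarrow> degree (V n j) \<le> 3 * n" "\<And>n. 1 \<le> n \<Longrightarrow> V n 0 \<noteq> 0"
    and T: "\<And>n s. 1 \<le> n \<Longrightarrow> s\<^sup>2 \<noteq> 1 \<Longrightarrow> \<alpha> * s\<^sup>2 \<noteq> \<beta> \<Longrightarrow> poly (T n) s = dual n (V n) s"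
    and deg: "\<And>n. 1 \<le> n \<Longrightarrow> degree (T n) \<le> d"
    and U: "openin sphere_top U" "first_boundary A B g \<subseteq> U"
  shows "\<forall>\<^sub>F n in sequentially. size (filter_mset (\<lambda>z. Some z \<notin> U) (proots (V n 0))) \<le> d"
proof (rule ccontr)
  assume "\<not> ?thesis"
  then obtain \<nu> where \<nu>: "filterlim \<nu> at_top sequentially" "\<And>k. 1 \<le> \<nu> k"
    "\<And>k. d < size (filter_mset (\<lambda>z. Some z \<notin> U) (proots (V (\<nu> k) 0)))"
    by (rule not_eventually_sequentially_obtains) (auto simp: not_le)
  obtain r c L where L: "strict_mono r" "\<And>k. c k \<noteq> 0" "L \<noteq> 0" "degree L \<le> d"
    "\<And>j. j < 2 \<Longrightarrow> locally_uniform_limit sheet1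
       (\<lambda>k. normalized (\<nu> (r k)) (smult (c k) (V (\<nu> (r k)) j))) (\<lambda>s. F_of s ^ j * poly L s)"
    by (rule normalized_subsequence[of "\<lambda>k. V (\<nu> k)" \<nu> "\<lambda>k. T (\<nu> k)" d,
          OF V(1)[OF \<nu>(2)] V(2)[OF \<nu>(2)] T[OF \<nu>(2)] deg[OF \<nu>(2)] \<nu>(1)]) blast+
  have "\<exists>z p'. (\<forall>i\<le>d. Some (z i) \<notin> U) \<and> V (\<nu> k) 0 = (\<Prod>i<Suc d. [:- z i, 1:]) * p'" for k
    using proots_filter_factor[OF \<nu>(3)[of k]] by metis
  then obtain z p' where z: "\<And>k i. i \<le> d \<Longrightarrow> Some (z k i) \<notin> U"
    "\<And>k. V (\<nu> k) 0 = (\<Prod>i<Suc d. [:- z k i, 1:]) * p' k"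
    by metis
  have "\<exists>s\<in>sheet1. zden s \<noteq> 0 \<and> z_of s = z k i" if "i \<le> d" for k i
  proof -
    have "Some (z k i) \<notin> first_boundary A B g" using z(1)[OF that] U(2) by blast
    then show ?thesis using sheet1_point_exists[OF g] by (metis zden_eq_0_iff)
  qed
  then have ex: "\<exists>s. s \<in> sheet1 \<and> zden s \<noteq> 0 \<and> z_of s = z k i" if "i \<le> d" for k i
    using that by blast
  define s where "s = (\<lambda>k i. SOME s. s \<in> sheet1 \<and> zden s \<noteq> 0 \<and> z_of s = z k i)"
  have s: "s k i \<in> sheet1" "zden (s k i) \<noteq> 0" "z_of (s k i) = z k i" if "i \<le> d" for k i
    using someI_ex[OF ex[OF that, of k]] unfolding s_def by blast+
  have "bounded (range (\<lambda>k. s (r k) i))" if "i < Suc d" for i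
    using bounded_sheet1 by (rule bounded_subset) (use s(1) that in auto)
  then obtain r' \<tau> where r': "strict_mono r'" "\<And>i. i < Suc d \<Longrightarrow> (\<lambda>k. s (r (r' k)) i) \<longlonglongrightarrow> \<tau> i"
    using common_convergent_subsequence[of "Suc d" "\<lambda>i k. s (r k) i"] by blast
  have \<tau>: "\<tau> i \<in> sheet1" if i: "i < Suc d" for i
  proof (rule limit_in_sheet1[OF g r'(2)[OF i]])
    show "s (r (r' k)) i \<in> sheet1" for k using s(1) i by simp
    assume "zden (\<tau> i) \<noteq> 0"
    then have "(\<lambda>k. z_of (s (r (r' k)) i)) \<longlonglongrightarrow> z_of (\<tau> i)"
      using isCont_tendsto_compose[OF isCont_z_of r'(2)[OF i]] by blast
    moreover have "z_of (s (r (r' k)) i) \<in> - {z. Some z \<in> U}" for k using s(3) z(1) i by simp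
    moreover have "closed (- {z. Some z \<in> U})" using open_Some_vimage[OF U(1)] by (simp add: closed_Compl)
    ultimately have "z_of (\<tau> i) \<in> - {z. Some z \<in> U}"
      using closed_sequentially[of "- {z. Some z \<in> U}" "\<lambda>k. z_of (s (r (r' k)) i)"] by blast
    then show "Some (z_of (\<tau> i)) \<notin> first_boundary A B g" using U(2) by auto
  qed
  let ?n = "\<lambda>k. \<nu> (r (r' k))"
  let ?p = "\<lambda>k. smult (c (r' k)) (V (?n k) 0)"
  have "\<exists>h. h holomorphic_on sheet1 \<and> (\<forall>t. normalized (?n k) (?p k) t = (\<Prod>i<Suc d. t - s (r (r' k)) i) * h t)" for k
  proof -
    have 1: "?p k = (\<Prod>i<Suc d. [:- z (r (r' k)) i, 1:]) * smult (c (r' k)) (p' (r (r' k)))"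
      unfolding z(2) by (simp only: mult_smult_right)
    have 2: "degree (?p k) \<le> 3 * ?n k" using V(1)[OF \<nu>(2), of 0] degree_smult_le order_trans by fastforce
    have 3: "?p k \<noteq> 0" using V(2)[OF \<nu>(2)] L(2) by simp
    have 4: "znum (s (r (r' k)) i) = z (r (r' k)) i * zden (s (r (r' k)) i)" if "i < Suc d" for i
      using s(2,3)[of i "r (r' k)"] that unfolding z_of_def by (simp add: divide_eq_eq)
    show ?thesis using normalized_factor[OF 1 2 3 4] by metis
  qed
  then obtain h where h: "\<And>k. h k holomorphic_on sheet1"
    "\<And>k t. normalized (?n k) (?p k) t = (\<Prod>i<Suc d. t - s (r (r' k)) i) * h k t"
    by metis
  have lim: "locally_uniform_limit sheet1 (\<lambda>k. normalized (?n k) (?p k)) (poly L)"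
    using locally_uniform_limit_subseq[OF L(5)[of 0] r'(1)] by simp
  have "Suc d \<le> degree L"
  proof (rule zeros_bounded_by_degree_of_limit[OF open_sheet1 h(1) _ lim L(3)])
    show "normalized (?n k) (?p k) t = (\<Prod>i<Suc d. t - s (r (r' k)) i) * h k t" for k t
      by (rule h(2))
    show "(\<lambda>k. s (r (r' k)) i) \<longlonglongrightarrow> \<tau> i \<and> \<tau> i \<in> sheet1 \<and> (\<forall>k. s (r (r' k)) i \<in> sheet1)"
      if "i < Suc d" for i
      using that r'(2) \<tau> s(1) by simp
  qed
  then show False using L(4) by simp
qed

text \<open>
  Numerator and denominator carry the same factors, which cancel. The argument \<open>s k\<close> varies with
  \<open>k\<close> because the exceptional set is handled by sequences.
\<close>

lemma quotient_converges_along_sheet1: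
  assumes lim: "\<And>j. j < 2 \<Longrightarrow> locally_uniform_limit sheet1
       (\<lambda>k. normalized (n k) (smult (c k) (V k j))) (\<lambda>s. F_of s ^ j * poly L s)"
    and V: "\<And>k j. j < 2 \<Longrightarrow> degree (V k j) \<le> 3 * n k"
    and s: "s \<longlonglongrightarrow> \<tau>" "\<tau> \<in> sheet1" "\<And>k. zden (s k) \<noteq> 0"
    and L: "poly L \<tau> \<noteq> 0"
  shows "(\<lambda>k. poly (V k 1) (z_of (s k)) / poly (V k 0) (z_of (s k)) - F_of (s k)) \<longlonglongrightarrow> 0"
proof -
  define q where "q = (\<lambda>j k. normalized (n k) (smult (c k) (V k j)) (s k))"
  have cF: "isCont F_of \<tau>"
    using F_of_holomorphic open_sheet1 s(2) by (metis continuous_on_eq_continuous_at holomorphic_on_imp_continuous_on)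
  have q: "q j \<longlonglongrightarrow> F_of \<tau> ^ j * poly L \<tau>" if "j < 2" for j
    unfolding q_def by (rule locally_uniform_limit_moving_point[OF lim[OF that] _ s(1,2)])
      (intro continuous_intros cF)
  have "(\<lambda>k. q 1 k / q 0 k - F_of (s k)) \<longlonglongrightarrow> (F_of \<tau> ^ 1 * poly L \<tau>) / (F_of \<tau> ^ 0 * poly L \<tau>) - F_of \<tau>"
    by (intro tendsto_intros q isCont_tendsto_compose[OF cF s(1)]) (use L in auto)
  moreover have "\<forall>\<^sub>F k in sequentially. q 1 k / q 0 k - F_of (s k)
      = poly (V k 1) (z_of (s k)) / poly (V k 0) (z_of (s k)) - F_of (s k)"
    using tendsto_imp_eventually_ne[OF q[of 0], of 0, simplified, OF L]
  proof eventually_elim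
    case (elim k)
    have e: "q j k = c k * (2 * \<kappa> ^ 3 * w_of (s k) ^ n k * disc (s k)) * poly (V k j) (z_of (s k))" if "j < 2" for j
      using normalized_eq[OF V[OF that]] s(3)[of k] unfolding q_def normalized_smult by (simp add: zden_eq_0_iff)
    define m where "m = c k * (2 * \<kappa> ^ 3 * w_of (s k) ^ n k * disc (s k))"
    have q0: "q 0 k = m * poly (V k 0) (z_of (s k))" and q1: "q 1 k = m * poly (V k 1) (z_of (s k))"
      unfolding m_def by (rule e; simp)+
    have "m \<noteq> 0" using elim unfolding q0 by auto
    then show ?case unfolding q0 q1 by simp
  qed
  ultimately have "(\<lambda>k. poly (V k 1) (z_of (s k)) / poly (V k 0) (z_of (s k)) - F_of (s k))
      \<longlonglongrightarrow> (F_of \<tau> ^ 1 * poly L \<tau>) / (F_of \<tau> ^ 0 * poly L \<tau>) - F_of \<tau>"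
    by (rule Lim_transform_eventually)
  then show ?thesis using L by simp
qed

text \<open>
  If the capacities did not tend to 0 along some sequence, the exceptional sets would leave any small
  discs around the points over which \<open>L\<close> vanishes. Points of the exceptional sets outside these discs
  accumulate at a point of the first sheet where \<open>L\<close> does not vanish, and near it the quotients
  converge.
\<close>

lemma quotients_converge_in_capacity:
  assumes g: "green_function_at_infinity (zeta_cut A B) g"
    and V: "\<And>n j. 1 \<le> n \<Longrightarrow> j < 4 \<Longrightarrow> degree (V n j) \<le> 3 * n" "\<And>n. 1 \<le> n \<Longrightarrow> V n 0 \<noteq> 0"
    and T: "\<And>n s. 1 \<le> n \<Longrightarrow> s\<^sup>2 \<noteq> 1 \<Longrightarrow> \<alpha> * s\<^sup>2 \<noteq> \<beta> \<Longrightarrow> poly (T n) s = dual n (V n) s"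
    and deg: "\<And>n. 1 \<le> n \<Longrightarrow> degree (T n) \<le> d"
    and F: "\<And>s. s \<in> sheet1 \<Longrightarrow> s\<^sup>2 \<noteq> 1 \<Longrightarrow> F (Some s) = F_of s"
  shows "converges_in_capacity (\<lambda>n. poly_quotient (V n 1) (V n 0))
           (\<lambda>y. F (sheet_point A B g y 1)) (- first_boundary A B g) sequentially"
  unfolding converges_in_capacity_def
proof (intro allI impI)
  fix p and K :: "complex set" and \<epsilon> :: real
  assume K: "compact K" and sub: "sphere_chart p ` K \<subseteq> - first_boundary A B g" and \<epsilon>: "0 < \<epsilon>"
  define Bad where "Bad = (\<lambda>n. {t\<in>K. \<epsilon> \<le> dist (poly_quotient (V n 1) (V n 0) (sphere_chart p t))
      (F (sheet_point A B g (sphere_chart p t) 1))})"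
  have "\<forall>\<^sub>F n in sequentially. log_capacity (Bad n) < a" if a: "0 < a" for a
  proof (rule ccontr)
    assume "\<not> ?thesis"
    then obtain \<nu> where \<nu>: "filterlim \<nu> at_top sequentially" "\<And>k. 1 \<le> \<nu> k"
      "\<And>k. \<not> log_capacity (Bad (\<nu> k)) < a"
      by (rule not_eventually_sequentially_obtains) auto
    obtain r c L where L: "strict_mono r" "\<And>k. c k \<noteq> 0" "L \<noteq> 0"
      "\<And>j. j < 2 \<Longrightarrow> locally_uniform_limit sheet1
         (\<lambda>k. normalized (\<nu> (r k)) (smult (c k) (V (\<nu> (r k)) j))) (\<lambda>s. F_of s ^ j * poly L s)"
      by (rule normalized_subsequence[of "\<lambda>k. V (\<nu> k)" \<nu> "\<lambda>k. T (\<nu> k)" d,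
          OF V(1)[OF \<nu>(2)] V(2)[OF \<nu>(2)] T[OF \<nu>(2)] deg[OF \<nu>(2)] \<nu>(1)]) blast+
    \<comment> \<open>the point of the plane with the local coordinate \<open>t\<close>, and its inverse\<close>
    define pt where "pt = (\<lambda>t. case p of Some b \<Rightarrow> b + t | None \<Rightarrow> 1 / t)"
    define coord where "coord = (\<lambda>z. case p of Some b \<Rightarrow> z - b | None \<Rightarrow> 1 / z)"
    have chart: "sphere_chart p t = Some (pt t)" "isCont pt t" "coord (pt t) = t" if "t \<noteq> 0 \<or> p \<noteq> None" for t
      using that by (cases p; auto simp: sphere_chart_def pt_def coord_def intro!: continuous_intros)+
    \<comment> \<open>the coordinate 0 is included because it is the point at infinity if \<open>p\<close> is \<open>None\<close>\<close>
    define X where "X = insert 0 (coord ` z_of ` {s. poly L s = 0})"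
    have "finite X" unfolding X_def using poly_roots_finite[OF L(3)] by simp
    then obtain \<rho> where \<rho>: "0 < \<rho>"
      "\<And>S. S \<subseteq> K \<Longrightarrow> S \<subseteq> (\<Union>x\<in>X. ball x \<rho>) \<Longrightarrow> log_capacity S < a"
      using log_capacity_vanishes_near_finite[OF _ compact_imp_bounded[OF K] a] by blast
    have "\<exists>t\<in>Bad (\<nu> (r k)). \<forall>x\<in>X. \<rho> \<le> dist x t" for k
    proof -
      have "Bad (\<nu> (r k)) \<subseteq> K" by (auto simp: Bad_def)
      then have "\<not> Bad (\<nu> (r k)) \<subseteq> (\<Union>x\<in>X. ball x \<rho>)" using \<rho>(2) \<nu>(3) by blast
      then show ?thesis by (force simp: not_less)
    qed
    then obtain t where t: "\<And>k. t k \<in> Bad (\<nu> (r k))" "\<And>k x. x \<in> X \<Longrightarrow> \<rho> \<le> dist x (t k)"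
      by metis
    have t0: "t k \<noteq> 0" for k using t(2)[of 0 k] \<rho>(1) by (auto simp: X_def)
    have tK: "t k \<in> K" for k using t(1)[of k] by (simp add: Bad_def)
    have "Some (pt (t k)) \<notin> first_boundary A B g" for k
      using sub tK[of k] chart(1)[of "t k"] t0[of k] by (metis ComplD image_subset_iff)
    then have "\<exists>s\<in>sheet1. zden s \<noteq> 0 \<and> z_of s = pt (t k) \<and> sheet_point A B g (Some (pt (t k))) 1 = Some s" for k
      using sheet1_point_exists[OF g] by (metis zden_eq_0_iff)
    then obtain s where s: "\<And>k. s k \<in> sheet1" "\<And>k. zden (s k) \<noteq> 0" "\<And>k. z_of (s k) = pt (t k)"
      "\<And>k. sheet_point A B g (Some (pt (t k))) 1 = Some (s k)"
      by metis
    have "bounded (range (if i = 0 then t else s))" for i :: nat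
      using bounded_subset[OF compact_imp_bounded[OF K], of "range t"] tK
        bounded_subset[OF bounded_sheet1, of "range s"] s(1) by auto
    then obtain r' l where r': "strict_mono r'" "\<And>i. i < (2::nat) \<Longrightarrow> (\<lambda>k. (if i = 0 then t else s) (r' k)) \<longlonglongrightarrow> l i"
      using common_convergent_subsequence[of 2 "\<lambda>i. if i = 0 then t else s"] by blast
    define t' \<tau> where "t' = l 0" and "\<tau> = l 1"
    have tlim: "(\<lambda>k. t (r' k)) \<longlonglongrightarrow> t'" and slim: "(\<lambda>k. s (r' k)) \<longlonglongrightarrow> \<tau>"
      using r'(2)[of 0] r'(2)[of 1] by (auto simp: t'_def \<tau>_def)
    have far: "\<rho> \<le> dist x t'" if "x \<in> X" for x
      by (rule LIMSEQ_le_const[OF tendsto_dist[OF tendsto_const tlim]]) (use t(2)[OF that] in auto)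
    have t'0: "t' \<noteq> 0" using far[of 0] \<rho>(1) by (auto simp: X_def)
    have t'K: "t' \<in> K" using closed_sequentially[OF compact_imp_closed[OF K] _ tlim] tK by blast
    have zlim: "(\<lambda>k. z_of (s (r' k))) \<longlonglongrightarrow> pt t'"
      unfolding s(3) using isCont_tendsto_compose[OF chart(2) tlim] t'0 by blast
    have "(\<lambda>k. znum (s (r' k))) \<longlonglongrightarrow> znum \<tau>"
      using isCont_tendsto_compose[OF isCont_coefficients(3) slim] .
    moreover have "(\<lambda>k. z_of (s (r' k)) * zden (s (r' k))) \<longlonglongrightarrow> pt t' * zden \<tau>"
      by (intro tendsto_intros zlim isCont_tendsto_compose[OF isCont_coefficients(4) slim])
    moreover have "z_of (s k) * zden (s k) = znum (s k)" for k
      using s(2)[of k] by (simp add: z_of_def)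
    ultimately have eq: "znum \<tau> = pt t' * zden \<tau>" using LIMSEQ_unique by simp blast
    then have zd: "zden \<tau> \<noteq> 0" using znum_nonzero[of \<tau>] by auto
    then have z\<tau>: "z_of \<tau> = pt t'" using eq by (simp add: z_of_def)
    have "Some (z_of \<tau>) \<notin> first_boundary A B g"
      using sub t'K chart(1)[of t'] t'0 unfolding z\<tau> by (metis ComplD image_subset_iff)
    then have \<tau>: "\<tau> \<in> sheet1" using limit_in_sheet1[OF g slim s(1)] by blast
    have L\<tau>: "poly L \<tau> \<noteq> 0"
    proof
      assume "poly L \<tau> = 0"
      then have "coord (z_of \<tau>) \<in> X" by (auto simp: X_def)
      then have "t' \<in> X" unfolding z\<tau> using chart(3)[of t'] t'0 by simp
      then show False using far[of t'] \<rho>(1) by simp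
    qed
    let ?n = "\<lambda>k. \<nu> (r (r' k))"
    have "(\<lambda>k. poly (V (?n k) 1) (z_of (s (r' k))) / poly (V (?n k) 0) (z_of (s (r' k))) - F_of (s (r' k))) \<longlonglongrightarrow> 0"
    proof (rule quotient_converges_along_sheet1[where n = ?n and c = "\<lambda>k. c (r' k)" and V = "\<lambda>k. V (?n k)" and L = L])
      show "locally_uniform_limit sheet1 (\<lambda>k. normalized (?n k) (smult (c (r' k)) (V (?n k) j)))
          (\<lambda>s. F_of s ^ j * poly L s)" if "j < 2" for j
        using locally_uniform_limit_subseq[OF L(4)[OF that] r'(1)] .
      show "degree (V (?n k) j) \<le> 3 * ?n k" if "j < 2" for k j using V(1)[OF \<nu>(2)] that by simp
    qed (use slim \<tau> s(2) L\<tau> in auto)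
    from tendstoD[OF this \<epsilon>] obtain k where
      k: "norm (poly (V (?n k) 1) (z_of (s (r' k))) / poly (V (?n k) 0) (z_of (s (r' k))) - F_of (s (r' k))) < \<epsilon>"
      unfolding eventually_sequentially by auto
    have "\<epsilon> \<le> dist (poly_quotient (V (?n k) 1) (V (?n k) 0) (Some (pt (t (r' k)))))
        (F (sheet_point A B g (Some (pt (t (r' k)))) 1))"
      using t(1)[of "r' k"] chart(1)[of "t (r' k)"] t0[of "r' k"] by (simp add: Bad_def)
    also have "\<dots> = norm (poly (V (?n k) 1) (z_of (s (r' k))) / poly (V (?n k) 0) (z_of (s (r' k))) - F_of (s (r' k)))"
    proof -
      have sq: "(s (r' k))\<^sup>2 \<noteq> 1" using s(2)[of "r' k"] by (simp add: zden_eq_0_iff)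
      show ?thesis unfolding s(4) F[OF s(1) sq] s(3) poly_quotient_def option.case dist_norm ..
    qed
    finally show False using k by simp
  qed
  then show "((\<lambda>n. log_capacity {t\<in>K. \<epsilon> \<le> dist (poly_quotient (V n 1) (V n 0) (sphere_chart p t))
      (F (sheet_point A B g (sphere_chart p t) 1))}) \<longlongrightarrow> 0) sequentially"
    unfolding Bad_def by (intro order_tendstoI) auto
qed

end

section \<open>The branch of the function at infinity\<close>

text \<open>
  The branch of the square root is the right one because \<open>(\<zeta>\<^sup>2 - 1) / (\<zeta>\<^sup>2 + 1)\<close> has positive real
  part for \<open>|\<zeta>| > 1\<close>. If the point were in \<open>[-1,1]\<close>, the argument of the root would be real and not
  positive, and its root would be imaginary.
\<close>

lemma joukowski_phi_inverse:
  fixes \<zeta> :: complex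
  assumes \<zeta>: "1 < norm \<zeta>"
  shows "joukowski_phi ((\<zeta> + 1 / \<zeta>) / 2) = \<zeta>" "(\<zeta> + 1 / \<zeta>) / 2 \<notin> closed_segment (- 1) 1"
proof -
  define u v z where "u = \<zeta>\<^sup>2" and "v = (\<zeta>\<^sup>2 - 1) / (\<zeta>\<^sup>2 + 1)" and "z = (\<zeta> + 1 / \<zeta>) / 2"
  have z0: "\<zeta> \<noteq> 0" using \<zeta> by auto
  have "1 < norm \<zeta> ^ 2" using \<zeta> by (simp add: one_less_power)
  then have u: "1 < norm u" by (simp add: u_def norm_power)
  have u1: "u + 1 \<noteq> 0"
  proof
    assume "u + 1 = 0"
    then have "u = - 1" by (simp add: eq_neg_iff_add_eq_0)
    then show False using u by simp
  qed
  have zz: "z = (u + 1) / (2 * \<zeta>)" using z0 by (simp add: z_def u_def power2_eq_square field_simps)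
  have "1 - 1 / z\<^sup>2 = v\<^sup>2"
  proof -
    have "1 - 1 / z\<^sup>2 = ((u + 1)\<^sup>2 - 4 * u) / (u + 1)\<^sup>2"
      using u1 unfolding zz by (simp add: power_divide power_mult_distrib u_def diff_divide_distrib)
    also have "(u + 1)\<^sup>2 - 4 * u = (u - 1)\<^sup>2" by (simp add: power2_eq_square algebra_simps)
    finally show ?thesis by (simp add: v_def u_def power_divide)
  qed
  moreover have "0 < Re v"
  proof -
    have "1 < (norm u)\<^sup>2" using u by (simp add: one_less_power)
    moreover have "Re ((u - 1) * cnj (u + 1)) = (norm u)\<^sup>2 - 1"
      unfolding cmod_power2 by (simp add: power2_eq_square algebra_simps)
    ultimately show ?thesis unfolding v_def u_def[symmetric] Re_complex_div_gt_0 by simp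
  qed
  ultimately have c: "csqrt (1 - 1 / z\<^sup>2) = v" "0 < Re v" using csqrt_unique by auto
  have "z * v = (u - 1) / (2 * \<zeta>)" unfolding zz v_def u_def[symmetric] using u1 by simp
  then have "joukowski_phi z = (u + 1) / (2 * \<zeta>) + (u - 1) / (2 * \<zeta>)"
    unfolding joukowski_phi_def c by (simp add: zz)
  also have "\<dots> = \<zeta>" using z0 by (simp add: u_def power2_eq_square field_simps)
  finally show "joukowski_phi ((\<zeta> + 1 / \<zeta>) / 2) = \<zeta>" by (simp add: z_def)
  show "(\<zeta> + 1 / \<zeta>) / 2 \<notin> closed_segment (- 1) 1"
  proof
    assume "(\<zeta> + 1 / \<zeta>) / 2 \<in> closed_segment (- 1) 1"
    then obtain t where t: "0 \<le> t" "t \<le> 1" "z = (1 - t) *\<^sub>R (- 1) + t *\<^sub>R 1"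
      unfolding z_def closed_segment_def by blast
    define x where "x = 2 * t - 1"
    have x: "\<bar>x\<bar> \<le> 1" "z = of_real x" using t by (auto simp: x_def scaleR_conv_of_real algebra_simps)
    have "z \<noteq> 0" using zz u1 z0 by simp
    then have "x \<noteq> 0" using x by auto
    moreover have "x\<^sup>2 \<le> 1" using x(1) by (simp add: abs_square_le_1)
    ultimately have "1 - 1 / x\<^sup>2 \<le> 0" by (simp add: field_simps)
    moreover have "1 - 1 / z\<^sup>2 = of_real (1 - 1 / x\<^sup>2)" by (simp add: x)
    ultimately have "Re (csqrt (1 - 1 / z\<^sup>2)) = 0" by (simp add: csqrt_of_real_nonpos)
    then show False using c by simp
  qed
qed

context cut_surface
begin

lemma cut_function_values:
  assumes s: "s\<^sup>2 \<noteq> 1" "\<alpha> * s\<^sup>2 \<noteq> \<beta>"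
  shows "(A - 1 / zeta_of s) * (B - 1 / zeta_of s) = A * B * (\<alpha> - \<beta>)\<^sup>2 * s\<^sup>2 / (zeta_num s)\<^sup>2"
    and "(A - zeta_of s) * (B - zeta_of s) = A * B * (pp s * qq s) / (s\<^sup>2 - 1)\<^sup>2"
proof -
  have AB1: "A * \<alpha> = 1" "B * \<beta> = 1" using parameters by (auto simp: \<alpha>_eq \<beta>_eq)
  define x y where "x = zeta_num s" and "y = s\<^sup>2 - 1"
  have ne: "x \<noteq> 0" "y \<noteq> 0" using s by (auto simp: x_def y_def)
  have xy: "A * x - y = A * (\<alpha> - \<beta>)" "B * x - y = B * (\<alpha> - \<beta>) * s\<^sup>2"
    "A * y - x = A * qq s" "B * y - x = B * pp s"
  proof -
    have "A * x - y = (A * \<alpha> - 1) * s\<^sup>2 + (1 - A * \<beta>)" by (simp add: x_def y_def algebra_simps)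
    then show "A * x - y = A * (\<alpha> - \<beta>)" using AB1 by (simp add: algebra_simps)
    have "B * x - y = (B * \<alpha> - 1) * s\<^sup>2 + (1 - B * \<beta>)" by (simp add: x_def y_def algebra_simps)
    then show "B * x - y = B * (\<alpha> - \<beta>) * s\<^sup>2" using AB1 by (simp add: algebra_simps)
    have "A * qq s = A * s\<^sup>2 - (A * \<alpha>) * \<alpha> * s\<^sup>2 - A + (A * \<alpha>) * \<beta>"
      by (simp add: qq_def power2_eq_square algebra_simps)
    then show "A * y - x = A * qq s" using AB1 by (simp add: x_def y_def algebra_simps)
    have "B * pp s = B * s\<^sup>2 - (B * \<beta>) * \<alpha> * s\<^sup>2 - B + (B * \<beta>) * \<beta>"
      by (simp add: pp_def power2_eq_square algebra_simps)
    then show "B * y - x = B * pp s" using AB1 by (simp add: x_def y_def algebra_simps)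
  qed
  have ze: "zeta_of s = x / y" by (simp add: zeta_of_def x_def y_def)
  have 1: "c - 1 / zeta_of s = (c * x - y) / x" "c - zeta_of s = (c * y - x) / y" for c
    unfolding ze using ne by (simp_all add: field_simps)
  show "(A - 1 / zeta_of s) * (B - 1 / zeta_of s) = A * B * (\<alpha> - \<beta>)\<^sup>2 * s\<^sup>2 / (zeta_num s)\<^sup>2"
    unfolding 1(1) xy x_def[symmetric] by (simp add: power2_eq_square)
  show "(A - zeta_of s) * (B - zeta_of s) = A * B * (pp s * qq s) / (s\<^sup>2 - 1)\<^sup>2"
    unfolding 1(2) xy y_def[symmetric] by (simp add: power2_eq_square mult_ac)
qed

lemma zeta_of_first_copy:
  assumes "s\<^sup>2 \<noteq> 1" "0 < Re s"
  shows "surf_zeta A B (Some s) = Some (zeta_of s)" "surf_side (Some s) = 1" "zeta_of s \<notin> zeta_cut A B"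
proof -
  show 1: "surf_zeta A B (Some s) = Some (zeta_of s)" using assms by (simp add: surf_zeta_Some_eq)
  show 2: "surf_side (Some s) = 1" using assms by (simp add: surf_side_def)
  show "zeta_of s \<notin> zeta_cut A B"
    using surf_side_eq_0_iff[OF AB(1) parameters(1,2), of "Some s"] 1 2 by auto
qed

text \<open>
  The quotient of both sides has a constant square and is continuous on a connected set, the right
  half-plane without finitely many points; so it is constant itself.
\<close>

lemma obtain_branch_constant:
  assumes ft_hol: "ft holomorphic_on - zeta_cut A B"
    and ft_eq: "\<And>\<zeta>. \<zeta> \<notin> zeta_cut A B \<Longrightarrow> \<zeta> \<noteq> 0 \<Longrightarrow> (ft \<zeta>)\<^sup>2 = 1 / ((A - 1 / \<zeta>) * (B - 1 / \<zeta>))"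
  obtains \<kappa> where "\<kappa>\<^sup>2 * (\<alpha> - \<beta>)\<^sup>2 = \<alpha> * \<beta>"
    "\<And>s. 0 < Re s \<Longrightarrow> s\<^sup>2 \<noteq> 1 \<Longrightarrow> \<alpha> * s\<^sup>2 \<noteq> \<beta> \<Longrightarrow> ft (zeta_of s) = \<kappa> * zeta_num s / s"
proof -
  define X where "X = {s. s\<^sup>2 = 1 \<or> \<alpha> * s\<^sup>2 = \<beta>}"
  have finX: "finite X" unfolding X_def by (rule finite_poles)
  define S where "S = {s. 0 < Re s} - X"
  have S: "s\<^sup>2 \<noteq> 1" "\<alpha> * s\<^sup>2 \<noteq> \<beta>" "0 < Re s" "s \<noteq> 0" if "s \<in> S" for s
    using that by (auto simp: S_def X_def)
  have connS: "connected S" unfolding S_def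
  proof (rule connected_open_delete_finite)
    show "open {s. 0 < Re s}" by (rule open_halfspace_Re_gt)
    have "convex {s. 0 < Re s}" by (rule convex_halfspace_Re_gt)
    then show "connected {s. 0 < Re s}" by (rule convex_connected)
  qed (use finX in auto)
  define h where "h = (\<lambda>s. ft (zeta_of s) * s / zeta_num s)"
  define e where "e = \<alpha> * \<beta> / (\<alpha> - \<beta>)\<^sup>2"
  have h2: "(h s)\<^sup>2 = e" if "s \<in> S" for s
  proof -
    note s = S[OF that]
    have "(ft (zeta_of s))\<^sup>2 = 1 / (A * B * (\<alpha> - \<beta>)\<^sup>2 * s\<^sup>2 / (zeta_num s)\<^sup>2)"
      using ft_eq[OF zeta_of_first_copy(3)[OF s(1,3)] zeta_of_nonzero[OF s(1,2)]]
      unfolding cut_function_values(1)[OF s(1,2)] .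
    also have "\<dots> = e * (zeta_num s)\<^sup>2 / s\<^sup>2"
      using parameters by (simp add: e_def \<alpha>_eq[symmetric] \<beta>_eq[symmetric] field_simps) (simp add: \<alpha>_eq \<beta>_eq)
    finally show ?thesis
      using s by (simp add: h_def power_divide power_mult_distrib)
  qed
  have "continuous_on S zeta_of" unfolding zeta_of_def[abs_def]
    using S by (intro continuous_intros) auto
  moreover have "zeta_of ` S \<subseteq> - zeta_cut A B" using zeta_of_first_copy(3) S by auto
  ultimately have "continuous_on S (\<lambda>s. ft (zeta_of s))"
    using holomorphic_on_imp_continuous_on[OF ft_hol] continuous_on_compose2 by blast
  then have "continuous_on S h" unfolding h_def using S by (intro continuous_intros) auto
  moreover have "finite (h ` S)"
  proof (rule finite_subset)
    show "h ` S \<subseteq> {csqrt e, - csqrt e}"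
    proof
      fix w assume "w \<in> h ` S"
      then have "w\<^sup>2 = (csqrt e)\<^sup>2" using h2 by auto
      then show "w \<in> {csqrt e, - csqrt e}" unfolding power2_eq_iff by auto
    qed
  qed simp
  ultimately have "h constant_on S" using continuous_finite_range_constant[OF connS] by blast
  then obtain \<kappa> where \<kappa>: "\<And>s. s \<in> S \<Longrightarrow> h s = \<kappa>" unfolding constant_on_def by blast
  have "infinite {s::complex. 0 < Re s}"
  proof -
    have "(\<lambda>n::nat. of_nat (Suc n) :: complex) ` UNIV \<subseteq> {s. 0 < Re s}" by auto
    moreover have "infinite ((\<lambda>n::nat. of_nat (Suc n) :: complex) ` UNIV)"
      by (rule range_inj_infinite) (auto simp: inj_on_def simp del: of_nat_Suc)
    ultimately show ?thesis using finite_subset by blast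
  qed
  then have "S \<noteq> {}" unfolding S_def using finX by (metis Diff_eq_empty_iff finite_subset)
  then obtain s0 where "s0 \<in> S" by blast
  then have "\<kappa>\<^sup>2 = e" using h2 \<kappa> by blast
  then have "\<kappa>\<^sup>2 * (\<alpha> - \<beta>)\<^sup>2 = \<alpha> * \<beta>" using parameters by (simp add: e_def)
  moreover have "ft (zeta_of s) = \<kappa> * zeta_num s / s" if "0 < Re s" "s\<^sup>2 \<noteq> 1" "\<alpha> * s\<^sup>2 \<noteq> \<beta>" for s
  proof -
    have "s \<in> S" using that by (simp add: S_def X_def)
    then show ?thesis using \<kappa>[of s] S(2,4)[of s] by (auto simp: h_def field_simps)
  qed
  ultimately show ?thesis using that by blast
qed

end

context cut_surface_function
begin

text \<open>
  Near \<open>s = - 1\<close> the point \<open>s\<close> is on the second copy and \<open>F\<close> is \<open>- f\<close>, which makes the first factor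
  vanish. Near the two points over \<open>\<zeta> = 0\<close>, the branch at infinity is the value over \<open>1 / \<zeta>\<close>, whose
  square is known, and the second factor vanishes.
\<close>

lemma branch_at_other_infinities:
  assumes ft: "\<And>s. 0 < Re s \<Longrightarrow> s\<^sup>2 \<noteq> 1 \<Longrightarrow> \<alpha> * s\<^sup>2 \<noteq> \<beta> \<Longrightarrow> ft (zeta_of s) = F_of s"
    and f_eq: "\<And>z. z \<notin> closed_segment (- 1) 1 \<Longrightarrow>
          (f z)\<^sup>2 = 1 / ((A - 1 / joukowski_phi z) * (B - 1 / joukowski_phi z))"
    and ft_f: "\<And>z. z \<notin> closed_segment (- 1) 1 \<Longrightarrow> ft (joukowski_phi z) = f z"
    and s0: "s0 = - 1 \<or> \<alpha> * s0\<^sup>2 = \<beta>"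
  shows "\<forall>\<^sub>F s in at s0. (s * f (z_of s) + \<kappa> * zeta_num s) *
        ((f (z_of s))\<^sup>2 * (pp s * qq s) - \<alpha> * \<beta> * (s\<^sup>2 - 1)\<^sup>2) = 0"
  using s0
proof
  assume s0: "s0 = - 1"
  have "filterlim zeta_of at_infinity (at s0)"
    unfolding zeta_of_def
  proof (rule filterlim_divide_at_infinity)
    show "((\<lambda>s. zeta_num s) \<longlongrightarrow> \<alpha> * s0\<^sup>2 - \<beta>) (at s0)" by (intro tendsto_intros)
    show "\<alpha> * s0\<^sup>2 - \<beta> \<noteq> 0" using parameters by (simp add: s0)
    have "((\<lambda>s::complex. s\<^sup>2 - 1) \<longlongrightarrow> s0\<^sup>2 - 1) (at s0)" by (intro tendsto_intros)
    then show "filterlim (\<lambda>s. s\<^sup>2 - 1) (at 0) (at s0)"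
      unfolding filterlim_at using eventually_not_pole[of s0] by (auto simp: s0 elim!: eventually_mono)
  qed
  then have "\<forall>\<^sub>F s in at s0. 2 \<le> norm (zeta_of s)"
    unfolding filterlim_at_infinity[OF order_refl] by auto
  moreover have "\<forall>\<^sub>F s in at s0. Re s < 0"
  proof -
    have "((\<lambda>s. Re s) \<longlongrightarrow> Re s0) (at s0)" by (intro tendsto_intros)
    then show ?thesis by (rule order_tendstoD) (simp add: s0)
  qed
  moreover have "\<forall>\<^sub>F s in at s0. s\<^sup>2 \<noteq> 1 \<and> \<alpha> * s\<^sup>2 \<noteq> \<beta>" by (rule eventually_not_pole)
  ultimately show ?thesis
  proof eventually_elim
    case (elim s)
    then have big: "1 < norm (zeta_of s)" and s: "s\<^sup>2 \<noteq> 1" "\<alpha> * s\<^sup>2 \<noteq> \<beta>" by auto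
    have "f (z_of s) = ft (zeta_of s)"
      unfolding z_of_zeta[OF s] using joukowski_phi_inverse[OF big] ft_f by metis
    also have "\<dots> = ft (zeta_of (- s))" by (simp add: zeta_of_def)
    also have "\<dots> = F_of (- s)" using ft[of "- s"] elim by simp
    finally have "f (z_of s) = F_of (- s)" .
    moreover have "s \<noteq> 0" using elim by auto
    ultimately have "s * f (z_of s) = - \<kappa> * zeta_num s" by (simp add: F_of_def)
    then show ?case by simp
  qed
next
  assume s0: "\<alpha> * s0\<^sup>2 = \<beta>"
  have s01: "s0\<^sup>2 \<noteq> 1" using s0 parameters by auto
  have "(zeta_of \<longlongrightarrow> (\<alpha> * s0\<^sup>2 - \<beta>) / (s0\<^sup>2 - 1)) (at s0)"
    unfolding zeta_of_def[abs_def] using s01 by (intro tendsto_intros) auto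
  then have "((\<lambda>s. norm (zeta_of s)) \<longlongrightarrow> norm ((\<alpha> * s0\<^sup>2 - \<beta>) / (s0\<^sup>2 - 1))) (at s0)" by (rule tendsto_norm)
  then have "\<forall>\<^sub>F s in at s0. norm (zeta_of s) < 1" by (rule order_tendstoD) (simp add: s0)
  moreover have "\<forall>\<^sub>F s in at s0. s\<^sup>2 \<noteq> 1 \<and> \<alpha> * s\<^sup>2 \<noteq> \<beta>" by (rule eventually_not_pole)
  moreover have "\<forall>\<^sub>F s in at s0. pp s * qq s \<noteq> 0"
  proof (rule tendsto_imp_eventually_ne)
    show "((\<lambda>s. pp s * qq s) \<longlongrightarrow> pp s0 * qq s0) (at s0)"
      using isCont_coefficients(1,2) unfolding isCont_def by (intro tendsto_mult)
    have "pp s0 = qq s0" using pp_qq_identities(2)[of s0] s0 by simp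
    then show "pp s0 * qq s0 \<noteq> 0" using pp_or_qq[of s0] by simp
  qed
  ultimately show ?thesis
  proof eventually_elim
    case (elim s)
    then have s: "s\<^sup>2 \<noteq> 1" "\<alpha> * s\<^sup>2 \<noteq> \<beta>" by auto
    define \<zeta> where "\<zeta> = 1 / zeta_of s"
    have z0: "zeta_of s \<noteq> 0" by (rule zeta_of_nonzero[OF s])
    then have big: "1 < norm \<zeta>" using elim by (simp add: \<zeta>_def norm_divide)
    have zeq: "z_of s = (\<zeta> + 1 / \<zeta>) / 2" unfolding z_of_zeta[OF s] \<zeta>_def by simp
    have "(f (z_of s))\<^sup>2 = 1 / ((A - 1 / \<zeta>) * (B - 1 / \<zeta>))"
      using f_eq[OF joukowski_phi_inverse(2)[OF big]] unfolding joukowski_phi_inverse(1)[OF big] zeq .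
    also have "\<dots> = 1 / (A * B * (pp s * qq s) / (s\<^sup>2 - 1)\<^sup>2)"
      using cut_function_values(2)[OF s] by (simp add: \<zeta>_def)
    also have "\<dots> = \<alpha> * \<beta> * (s\<^sup>2 - 1)\<^sup>2 / (pp s * qq s)"
      by (simp add: \<alpha>_eq \<beta>_eq)
    finally show ?case using elim by simp
  qed
qed

end

theorem theorem6:
  fixes A B :: complex
    and f ft :: "complex \<Rightarrow> complex"
    and F :: "surf \<Rightarrow> complex"
    and g :: "complex \<Rightarrow> real"
    and Q :: "nat \<Rightarrow> complex poly"
    and P :: "nat \<Rightarrow> nat \<Rightarrow> complex poly"
    and q :: "nat \<Rightarrow> nat \<Rightarrow> nat \<Rightarrow> complex poly"
    and p :: "nat \<Rightarrow> nat \<Rightarrow> nat \<Rightarrow> surf"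
    and G :: "surf \<Rightarrow> surf \<Rightarrow> surf \<Rightarrow> complex"
    and a b :: surf
    and ap :: "nat \<Rightarrow> surf"
    and \<Lambda> :: "nat set"
    and M :: "surf set"
  assumes AB: "A \<noteq> B" "norm A > 1" "norm B > 1" "0 \<notin> zeta_cut A B"
    \<comment> \<open>the function \<open>f\<close> in the plane, its lift \<open>ft\<close> to the \<open>\<zeta>\<close>-plane and its extension \<open>F\<close>
        to the surface\<close>
    and f_hol: "f holomorphic_on - closed_segment (- 1) 1"
    and f_eq: "\<And>z. z \<notin> closed_segment (- 1) 1 \<Longrightarrow>
          (f z)\<^sup>2 = 1 / ((A - 1 / joukowski_phi z) * (B - 1 / joukowski_phi z))"
    and ft_hol: "ft holomorphic_on - zeta_cut A B"
    and ft_eq: "\<And>\<zeta>. \<zeta> \<notin> zeta_cut A B \<Longrightarrow> \<zeta> \<noteq> 0 \<Longrightarrow>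
          (ft \<zeta>)\<^sup>2 = 1 / ((A - 1 / \<zeta>) * (B - 1 / \<zeta>))"
    and ft_f: "\<And>z. z \<notin> closed_segment (- 1) 1 \<Longrightarrow> ft (joukowski_phi z) = f z"
    and F_mero: "sphere_meromorphic F"
    and F_first: "\<And>x \<zeta>. surf_zeta A B x = Some \<zeta> \<Longrightarrow> surf_side x = 1 \<Longrightarrow> F x = ft \<zeta>"
    and F_second: "\<And>x \<zeta>. surf_zeta A B x = Some \<zeta> \<Longrightarrow> surf_side x = - 1 \<Longrightarrow> F x = - ft \<zeta>"
    and green: "green_function_at_infinity (zeta_cut A B) g"
    \<comment> \<open>\<open>Q n\<close> and \<open>P n j\<close> have index \<open>3n\<close> in the usual notation\<close>
    and typeII: "\<And>n. n \<ge> 1 \<Longrightarrow> Q n \<noteq> 0 \<and> degree (Q n) \<le> 3 * n"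
      "\<And>n j. n \<ge> 1 \<Longrightarrow> j \<in> {1,2,3} \<Longrightarrow> degree (P n j) \<le> 3 * n \<and>
          (\<lambda>z. poly (Q n) z * f z ^ j - poly (P n j) z) \<in> O[at_infinity](\<lambda>z. 1 / z ^ (n + 1))"
    and typeI: "\<And>n k. n \<ge> 1 \<Longrightarrow> k \<in> {1,2,3} \<Longrightarrow>
          (\<exists>i\<le>3. q n k i \<noteq> 0) \<and> degree (q n k 0) \<le> n \<and>
          (\<forall>i\<in>{1,2,3}. (i = k \<longrightarrow> degree (q n k i) \<le> n) \<and>
             (i \<noteq> k \<longrightarrow> degree (q n k i) \<le> n - 1)) \<and>
          (\<lambda>z. \<Sum>i\<le>3. poly (q n k i) z * f z ^ i) \<in> O[at_infinity](\<lambda>z. 1 / z ^ (3 * n + 1))"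
    \<comment> \<open>the branch points and the divisors of the remainders\<close>
    and ab: "surf_zeta A B a = Some (1 / A)" "surf_zeta A B b = Some (1 / B)"
    and divisor: "\<And>n k x. n \<ge> 1 \<Longrightarrow> k \<in> {1,2,3} \<Longrightarrow>
          sphere_order (typeI_remainder A B F (q n k)) x =
            (3 * int n + 1) * of_bool (x = surf_lift A B None)
            - int n * of_bool (x = surf_lift A B (Some 0))
            - int n * of_bool (x = surf_swap (surf_lift A B (Some 0)))
            - int n * of_bool (x = surf_swap (surf_lift A B None))
            - 3 * (of_bool (x = a) + of_bool (x = b))
            + (\<Sum>j=1..5. of_bool (x = p n k j))"
    and poles: "image_mset ap (mset_set {1..6}) = replicate_mset 3 a + replicate_mset 3 b"
    and third_kind: "\<And>z1 z2. z1 \<noteq> z2 \<Longrightarrow> third_kind_integral z1 z2 (G z1 z2)"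
    and third_kind_const: "\<And>z1. \<exists>c. \<forall>x. exp (G z1 z1 x) = c"
    and Lambda: "infinite \<Lambda>" "0 \<notin> \<Lambda>"
    and M: "finite M"
    and Delta_bounds: "\<And>K. compactin sphere_top K \<Longrightarrow> K \<inter> M = {} \<Longrightarrow>
          \<exists>C1 C2 :: real. 0 < C1 \<and>
            (\<forall>n\<in>\<Lambda>. \<forall>x\<in>K. \<forall>l. Delta_modulus A B g G ap (p n) (surf_proj A B x) l \<longrightarrow>
               ereal C1 \<le> l \<and> l \<le> ereal C2)"
  shows "(\<exists>N::nat. \<forall>U. openin sphere_top U \<longrightarrow> first_boundary A B g \<subseteq> U \<longrightarrow>
            (\<forall>\<^sub>F n in inf sequentially (principal \<Lambda>).
               size (filter_mset (\<lambda>z. Some z \<notin> U) (proots (Q n))) \<le> N)) \<and>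
         converges_in_capacity (\<lambda>n. poly_quotient (P n 1) (Q n))
           (\<lambda>y. F (sheet_point A B g y 1))
           (- first_boundary A B g) (inf sequentially (principal \<Lambda>))"
proof -
  interpret cut_surface A B "1 / A" "1 / B"
    by unfold_locales (use AB in auto)
  obtain \<kappa> where k: "\<kappa>\<^sup>2 * (1 / A - 1 / B)\<^sup>2 = 1 / A * (1 / B)"
    "\<And>s. 0 < Re s \<Longrightarrow> s\<^sup>2 \<noteq> 1 \<Longrightarrow> 1 / A * s\<^sup>2 \<noteq> 1 / B \<Longrightarrow>
       ft (zeta_of s) = \<kappa> * (1 / A * s\<^sup>2 - 1 / B) / s"
    using obtain_branch_constant[OF ft_hol ft_eq] by blast
  interpret cut_surface_function A B "1 / A" "1 / B" \<kappa>
    by unfold_locales (rule k(1))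
  have ftF: "ft (zeta_of s) = F_of s" if "0 < Re s" "s\<^sup>2 \<noteq> 1" "1 / A * s\<^sup>2 \<noteq> 1 / B" for s
    using k(2)[OF that] unfolding F_of_def .
  define V where "V = (\<lambda>n j. if j = 0 then Q n else P n j)"
  have V: "degree (V n j) \<le> 3 * n" if "1 \<le> n" "j < 4" for n j
  proof -
    have "j = 0 \<or> j \<in> {1, 2, 3}" using that by auto
    then show ?thesis using typeII that by (auto simp: V_def)
  qed
  have V0: "V n 0 \<noteq> 0" if "1 \<le> n" for n using typeII(1)[OF that] by (simp add: V_def)
  have "\<exists>T. degree T \<le> 6 \<and> (\<forall>s. s\<^sup>2 \<noteq> 1 \<longrightarrow> 1 / A * s\<^sup>2 \<noteq> 1 / B \<longrightarrow> poly T s = dual n (V n) s)"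
    if n: "1 \<le> n" for n
  proof -
    have tII: "(\<lambda>z. poly (V n 0) z * f z ^ j - poly (V n j) z) \<in> O[at_infinity](\<lambda>z. 1 / z ^ (n + 1))"
      if "j \<in> {1,2,3}" for j
      using typeII(2)[OF n that] that by (auto simp: V_def)
    have br: "\<forall>\<^sub>F s in at s0. (s * f (z_of s) + \<kappa> * (1 / A * s\<^sup>2 - 1 / B)) *
        ((f (z_of s))\<^sup>2 * (pp s * qq s) - 1 / A * (1 / B) * (s\<^sup>2 - 1)\<^sup>2) = 0"
      if "s0 = - 1 \<or> 1 / A * s0\<^sup>2 = 1 / B" for s0
      using ftF f_eq ft_f that by (rule branch_at_other_infinities)
    show ?thesis
    proof (rule dual_polynomial[where V = "V n" and n = n and f = f])
      show "degree (V n j) \<le> 3 * n" if "j < 4" for j using V[OF n that] .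
    qed (use tII br in blast)+
  qed
  then obtain T where T: "\<And>n. 1 \<le> n \<Longrightarrow> degree (T n) \<le> 6"
    "\<And>n s. 1 \<le> n \<Longrightarrow> s\<^sup>2 \<noteq> 1 \<Longrightarrow> 1 / A * s\<^sup>2 \<noteq> 1 / B \<Longrightarrow> poly (T n) s = dual n (V n) s"
    by metis
  have F: "F (Some s) = F_of s" if "s \<in> sheet1" "s\<^sup>2 \<noteq> 1" for s
  proof -
    have R: "0 < Re s" using that(1) by (simp add: sheet1_def)
    show ?thesis
      using F_first[OF zeta_of_first_copy(1,2)[OF that(2) R]] ftF[OF R that(2) sheet1_nonzero(3)[OF that(1)]] by simp
  qed
  have le: "inf sequentially (principal \<Lambda>) \<le> sequentially" by simp
  have "\<forall>\<^sub>F n in inf sequentially (principal \<Lambda>). size (filter_mset (\<lambda>z. Some z \<notin> U) (proots (Q n))) \<le> 6"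
    if "openin sphere_top U" "first_boundary A B g \<subseteq> U" for U
    using filter_leD[OF le zeros_attracted[OF green V V0 T(2) T(1) that]] by (simp add: V_def)
  moreover have "converges_in_capacity (\<lambda>n. poly_quotient (P n 1) (Q n))
      (\<lambda>y. F (sheet_point A B g y 1)) (- first_boundary A B g) sequentially"
    using quotients_converge_in_capacity[OF green V V0 T(2) T(1) F] by (simp add: V_def)
  then have "converges_in_capacity (\<lambda>n. poly_quotient (P n 1) (Q n))
      (\<lambda>y. F (sheet_point A B g y 1)) (- first_boundary A B g) (inf sequentially (principal \<Lambda>))"
    unfolding converges_in_capacity_def using tendsto_mono[OF le] by blast
  ultimately show ?thesis by blast
qed

end
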